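(* Let $I=[0,\infty)$, let $X$ be a complex Banach space, let $\mathcal{A}$ be a multivalued linear operator in $X$ satisfying condition (P) (stated in the context) with constants $c>0$ and $\beta\in(0,1]$, let $(T(t))_{t>0}$ be the degenerate semigroup generated by $\mathcal{A}$, let $M>0$ be a constant with $\|T(t)\|\le Me^{-ct}t^{\beta-1}$ for $t>0$, and let $u_0\in X$ be a point of continuity of $(T(t))_{t>0}$. Let $f:I\times X\to X$ and suppose that the following conditions hold: (i) $g\in APS^p(I\times X:X)$ with $p>1$, and there exist a number $r\ge\max(p,p/(p-1))$ and a function $L_g\in L^r_S(I)$ such that $\|g(t,x)-g(t,y)\|\le L_g(t)\|x-y\|$ for all $t\in I$ and $x,y\in X$. (ii) $f(t,x)=g(t,x)+h(t,x)$ for all $t\ge0$ and $x\in X$, where $\hat h\in C_0(I\times X:L^q([0,1]:X))$ and $q=\frac{pr}{p+r}$. (iii) $\beta=1$ provided $r=p/(p-1)$, and $\frac{pr}{pr-p-r}<\frac1{1-\beta}$ provided $r>p/(p-1)$. (iv) There is a locally bounded positive function $L_f(\cdot)$ such that $\|f(t,x)-f(t,y)\|\le L_f(t)\|x-y\|$ for a.e. $t>0$ and all $x,y\in X$, and such that $M_n<1$ for some $n\in\mathbb{N}$, where $$M_n:=M^n\sup_{t\ge0}e^{-ct}\int_0^t\int_0^{x_n}\cdots\int_0^{x_2}e^{cx_1}(t-x_n)^{\beta-1}\prod_{i=2}^n(x_i-x_{i-1})^{\beta-1}\prod_{i=1}^nL_f(x_i)\,dx_1\,dx_2\cdots dx_n.$$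 Then there exists a unique asymptotically almost periodic (mild) solution of the inclusion $$u'(t)\in\mathcal{A}u(t)+f(t,u(t)),\ t\ge0,\qquad u(0)=u_0.$$
   Context: A multivalued linear operator (MLO) in $X$ is a map $\mathcal{A}:X\to P(X)$ whose graph $\{(x,y):y\in\mathcal{A}x\}$ is a linear subspace of $X\times X$ (with $D(\mathcal{A})=\{x:\mathcal{A}x\ne\emptyset\}$). Its resolvent set $\rho(\mathcal{A})$ is the set of $\lambda\in\mathbb{C}$ such that $R(\lambda-\mathcal{A})=X$ (range) and $R(\lambda:\mathcal{A}):=(\lambda-\mathcal{A})^{-1}$ is a single-valued bounded operator on $X$. Condition (P): there exist finite constants $c,M_0>0$ and $\beta\in(0,1]$ such that $\Psi:=\{\lambda\in\mathbb{C}:\Re\lambda\ge-c(|\Im\lambda|+1)\}\subseteq\rho(\mathcal{A})$ and $\|R(\lambda:\mathcal{A})\|\le M_0(1+|\lambda|)^{-\beta}$ for $\lambda\in\Psi$. Under (P), $\mathcal{A}$ generates a degenerate strongly continuous semigroup $(T(t))_{t>0}\subseteq L(X)$, given by $T(t)=\frac1{2\pi i}\int_\Gamma e^{\lambda t}R(\lambda:\mathcal{A})\,d\lambda$, $t>0$, where $\Gamma$ is the curve $\lambda=-c(|\eta|+1)+i\eta$, $\eta$ running from $-\infty$ to $\infty$; it satisfies $\|T(t)\|=O(e^{-ct}t^{\beta-1})$, $t>0$. A point $u_0$ is a point of continuity of the semigroup if $\lim_{t\to0+}T(t)u_0=u_0$; put $T(0)u_0:=u_0$. A mild solution of the inclusion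 is a function $u\in C([0,\infty):X)$ with $u(t)=T(t)u_0+\int_0^tT(t-s)f(s,u(s))\,ds$ for all $t\ge0$. Convention: $1/(1-\beta)=+\infty$ if $\beta=1$. $L^r_S(I)$ is the space of scalar functions $h\in L^r_{loc}(I)$ with $\sup_{t\in I}\left(\int_t^{t+1}|h(s)|^r\,ds\right)^{1/r}<\infty$. A bounded continuous $u:[0,\infty)\to X$ is asymptotically almost periodic if for every $\epsilon>0$ there are $l>0$, $m>0$ such that every subinterval of $[0,\infty)$ of length $l$ contains $\tau$ with $\|u(t+\tau)-u(t)\|\le\epsilon$ for all $t\ge m$. For $F:I\times X\to X$ put $\hat F(t,x):=F(t+\cdot,x)$, a function on $[0,1]$. $APS^p(I\times X:X)$ is the set of $F:I\times X\to X$ such that $\hat F:I\times X\to L^p([0,1]:X)$ is almost periodic, i.e. bounded, continuous, and such that for every $\epsilon>0$ and compact $K\subseteq X$ there is $l>0$ such that every subinterval of $I$ of length $l$ contains $\tau$ with $\|\hat F(t+\tau,x)-\hat F(t,x)\|\le\epsilon$ for all $t\in I$, $x\in K$. For a Banach space $Z$, $C_0(I\times X:Z)$ is the space of continuous $\phi:I\times X\to Z$ with $\lim_{t\to\infty}\phi(t,x)=0$ uniformly for $x$ in any compact subset of $X$. *)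

theory Defs
  imports "HOL-Analysis.Analysis"
begin

class complex_banach = banach +
  fixes scaleC :: "complex \<Rightarrow> 'a \<Rightarrow> 'a" (infixr "*\<^sub>C" 75)
  assumes scaleC_add_right: "z *\<^sub>C (x + y) = z *\<^sub>C x + z *\<^sub>C y"
    and scaleC_add_left: "(z + w) *\<^sub>C x = z *\<^sub>C x + w *\<^sub>C x"
    and scaleC_scaleC: "z *\<^sub>C w *\<^sub>C x = (z * w) *\<^sub>C x"
    and scaleC_of_real: "complex_of_real r *\<^sub>C x = r *\<^sub>R x"
    and norm_scaleC: "norm (z *\<^sub>C x) = cmod z * norm x"

lemma bounded_linear_scaleC: "bounded_linear (\<lambda>x::'a::complex_banach. z *\<^sub>C x)"
proof (rule bounded_linear_intro[where K = "cmod z"])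
  show "z *\<^sub>C (r *\<^sub>R x) = r *\<^sub>R (z *\<^sub>C x)" for r and x :: 'a
    by (metis scaleC_of_real scaleC_scaleC mult.commute)
qed (simp_all add: scaleC_add_right norm_scaleC mult.commute)

instantiation blinfun :: (real_normed_vector, complex_banach) complex_banach
begin

lift_definition scaleC_blinfun :: "complex \<Rightarrow> 'a \<Rightarrow>\<^sub>L 'b \<Rightarrow> 'a \<Rightarrow>\<^sub>L 'b"
  is "\<lambda>z B x. z *\<^sub>C B x"
  by (rule bounded_linear_compose[OF bounded_linear_scaleC])

instance
proof
  fix z w :: complex and r :: real and B C :: "'a \<Rightarrow>\<^sub>L 'b"
  show "z *\<^sub>C (B + C) = z *\<^sub>C B + z *\<^sub>C C"
    by transfer (simp add: scaleC_add_right)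
  show "(z + w) *\<^sub>C B = z *\<^sub>C B + w *\<^sub>C B"
    by transfer (simp add: scaleC_add_left)
  show "z *\<^sub>C w *\<^sub>C B = (z * w) *\<^sub>C B"
    by transfer (simp add: scaleC_scaleC)
  show "complex_of_real r *\<^sub>C B = r *\<^sub>R B"
    by transfer (simp add: scaleC_of_real)
  have le: "norm (v *\<^sub>C D) \<le> cmod v * norm D" for v and D :: "'a \<Rightarrow>\<^sub>L 'b"
  proof (rule norm_blinfun_bound)
    fix x
    have "norm (blinfun_apply (v *\<^sub>C D) x) = cmod v * norm (blinfun_apply D x)"
      by (simp add: scaleC_blinfun.rep_eq norm_scaleC)
    also have "\<dots> \<le> cmod v * (norm D * norm x)"
      by (intro mult_left_mono norm_blinfun) simp
    finally show "norm (blinfun_apply (v *\<^sub>C D) x) \<le> cmod v * norm D * norm x"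
      by (simp add: mult.assoc)
  qed simp
  show "norm (z *\<^sub>C B) = cmod z * norm B"
  proof (cases "z = 0")
    case True
    then show ?thesis using le[of z B] by simp
  next
    case False
    have "inverse z *\<^sub>C z *\<^sub>C B = B"
    proof (rule blinfun_eqI)
      fix x
      have "complex_of_real 1 *\<^sub>C blinfun_apply B x = blinfun_apply B x"
        by (simp only: scaleC_of_real scaleR_one)
      then show "blinfun_apply (inverse z *\<^sub>C z *\<^sub>C B) x = blinfun_apply B x"
        using False by (simp add: scaleC_blinfun.rep_eq scaleC_scaleC)
    qed
    then have "norm B \<le> cmod (inverse z) * norm (z *\<^sub>C B)"
      using le[of "inverse z" "z *\<^sub>C B"] by simp
    then have "cmod z * norm B \<le> norm (z *\<^sub>C B)"
      using False by (simp add: norm_inverse norm_divide field_simps)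
    with le[of z B] show ?thesis by simp
  qed
qed

end

text \<open>The integral \<^term>\<open>has_bochner_integral\<close> of the library is restricted to second countable
  (that is, separable) Banach spaces. For a general Banach space Borel measurability has to be
  replaced by strong measurability, that is, almost everywhere approximation by simple functions.\<close>

definition strongly_measurable :: "'b measure \<Rightarrow> ('b \<Rightarrow> 'a::real_normed_vector) \<Rightarrow> bool" where
  "strongly_measurable M f \<longleftrightarrow>
     (\<exists>s. (\<forall>i. simple_function M (s i)) \<and> (AE x in M. (\<lambda>i::nat. s i x) \<longlonglongrightarrow> f x))"

definition has_strong_bochner_integral ::
    "'b measure \<Rightarrow> ('b \<Rightarrow> 'a::real_normed_vector) \<Rightarrow> 'a \<Rightarrow> bool" where
  "has_strong_bochner_integral M f z \<longleftrightarrow>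
     strongly_measurable M f \<and>
     (\<exists>s. (\<forall>i::nat. Bochner_Integration.simple_bochner_integrable M (s i)) \<and>
          (\<lambda>i. \<integral>\<^sup>+x. ennreal (norm (f x - s i x)) \<partial>M) \<longlonglongrightarrow> 0 \<and>
          (\<lambda>i. Bochner_Integration.simple_bochner_integral M (s i)) \<longlonglongrightarrow> z)"

definition strong_bochner_integral :: "'b measure \<Rightarrow> ('b \<Rightarrow> 'a::real_normed_vector) \<Rightarrow> 'a" where
  "strong_bochner_integral M f = (THE z. has_strong_bochner_integral M f z)"

definition mlo :: "('a::complex_banach \<Rightarrow> 'a set) \<Rightarrow> bool" where
  "mlo A \<longleftrightarrow> 0 \<in> A 0 \<and>
     (\<forall>x y x' y'. y \<in> A x \<longrightarrow> y' \<in> A x' \<longrightarrow> y + y' \<in> A (x + x')) \<and>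
     (\<forall>z x y. y \<in> A x \<longrightarrow> z *\<^sub>C y \<in> A (z *\<^sub>C x))"

definition mlo_range :: "('a \<Rightarrow> 'a set) \<Rightarrow> 'a set" where
  "mlo_range A = (\<Union>x. A x)"

definition mlo_inverse :: "('a \<Rightarrow> 'a set) \<Rightarrow> 'a \<Rightarrow> 'a set" where
  "mlo_inverse A y = {x. y \<in> A x}"

definition mlo_shift :: "complex \<Rightarrow> ('a::complex_banach \<Rightarrow> 'a set) \<Rightarrow> 'a \<Rightarrow> 'a set" where
  "mlo_shift z A x = {z *\<^sub>C x - y | y. y \<in> A x}"

text \<open>Elements of \<^typ>\<open>'a \<Rightarrow>\<^sub>L 'a\<close> are only real linear, but an inverse of a multivalued linear
  operator which is single valued and everywhere defined is automatically complex linear.\<close>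

definition resolvent_set :: "('a::complex_banach \<Rightarrow> 'a set) \<Rightarrow> complex set" where
  "resolvent_set A = {z. mlo_range (mlo_shift z A) = UNIV \<and>
     (\<exists>R :: 'a \<Rightarrow>\<^sub>L 'a. \<forall>y. mlo_inverse (mlo_shift z A) y = {blinfun_apply R y})}"

definition resolvent :: "('a::complex_banach \<Rightarrow> 'a set) \<Rightarrow> complex \<Rightarrow> 'a \<Rightarrow>\<^sub>L 'a" where
  "resolvent A z = (THE R. \<forall>y. mlo_inverse (mlo_shift z A) y = {blinfun_apply R y})"

definition condition_P :: "('a::complex_banach \<Rightarrow> 'a set) \<Rightarrow> real \<Rightarrow> real \<Rightarrow> bool" where
  "condition_P A c \<beta> \<longleftrightarrow> c > 0 \<and> 0 < \<beta> \<and> \<beta> \<le> 1 \<and>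
     (\<exists>M0>0. \<forall>z. Re z \<ge> - c * (\<bar>Im z\<bar> + 1) \<longrightarrow>
        z \<in> resolvent_set A \<and> norm (resolvent A z) \<le> M0 * (1 + cmod z) powr (- \<beta>))"

definition Gamma_curve :: "real \<Rightarrow> real \<Rightarrow> complex" where
  "Gamma_curve c \<eta> = Complex (- c * (\<bar>\<eta>\<bar> + 1)) \<eta>"

text \<open>Only the values at \<open>t > 0\<close> are meaningful.\<close>

definition degenerate_semigroup ::
    "('a::complex_banach \<Rightarrow> 'a set) \<Rightarrow> real \<Rightarrow> real \<Rightarrow> 'a \<Rightarrow>\<^sub>L 'a" where
  "degenerate_semigroup A c t =
     (1 / (2 * of_real pi * \<i>)) *\<^sub>C
       strong_bochner_integral lebesgue
         (\<lambda>\<eta>. (exp (Gamma_curve c \<eta> * of_real t) * vector_derivative (Gamma_curve c) (at \<eta>))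
                 *\<^sub>C resolvent A (Gamma_curve c \<eta>))"

definition point_of_continuity :: "(real \<Rightarrow> 'a \<Rightarrow>\<^sub>L 'a) \<Rightarrow> 'a::complex_banach \<Rightarrow> bool" where
  "point_of_continuity T u0 \<longleftrightarrow> ((\<lambda>t. blinfun_apply (T t) u0) \<longlongrightarrow> u0) (at_right 0)"

text \<open>The convention \<open>T(0) u0 = u0\<close> is built in; the value of \<open>T(0)\<close> inside the integral is
  irrelevant. Existence of the Bochner integral is part of the definition.\<close>

definition mild_solution ::
    "(real \<Rightarrow> 'a \<Rightarrow>\<^sub>L 'a) \<Rightarrow> (real \<Rightarrow> 'a \<Rightarrow> 'a) \<Rightarrow> 'a::complex_banach \<Rightarrow> (real \<Rightarrow> 'a) \<Rightarrow> bool" where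
  "mild_solution T f u0 u \<longleftrightarrow> continuous_on {0..} u \<and>
     (\<forall>t\<ge>0. \<exists>J. has_strong_bochner_integral (lebesgue_on {0..t})
                  (\<lambda>s. blinfun_apply (T (t - s)) (f s (u s))) J \<and>
                u t = (if t = 0 then u0 else blinfun_apply (T t) u0) + J)"

text \<open>Elements of \<open>L\<^sup>p([0,1]:X)\<close> are represented by functions, without passing to classes modulo
  null functions.\<close>

definition in_Lp :: "real \<Rightarrow> (real \<Rightarrow> 'a::real_normed_vector) \<Rightarrow> bool" where
  "in_Lp p F \<longleftrightarrow> strongly_measurable (lebesgue_on {0..1}) F \<and>
     integrable (lebesgue_on {0..1}) (\<lambda>s. norm (F s) powr p)"

definition Lp_norm :: "real \<Rightarrow> (real \<Rightarrow> 'a::real_normed_vector) \<Rightarrow> real" where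
  "Lp_norm p F = (LINT s|lebesgue_on {0..1}. norm (F s) powr p) powr (1 / p)"

definition bochner_transform :: "(real \<Rightarrow> 'x \<Rightarrow> 'a) \<Rightarrow> real \<Rightarrow> 'x \<Rightarrow> real \<Rightarrow> 'a" where
  "bochner_transform F t x = (\<lambda>s. F (t + s) x)"

definition Lp_continuous ::
    "real \<Rightarrow> (real \<Rightarrow> 'x::topological_space \<Rightarrow> real \<Rightarrow> 'a::real_normed_vector) \<Rightarrow> bool" where
  "Lp_continuous p \<Phi> \<longleftrightarrow> (\<forall>t\<ge>0. \<forall>x. in_Lp p (\<Phi> t x)) \<and>
     (\<forall>t\<ge>0. \<forall>x. ((\<lambda>(t', x'). Lp_norm p (\<lambda>s. \<Phi> t' x' s - \<Phi> t x s)) \<longlongrightarrow> 0)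
                    (at (t, x) within {0..} \<times> UNIV))"

definition APS :: "real \<Rightarrow> (real \<Rightarrow> 'x::topological_space \<Rightarrow> 'a::real_normed_vector) \<Rightarrow> bool" where
  "APS p F \<longleftrightarrow>
     Lp_continuous p (bochner_transform F) \<and>
     (\<exists>B. \<forall>t\<ge>0. \<forall>x. Lp_norm p (bochner_transform F t x) \<le> B) \<and>
     (\<forall>\<epsilon>>0. \<forall>K. compact K \<longrightarrow>
        (\<exists>l>0. \<forall>a\<ge>0. \<exists>\<tau>\<in>{a..a + l}. \<forall>t\<ge>0. \<forall>x\<in>K.
           Lp_norm p (\<lambda>s. bochner_transform F (t + \<tau>) x s - bochner_transform F t x s) \<le> \<epsilon>))"

definition C0_Lp ::
    "real \<Rightarrow> (real \<Rightarrow> 'x::topological_space \<Rightarrow> real \<Rightarrow> 'a::real_normed_vector) \<Rightarrow> bool" where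
  "C0_Lp q \<Phi> \<longleftrightarrow> Lp_continuous q \<Phi> \<and>
     (\<forall>K. compact K \<longrightarrow> uniform_limit K (\<lambda>t x. Lp_norm q (\<Phi> t x)) (\<lambda>x. 0) at_top)"

definition Lr_S :: "real \<Rightarrow> (real \<Rightarrow> real) \<Rightarrow> bool" where
  "Lr_S r L \<longleftrightarrow>
     L \<in> borel_measurable (lebesgue_on {0..}) \<and>
     (\<forall>a b. 0 \<le> a \<longrightarrow> integrable (lebesgue_on {a..b}) (\<lambda>s. \<bar>L s\<bar> powr r)) \<and>
     bdd_above ((\<lambda>t. (LINT s|lebesgue_on {t..t + 1}. \<bar>L s\<bar> powr r) powr (1 / r)) ` {0..})"

definition asymptotically_almost_periodic :: "(real \<Rightarrow> 'a::real_normed_vector) \<Rightarrow> bool" where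
  "asymptotically_almost_periodic u \<longleftrightarrow>
     continuous_on {0..} u \<and> bounded (u ` {0..}) \<and>
     (\<forall>\<epsilon>>0. \<exists>l>0. \<exists>m>0. \<forall>a\<ge>0. \<exists>\<tau>\<in>{a..a + l}. \<forall>t\<ge>m. norm (u (t + \<tau>) - u t) \<le> \<epsilon>)"

text \<open>\<open>iterated_integral n t F x\<close> is
  \<open>\<integral>\<^sub>0\<^sup>t \<integral>\<^sub>0\<^bsup>x\<^sub>n\<^esup> \<dots> \<integral>\<^sub>0\<^bsup>x\<^sub>2\<^esup> F(x\<^sub>1, \<dots>, x\<^sub>n) dx\<^sub>1 \<dots> dx\<^sub>n\<close>; the entries
  \<open>x 1, \<dots>, x n\<close> of the initial point \<open>x\<close> are overwritten.\<close>

fun iterated_integral ::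
    "nat \<Rightarrow> real \<Rightarrow> ((nat \<Rightarrow> real) \<Rightarrow> ennreal) \<Rightarrow> (nat \<Rightarrow> real) \<Rightarrow> ennreal" where
  "iterated_integral 0 b F x = F x"
| "iterated_integral (Suc k) b F x =
     (\<integral>\<^sup>+y\<in>{0..b}. iterated_integral k y F (x(Suc k := y)) \<partial>lebesgue)"

definition M_const :: "real \<Rightarrow> real \<Rightarrow> real \<Rightarrow> (real \<Rightarrow> real) \<Rightarrow> nat \<Rightarrow> ennreal" where
  "M_const c \<beta> M L n = ennreal (M ^ n) *
     (SUP t\<in>{0..}. ennreal (exp (- c * t)) *
        iterated_integral n t
          (\<lambda>x. ennreal (exp (c * x 1) * (t - x n) powr (\<beta> - 1) *
                 (\<Prod>i=2..n. (x i - x (i - 1)) powr (\<beta> - 1)) * (\<Prod>i=1..n. L (x i))))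
          (\<lambda>_. 0))"

end

theory Submission
  imports Defs
begin

text \<open>The solution is the fixed point of \<open>\<Upsilon> u(t) = T(t)u\<^sub>0 + \<integral>\<^sub>0\<^sup>t T(t - s) f(s, u(s)) ds\<close> on the
  asymptotically almost periodic functions. Only \<open>\<parallel>T(t)\<parallel> \<le> k(t) = M e\<^bsup>-ct\<^esup> t\<^bsup>\<beta>-1\<^esup>\<close> and the norm
  continuity of \<open>T\<close> are used, so every smallness condition is measured by convolution with the scalar
  kernel \<open>k\<close>; condition (iii) makes this convolution bounded by Stepanov norms of exponent at least
  \<open>q\<close>. Since \<open>\<parallel>\<Upsilon>\<^sup>n u - \<Upsilon>\<^sup>n v\<parallel> \<le> M\<^sub>n \<parallel>u - v\<parallel>\<close>, the iterate \<open>\<Upsilon>\<^sup>n\<close> is a contraction.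

  For invariance of the almost periodic functions, the range of \<open>u\<close> is replaced by a finite net; the
  error is controlled by the Lipschitz constants, and this needs the convolution of \<open>L\<^sub>f\<close> with \<open>k\<close> to
  be bounded although \<open>L\<^sub>f\<close> is only locally bounded. That bound is hidden in \<open>M\<^sub>n < 1\<close>: as \<open>k\<close>
  decreases, the \<open>n\<close>-fold integral dominates a constant times the \<open>n\<close>-th power of the simple one.\<close>

section \<open>Strong measurability\<close>

text \<open>The space is not assumed separable, so measurability and the Bochner integral are built
  from simple functions, and one estimate for the norm of a difference of two integrals does the
  work of linearity. Sizes are extended nonnegative convolutions with \<open>k\<close>, so
  finiteness is asked only when a vector integral is formed. The finite net is forced by the
  hypotheses: Stepanov norms of \<open>g\<close> and \<open>h\<close> integrate over a window with
  the point of the space held fixed, while \<open>u(s)\<close> moves inside the window.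
  \<open>h\<close> inherits a Lipschitz bound from \<open>f - g\<close>, which is where the
  convolution of \<open>L\<^sub>f\<close> enters. The almost periods of \<open>g\<close> and of
  \<open>u\<close> are unrelated sets, so common ones have to be manufactured; those of
  \<open>u\<close> hold only after a transient, whose influence dies out with the exponential factor
  of \<open>k\<close>. The singularity of \<open>T\<close> at \<open>0\<close> obstructs continuity
  of the convolution: the operator is frozen at a small time, with an error uniform in
  \<open>t\<close>. The lower bound for the iterated integral comes from halving the mass of
  \<open>k\<close> times \<open>L\<^sub>f\<close>: one half feeds the inner integrals, the other the
  outermost one.\<close>

lemma (in complete_measure) borel_measurable_AE_eq:
  fixes f g :: "'a \<Rightarrow> real"
  assumes g: "g \<in> borel_measurable M" and eq: "AE x in M. f x = g x"
  shows "f \<in> borel_measurable M"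
proof (rule measurableI)
  fix S :: "real set" assume "S \<in> sets borel"
  then have "g -` S \<inter> space M \<in> sets M" using g by (rule measurable_sets[rotated])
  moreover have "AE x in M. x \<in> g -` S \<inter> space M \<longleftrightarrow> x \<in> f -` S \<inter> space M"
    using eq by eventually_elim auto
  ultimately show "f -` S \<inter> space M \<in> sets M"
    by (intro in_sets_AE[of "g -` S \<inter> space M" "f -` S \<inter> space M"]) auto
qed simp

text \<open>Strong measurability demands convergence only almost everywhere; completeness of the
  measure lets the limit be arbitrary on the exceptional null set.\<close>

lemma (in complete_measure) borel_measurable_AE_LIMSEQ:
  fixes f :: "'a \<Rightarrow> real"
  assumes g: "\<And>i::nat. g i \<in> borel_measurable M" and lim: "AE x in M. (\<lambda>i. g i x) \<longlonglongrightarrow> f x"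
  shows "f \<in> borel_measurable M"
proof (rule borel_measurable_AE_eq)
  show "(\<lambda>x. lim (\<lambda>i. g i x)) \<in> borel_measurable M"
    by (rule borel_measurable_lim_metric[OF g])
  show "AE x in M. f x = lim (\<lambda>i. g i x)"
    using lim by eventually_elim (simp add: limI)
qed

lemma complete_measure_lebesgue_on:
  assumes "S \<in> sets lebesgue"
  shows "complete_measure (lebesgue_on S)"
proof
  fix A B assume "B \<subseteq> A" "A \<in> null_sets (lebesgue_on S)"
  then show "B \<in> sets (lebesgue_on S)"
    using assms completion.complete2[of B A]
    by (auto simp: null_sets_restrict_space sets_restrict_space_iff)
qed

lemma complete_measure_lebesgue: "complete_measure lebesgue"
  by (rule completion.complete_measure_axioms)

text \<open>A simple function has finitely many values with measurable level sets, so
  \<open>g\<close> may be any function; it is applied to the distance from a fixed point.\<close>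

lemma simple_function_measurable_comp:
  fixes g :: "'b \<Rightarrow> 'c::t2_space"
  assumes "simple_function M s"
  shows "(\<lambda>x. g (s x)) \<in> borel_measurable M"
  using simple_function_compose[OF assms, of g] by (simp add: comp_def borel_measurable_simple_function)

lemma strongly_measurable_norm_diff:
  assumes "complete_measure M" "strongly_measurable M f"
  shows "(\<lambda>x. norm (f x - d)) \<in> borel_measurable M"
proof -
  obtain s where s: "\<And>i. simple_function M (s i)" and lim: "AE x in M. (\<lambda>i::nat. s i x) \<longlonglongrightarrow> f x"
    using assms(2) unfolding strongly_measurable_def by auto
  show ?thesis
  proof (rule complete_measure.borel_measurable_AE_LIMSEQ[OF assms(1)])
    show "(\<lambda>x. norm (s i x - d)) \<in> borel_measurable M" for i
      by (rule simple_function_measurable_comp[OF s])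
    show "AE x in M. (\<lambda>i. norm (s i x - d)) \<longlonglongrightarrow> norm (f x - d)"
      using lim by eventually_elim (intro tendsto_intros)
  qed
qed

lemma strongly_measurable_norm:
  assumes "complete_measure M" "strongly_measurable M f"
  shows "(\<lambda>x. norm (f x)) \<in> borel_measurable M"
  using strongly_measurable_norm_diff[OF assms, of 0] by simp

lemma strongly_measurable_ennreal_norm:
  assumes "complete_measure M" "strongly_measurable M f"
  shows "(\<lambda>x. ennreal (norm (f x))) \<in> borel_measurable M"
  by (rule measurable_compose[OF strongly_measurable_norm[OF assms] measurable_ennreal])

lemma simple_bochner_integrable_imp_strongly_measurable:
  "Bochner_Integration.simple_bochner_integrable M s \<Longrightarrow> strongly_measurable M s"
  unfolding strongly_measurable_def simple_bochner_integrable.simps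
  by (intro exI[of _ "\<lambda>_. s"]) auto

text \<open>The countable set collects the finitely many values of each approximating simple
  function; almost every value of \<open>f\<close> is a limit of them.\<close>

lemma strongly_measurable_separable:
  assumes "strongly_measurable M f"
  obtains D where "countable D" "AE x in M. f x \<in> closure D"
proof -
  obtain s where s: "\<And>i. simple_function M (s i)" and lim: "AE x in M. (\<lambda>i::nat. s i x) \<longlonglongrightarrow> f x"
    using assms unfolding strongly_measurable_def by auto
  let ?D = "\<Union>i. s i ` space M"
  have "countable ?D"
    using countable_finite[OF simple_functionD(1)[OF s]] by blast
  moreover have "AE x in M. f x \<in> closure ?D"
    using lim AE_space
  proof eventually_elim
    case (elim x)
    then show ?case
      unfolding closure_sequential by (intro exI[of _ "\<lambda>i. s i x"]) auto
  qed
  ultimately show ?thesis by (rule that)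
qed

text \<open>The nearest of the first points of a dense sequence that starts with \<open>0\<close>: this makes the
  approximations dominated by \<open>f\<close>.\<close>

lemma dominated_simple_approximation:
  fixes f :: "'b \<Rightarrow> 'a::real_normed_vector"
  assumes D: "countable D" "AE x in M. f x \<in> closure D"
    and meas: "\<And>d. d \<in> insert 0 D \<Longrightarrow> (\<lambda>x. norm (f x - d)) \<in> borel_measurable M"
  obtains s where "\<And>i::nat. simple_function M (s i)" "AE x in M. (\<lambda>i. s i x) \<longlonglongrightarrow> f x"
    "\<And>i x. norm (f x - s i x) \<le> norm (f x)"
proof -
  define e where "e n = (case n of 0 \<Rightarrow> 0 | Suc k \<Rightarrow> from_nat_into (insert 0 D) k)" for n
  have e0: "e 0 = 0" by (simp add: e_def)
  have e_in: "e n \<in> insert 0 D" for n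
    using from_nat_into[of "insert 0 D"] by (auto simp: e_def split: nat.split)
  have e_surj: "\<exists>n. e n = d" if "d \<in> D" for d
  proof -
    have "d \<in> insert 0 D" "countable (insert 0 D)" using D(1) that by auto
    then obtain k where "from_nat_into (insert 0 D) k = d"
      using from_nat_into_surj by metis
    then show ?thesis by (intro exI[of _ "Suc k"]) (simp add: e_def)
  qed
  have [measurable]: "(\<lambda>x. norm (f x - e n)) \<in> borel_measurable M" for n
    by (rule meas[OF e_in])
  define P where "P i j x \<longleftrightarrow> j \<le> i \<and> (\<forall>k\<in>{..i}. norm (f x - e j) \<le> norm (f x - e k))" for i j x
  define m where "m i x = (LEAST j. P i j x)" for i x
  have P: "P i (m i x) x" for i x
  proof -
    have "\<exists>j\<in>{..i}. \<forall>k\<in>{..i}. norm (f x - e j) \<le> norm (f x - e k)"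
      using ex_is_arg_min_if_finite[of "{..i}" "\<lambda>j. norm (f x - e j)"]
      by (auto simp: is_arg_min_linorder)
    then have "\<exists>j. P i j x" by (auto simp: P_def)
    then show ?thesis unfolding m_def by (rule LeastI_ex)
  qed
  have "Measurable.pred M (P i j)" for i j
    unfolding P_def[abs_def] by measurable
  then have m_meas: "m i \<in> measurable M (count_space UNIV)" for i
    unfolding m_def[abs_def] by (intro measurable_Least) auto
  have m_simple: "simple_function M (m i)" for i
    unfolding simple_function_eq_measurable
    using m_meas[of i] finite_subset[of "m i ` space M" "{..i}"] P by (auto simp: P_def)
  show ?thesis
  proof (rule that[of "\<lambda>i x. e (m i x)"])
    show "simple_function M (\<lambda>x. e (m i x))" for i
      using simple_function_compose[OF m_simple, of e i] by (simp add: comp_def)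
    show "norm (f x - e (m i x)) \<le> norm (f x)" for i x
      using P[of i x] e0 by (auto simp: P_def dest!: bspec[of _ _ 0])
    show "AE x in M. (\<lambda>i. e (m i x)) \<longlonglongrightarrow> f x"
      using D(2)
    proof eventually_elim
      case (elim x)
      show ?case
      proof (rule metric_LIMSEQ_I)
        fix r :: real assume "0 < r"
        then obtain d where d: "d \<in> D" "dist d (f x) < r"
          using elim by (auto simp: closure_approachable)
        obtain n where n: "e n = d" using e_surj[OF d(1)] by auto
        have "dist (e (m i x)) (f x) < r" if "n \<le> i" for i
          using P[of i x] that n d(2) by (auto simp: P_def dist_norm norm_minus_commute dest!: bspec[of _ _ n])
        then show "\<exists>no. \<forall>i\<ge>no. dist (e (m i x)) (f x) < r" by auto
      qed
    qed
  qed
qed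

text \<open>A metric form of Pettis' theorem: once the range is essentially separable, measurability
  of the distances to fixed points suffices, because nearest points of a countable set can be
  selected measurably.\<close>

lemma strongly_measurableI:
  fixes f :: "'b \<Rightarrow> 'a::real_normed_vector"
  assumes "countable D" "AE x in M. f x \<in> closure D"
    and "\<And>d. (\<lambda>x. norm (f x - d)) \<in> borel_measurable M"
  shows "strongly_measurable M f"
  using dominated_simple_approximation[OF assms] unfolding strongly_measurable_def by metis

text \<open>Simple functions that approximate each \<open>F i\<close> only pointwise cannot be
  diagonalised directly. Instead both parts of the criterion above, separable range and measurable
  distances, pass to the limit.\<close>

lemma strongly_measurable_AE_LIMSEQ:
  fixes f :: "'b \<Rightarrow> 'a::real_normed_vector"
  assumes M: "complete_measure M" and F: "\<And>i::nat. strongly_measurable M (F i)"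
    and lim: "AE x in M. (\<lambda>i. F i x) \<longlonglongrightarrow> f x"
  shows "strongly_measurable M f"
proof -
  have "\<exists>D. \<forall>i. countable (D i) \<and> (AE x in M. F i x \<in> closure (D i))"
    using strongly_measurable_separable[OF F] by (intro choice allI) metis
  then obtain D where D: "\<And>i. countable (D i)" "\<And>i. AE x in M. F i x \<in> closure (D i)"
    by auto
  show ?thesis
  proof (rule strongly_measurableI)
    show "countable (\<Union>i. D i)" using D by auto
    have "AE x in M. \<forall>i. F i x \<in> closure (D i)" using D by (simp add: AE_all_countable)
    with lim show "AE x in M. f x \<in> closure (\<Union>i. D i)"
    proof eventually_elim
      case (elim x)
      have "F i x \<in> closure (\<Union>i. D i)" for i
        using elim(2) closure_mono[of "D i" "\<Union>i. D i"] by blast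
      then show ?case using elim(1) by (rule closed_sequentially[OF closed_closure])
    qed
    show "(\<lambda>x. norm (f x - d)) \<in> borel_measurable M" for d
    proof (rule complete_measure.borel_measurable_AE_LIMSEQ[OF M])
      show "(\<lambda>x. norm (F i x - d)) \<in> borel_measurable M" for i
        by (rule strongly_measurable_norm_diff[OF M F])
      show "AE x in M. (\<lambda>i. norm (F i x - d)) \<longlonglongrightarrow> norm (f x - d)"
        using lim by eventually_elim (intro tendsto_intros)
    qed
  qed
qed

text \<open>Gluing along a measurable choice among countably many functions. It serves for patching
  unit intervals together and for inserting a step function into a nonlinearity.\<close>

lemma strongly_measurable_compose_countable:
  fixes F :: "'i::countable \<Rightarrow> 'b \<Rightarrow> 'a::real_normed_vector"
  assumes M: "complete_measure M" and F: "\<And>i. strongly_measurable M (F i)"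
    and g: "g \<in> measurable M (count_space UNIV)"
  shows "strongly_measurable M (\<lambda>x. F (g x) x)"
proof -
  have "\<exists>D. \<forall>i. countable (D i) \<and> (AE x in M. F i x \<in> closure (D i))"
    using strongly_measurable_separable[OF F] by (intro choice allI) metis
  then obtain D where D: "\<And>i. countable (D i)" "\<And>i. AE x in M. F i x \<in> closure (D i)"
    by auto
  show ?thesis
  proof (rule strongly_measurableI)
    show "countable (\<Union>i. D i)" using D by auto
    have "AE x in M. \<forall>i. F i x \<in> closure (D i)" using D by (simp add: AE_all_countable)
    then show "AE x in M. F (g x) x \<in> closure (\<Union>i. D i)"
    proof eventually_elim
      case (elim x)
      then show ?case using closure_mono[of "D (g x)" "\<Union>i. D i"] by blast
    qed
    show "(\<lambda>x. norm (F (g x) x - d)) \<in> borel_measurable M" for d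
      by (rule measurable_compose_countable[OF strongly_measurable_norm_diff[OF M F] g])
  qed
qed

lemma strongly_measurable_compose2:
  assumes f: "strongly_measurable M f" and g: "strongly_measurable M g"
    and cont: "\<And>a b. isCont (\<lambda>(x, y). op x y) (a, b)"
  shows "strongly_measurable M (\<lambda>x. op (f x) (g x))"
proof -
  obtain s t where s: "\<And>i. simple_function M (s i)" and s_lim: "AE x in M. (\<lambda>i::nat. s i x) \<longlonglongrightarrow> f x"
    and t: "\<And>i. simple_function M (t i)" and t_lim: "AE x in M. (\<lambda>i::nat. t i x) \<longlonglongrightarrow> g x"
    using f g unfolding strongly_measurable_def by auto
  have "AE x in M. (\<lambda>i. op (s i x) (t i x)) \<longlonglongrightarrow> op (f x) (g x)"
    using s_lim t_lim
  proof eventually_elim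
    case (elim x)
    then have "(\<lambda>i. (s i x, t i x)) \<longlonglongrightarrow> (f x, g x)" by (rule tendsto_Pair)
    from isCont_tendsto_compose[OF cont this] show ?case by simp
  qed
  then show ?thesis
    using simple_function_compose2[OF s t] unfolding strongly_measurable_def
    by (intro exI[of _ "\<lambda>i x. op (s i x) (t i x)"]) auto
qed

lemma strongly_measurable_diff:
  assumes "strongly_measurable M f" "strongly_measurable M g"
  shows "strongly_measurable M (\<lambda>x. f x - g x)"
  using assms by (rule strongly_measurable_compose2) (auto simp: split_def intro!: continuous_intros)

lemma strongly_measurable_add:
  assumes "strongly_measurable M f" "strongly_measurable M g"
  shows "strongly_measurable M (\<lambda>x. f x + g x)"
  using assms by (rule strongly_measurable_compose2) (auto simp: split_def intro!: continuous_intros)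

lemma strongly_measurable_blinfun_apply:
  assumes "strongly_measurable M f" "strongly_measurable M g"
  shows "strongly_measurable M (\<lambda>x. blinfun_apply (f x) (g x))"
  using assms
proof (rule strongly_measurable_compose2)
  show "isCont (\<lambda>(x, y). blinfun_apply x y) (a, b)" for a :: "'b \<Rightarrow>\<^sub>L 'c" and b
    unfolding split_def
    by (intro bounded_bilinear.isCont[OF bounded_bilinear_blinfun_apply] continuous_intros)
qed

text \<open>Every subset of the line is separable, and continuity carries a dense sequence of
  \<open>S\<close> to one of the image; \<open>0\<close> is added for the points outside
  \<open>S\<close>.\<close>

lemma continuous_on_imp_strongly_measurable:
  fixes f :: "real \<Rightarrow> 'a::real_normed_vector"
  assumes S: "S \<in> sets lebesgue" and f: "continuous_on S f"
  shows "strongly_measurable lebesgue (\<lambda>x. indicator S x *\<^sub>R f x)"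
proof -
  obtain Q where Q: "countable Q" "Q \<subseteq> S" "S \<subseteq> closure Q"
    by (rule separable)
  show ?thesis
  proof (rule strongly_measurableI)
    show "countable (insert 0 (f ` Q))" using Q by auto
    have "f x \<in> closure (f ` Q)" if "x \<in> S" for x
    proof -
      have "x \<in> closure Q" using Q(3) that by blast
      then obtain q where q: "\<And>n. q n \<in> Q" "q \<longlonglongrightarrow> x"
        unfolding closure_sequential by blast
      then have "(\<lambda>n. f (q n)) \<longlonglongrightarrow> f x"
        using f that Q(2) unfolding continuous_on_sequentially comp_def by blast
      then show ?thesis
        using q(1) by (auto simp: closure_sequential intro!: exI[of _ "\<lambda>n. f (q n)"])
    qed
    then have "indicator S x *\<^sub>R f x \<in> closure (insert 0 (f ` Q))" for x
      using closure_mono[of "f ` Q" "insert 0 (f ` Q)"] closure_subset[of "insert 0 (f ` Q)"]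
      by (auto split: split_indicator)
    then show "AE x in lebesgue. indicator S x *\<^sub>R f x \<in> closure (insert 0 (f ` Q))" by simp
    show "(\<lambda>x. norm (indicator S x *\<^sub>R f x - d)) \<in> borel_measurable lebesgue" for d
    proof -
      have "(\<lambda>x. norm (f x - d)) \<in> borel_measurable (lebesgue_on S)"
        using f S by (intro continuous_imp_measurable_on_sets_lebesgue continuous_intros) auto
      then have "(\<lambda>x. indicator S x *\<^sub>R norm (f x - d)) \<in> borel_measurable lebesgue"
        using S by (subst (asm) borel_measurable_restrict_space_iff) auto
      moreover have "(\<lambda>x. indicator (- S) x *\<^sub>R norm d) \<in> borel_measurable lebesgue"
        using S by (auto intro!: borel_measurable_scaleR borel_measurable_indicator)
      ultimately have "(\<lambda>x. indicator S x *\<^sub>R norm (f x - d) + indicator (- S) x *\<^sub>R norm d)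
          \<in> borel_measurable lebesgue"
        by (rule borel_measurable_add)
      also have "(\<lambda>x. indicator S x *\<^sub>R norm (f x - d) + indicator (- S) x *\<^sub>R norm d) =
          (\<lambda>x. norm (indicator S x *\<^sub>R f x - d))"
        by (auto split: split_indicator)
      finally show ?thesis .
    qed
  qed
qed

section \<open>Restriction and translation of Lebesgue measure\<close>

lemma strongly_measurable_lebesgue_on:
  assumes S: "S \<in> sets lebesgue"
  shows "strongly_measurable (lebesgue_on S) f \<longleftrightarrow>
    strongly_measurable lebesgue (\<lambda>x. indicator S x *\<^sub>R f x)"
proof
  have S': "S \<inter> space lebesgue \<in> sets lebesgue" using S by auto
  assume "strongly_measurable (lebesgue_on S) f"
  then obtain s where s: "\<And>i::nat. simple_function (lebesgue_on S) (s i)"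
      and lim: "AE x in lebesgue_on S. (\<lambda>i. s i x) \<longlonglongrightarrow> f x"
    unfolding strongly_measurable_def by auto
  have "AE x in lebesgue. (\<lambda>i. indicator S x *\<^sub>R s i x) \<longlonglongrightarrow> indicator S x *\<^sub>R f x"
    using lim unfolding AE_restrict_space_iff[OF S'] by eventually_elim (auto split: split_indicator)
  then show "strongly_measurable lebesgue (\<lambda>x. indicator S x *\<^sub>R f x)"
    using s unfolding strongly_measurable_def simple_function_restrict_space[OF S']
    by (intro exI[of _ "\<lambda>i x. indicator S x *\<^sub>R s i x"]) auto
next
  have S': "S \<inter> space lebesgue \<in> sets lebesgue" using S by auto
  assume "strongly_measurable lebesgue (\<lambda>x. indicator S x *\<^sub>R f x)"
  then obtain s where s: "\<And>i::nat. simple_function lebesgue (s i)"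
      and lim: "AE x in lebesgue. (\<lambda>i. s i x) \<longlonglongrightarrow> indicator S x *\<^sub>R f x"
    unfolding strongly_measurable_def by auto
  have "AE x in lebesgue_on S. (\<lambda>i. s i x) \<longlonglongrightarrow> f x"
    using lim unfolding AE_restrict_space_iff[OF S'] by eventually_elim (auto split: split_indicator)
  moreover have "simple_function (lebesgue_on S) (s i)" for i
    unfolding simple_function_restrict_space[OF S']
    using simple_function_compose2[OF simple_function_indicator[OF S] s, of "(*\<^sub>R)"] by simp
  ultimately show "strongly_measurable (lebesgue_on S) f"
    unfolding strongly_measurable_def by blast
qed

lemma lebesgue_translation:
  fixes a :: real
  shows "(\<lambda>x. a + x) \<in> measurable lebesgue lebesgue"
    and "distr lebesgue lebesgue (\<lambda>x. a + x) = lebesgue"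
proof -
  show 1: "(\<lambda>x. a + x) \<in> measurable lebesgue lebesgue"
    using lebesgue_affine_measurable[of "\<lambda>_. 1" a] by simp
  show "distr lebesgue lebesgue (\<lambda>x. a + x) = lebesgue"
    using lebesgue_real_affine[of 1 a] by (simp add: density_1)
qed

lemma AE_lebesgue_translation:
  fixes a :: real
  assumes "AE x in lebesgue. P x"
  shows "AE x in lebesgue. P (a + x)"
proof (rule AE_distrD[OF lebesgue_translation(1)])
  show "AE x in distr lebesgue lebesgue ((+) a). P x"
    unfolding lebesgue_translation(2) using assms .
qed

lemma strongly_measurable_translation:
  fixes a :: real
  assumes "strongly_measurable lebesgue f"
  shows "strongly_measurable lebesgue (\<lambda>x. f (a + x))"
proof -
  obtain s where s: "\<And>i::nat. simple_function lebesgue (s i)"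
      and lim: "AE x in lebesgue. (\<lambda>i. s i x) \<longlonglongrightarrow> f x"
    using assms unfolding strongly_measurable_def by auto
  show ?thesis
    using AE_lebesgue_translation[OF lim, of a] simple_function_comp[OF lebesgue_translation(1) s]
    unfolding strongly_measurable_def by (intro exI[of _ "\<lambda>i x. s i (a + x)"]) auto
qed

lemma nn_integral_lebesgue_translation:
  fixes a :: real
  assumes "f \<in> borel_measurable lebesgue"
  shows "(\<integral>\<^sup>+x. f (a + x) \<partial>lebesgue) = (\<integral>\<^sup>+x. f x \<partial>lebesgue)"
  using nn_integral_real_affine_lebesgue[OF assms, of 1 a] by simp

section \<open>The strong Bochner integral\<close>

text \<open>A triangle inequality in the mean. With \<open>g = f\<close> it gives the Cauchy
  property of the approximating integrals; in general it bounds the distance of two limits.\<close>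

lemma simple_bochner_integral_norm_diff_le:
  assumes M: "complete_measure M" and f: "strongly_measurable M f" and g: "strongly_measurable M g"
    and s: "Bochner_Integration.simple_bochner_integrable M s" and t: "Bochner_Integration.simple_bochner_integrable M t"
  shows "ennreal (norm (Bochner_Integration.simple_bochner_integral M s - Bochner_Integration.simple_bochner_integral M t))
    \<le> (\<integral>\<^sup>+x. norm (f x - s x) \<partial>M) + (\<integral>\<^sup>+x. norm (g x - t x) \<partial>M) + (\<integral>\<^sup>+x. norm (f x - g x) \<partial>M)"
proof -
  have [measurable]: "(\<lambda>x. norm (f x - s x)) \<in> borel_measurable M"
      "(\<lambda>x. norm (g x - t x)) \<in> borel_measurable M" "(\<lambda>x. norm (f x - g x)) \<in> borel_measurable M"
    by (intro strongly_measurable_norm[OF M strongly_measurable_diff] f g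
        simple_bochner_integrable_imp_strongly_measurable s t)+
  have st: "Bochner_Integration.simple_bochner_integrable M (\<lambda>x. s x - t x)"
    using simple_bochner_integrable_compose2[of "(-)" M s t] s t by simp
  have "ennreal (norm (Bochner_Integration.simple_bochner_integral M s - Bochner_Integration.simple_bochner_integral M t))
      \<le> ennreal (Bochner_Integration.simple_bochner_integral M (\<lambda>x. norm (s x - t x)))"
    using simple_bochner_integral_norm_bound[OF st] simple_bochner_integral_diff[OF s t]
    by (simp add: ennreal_leI)
  also have "\<dots> = (\<integral>\<^sup>+x. norm (s x - t x) \<partial>M)"
    using simple_bochner_integrable_compose2[of "\<lambda>x y. norm (x - y)" M s t] s t
    by (intro simple_bochner_integral_eq_nn_integral) auto
  also have "\<dots> \<le> (\<integral>\<^sup>+x. ennreal (norm (f x - s x)) + ennreal (norm (g x - t x)) + ennreal (norm (f x - g x)) \<partial>M)"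
  proof (rule nn_integral_mono)
    fix x
    have "norm (s x - t x) = norm ((f x - g x) - (f x - s x) + (g x - t x))" by simp
    then have "norm (s x - t x) \<le> norm (f x - s x) + norm (g x - t x) + norm (f x - g x)"
      using norm_triangle_ineq[of "(f x - g x) - (f x - s x)" "g x - t x"]
        norm_triangle_ineq4[of "f x - g x" "f x - s x"] by linarith
    then show "ennreal (norm (s x - t x)) \<le> ennreal (norm (f x - s x)) + ennreal (norm (g x - t x)) + ennreal (norm (f x - g x))"
      by (metis ennreal_leI ennreal_plus norm_ge_zero add_nonneg_nonneg)
  qed
  also have "\<dots> = (\<integral>\<^sup>+x. norm (f x - s x) \<partial>M) + (\<integral>\<^sup>+x. norm (g x - t x) \<partial>M) + (\<integral>\<^sup>+x. norm (f x - g x) \<partial>M)"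
    by (subst nn_integral_add, measurable)+
  finally show ?thesis .
qed

lemma has_strong_bochner_integralE:
  assumes "has_strong_bochner_integral M f z"
  obtains s where "\<And>i::nat. Bochner_Integration.simple_bochner_integrable M (s i)"
    "(\<lambda>i. \<integral>\<^sup>+x. ennreal (norm (f x - s i x)) \<partial>M) \<longlonglongrightarrow> 0"
    "(\<lambda>i. Bochner_Integration.simple_bochner_integral M (s i)) \<longlonglongrightarrow> z"
  using assms unfolding has_strong_bochner_integral_def by blast

text \<open>The central estimate for this integral: uniqueness is the case \<open>g = f\<close>, the
  norm bound is the case \<open>g = 0\<close>, and later comparisons of two integrals use it without
  forming the integral of a difference.\<close>

lemma has_strong_bochner_integral_norm_diff_le:
  assumes M: "complete_measure M"
    and f: "has_strong_bochner_integral M f y" and g: "has_strong_bochner_integral M g z"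
  shows "ennreal (norm (y - z)) \<le> (\<integral>\<^sup>+x. norm (f x - g x) \<partial>M)"
proof -
  obtain s where s: "\<And>i::nat. Bochner_Integration.simple_bochner_integrable M (s i)"
      "(\<lambda>i. \<integral>\<^sup>+x. ennreal (norm (f x - s i x)) \<partial>M) \<longlonglongrightarrow> 0"
      "(\<lambda>i. Bochner_Integration.simple_bochner_integral M (s i)) \<longlonglongrightarrow> y"
    using has_strong_bochner_integralE[OF f] by blast
  obtain t where t: "\<And>i::nat. Bochner_Integration.simple_bochner_integrable M (t i)"
      "(\<lambda>i. \<integral>\<^sup>+x. ennreal (norm (g x - t i x)) \<partial>M) \<longlonglongrightarrow> 0"
      "(\<lambda>i. Bochner_Integration.simple_bochner_integral M (t i)) \<longlonglongrightarrow> z"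
    using has_strong_bochner_integralE[OF g] by blast
  have "(\<lambda>i. ennreal (norm (Bochner_Integration.simple_bochner_integral M (s i) - Bochner_Integration.simple_bochner_integral M (t i))))
      \<longlonglongrightarrow> ennreal (norm (y - z))"
    by (intro tendsto_intros s t)
  moreover have "(\<lambda>i. (\<integral>\<^sup>+x. norm (f x - s i x) \<partial>M) + (\<integral>\<^sup>+x. norm (g x - t i x) \<partial>M) + (\<integral>\<^sup>+x. norm (f x - g x) \<partial>M))
      \<longlonglongrightarrow> 0 + 0 + (\<integral>\<^sup>+x. norm (f x - g x) \<partial>M)"
    by (intro tendsto_intros s t)
  moreover have "ennreal (norm (Bochner_Integration.simple_bochner_integral M (s i) - Bochner_Integration.simple_bochner_integral M (t i)))
      \<le> (\<integral>\<^sup>+x. norm (f x - s i x) \<partial>M) + (\<integral>\<^sup>+x. norm (g x - t i x) \<partial>M) + (\<integral>\<^sup>+x. norm (f x - g x) \<partial>M)" for i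
    using f g by (intro simple_bochner_integral_norm_diff_le[OF M _ _ s(1) t(1)])
      (auto simp: has_strong_bochner_integral_def)
  ultimately show ?thesis using LIMSEQ_le by fastforce
qed

lemma has_strong_bochner_integral_unique:
  assumes "complete_measure M" "has_strong_bochner_integral M f y" "has_strong_bochner_integral M f z"
  shows "y = z"
  using has_strong_bochner_integral_norm_diff_le[OF assms] by simp

lemma has_strong_bochner_integral_zero:
  "has_strong_bochner_integral M (\<lambda>_. 0 :: 'a::real_normed_vector) 0"
proof -
  have "Bochner_Integration.simple_bochner_integrable M (\<lambda>_. 0 :: 'a)"
    by (auto intro!: simple_bochner_integrable.intros)
  moreover have "Bochner_Integration.simple_bochner_integral M (\<lambda>_. 0 :: 'a) = 0"
    unfolding simple_bochner_integral_def by (auto intro: sum.neutral)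
  ultimately show ?thesis
    unfolding has_strong_bochner_integral_def strongly_measurable_def
    by (auto intro!: exI[of _ "\<lambda>_ _. 0"])
qed

lemma has_strong_bochner_integral_norm_le:
  assumes "complete_measure M" "has_strong_bochner_integral M f y"
  shows "ennreal (norm y) \<le> (\<integral>\<^sup>+x. norm (f x) \<partial>M)"
  using has_strong_bochner_integral_norm_diff_le[OF assms has_strong_bochner_integral_zero] by simp

text \<open>The approximating simple functions satisfy
  \<open>norm (f x - s i x) \<le> norm (f x)\<close>, so dominated convergence makes them converge
  in the mean; their integrals are then Cauchy, and the space is complete.\<close>

lemma has_strong_bochner_integral_exists:
  fixes f :: "'b \<Rightarrow> 'a::banach"
  assumes M: "complete_measure M" and f: "strongly_measurable M f"
    and fin: "(\<integral>\<^sup>+x. norm (f x) \<partial>M) < \<infinity>"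
  shows "\<exists>z. has_strong_bochner_integral M f z"
proof -
  obtain D where D: "countable D" "AE x in M. f x \<in> closure D"
    using strongly_measurable_separable[OF f] .
  obtain s where s: "\<And>i::nat. simple_function M (s i)" and lim: "AE x in M. (\<lambda>i. s i x) \<longlonglongrightarrow> f x"
      and dom: "\<And>i x. norm (f x - s i x) \<le> norm (f x)"
    by (rule dominated_simple_approximation[OF D strongly_measurable_norm_diff[OF M f]]) (rule that)
  have [measurable]: "(\<lambda>x. norm (f x)) \<in> borel_measurable M"
    by (rule strongly_measurable_norm[OF M f])
  have s_sm: "strongly_measurable M (s i)" for i
    using s unfolding strongly_measurable_def by (intro exI[of _ "\<lambda>_. s i"]) auto
  have int: "Bochner_Integration.simple_bochner_integrable M (s i)" for i
  proof (rule simple_bochner_integrableI_bounded[OF s])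
    have "(\<integral>\<^sup>+x. norm (s i x) \<partial>M) \<le> (\<integral>\<^sup>+x. 2 * ennreal (norm (f x)) \<partial>M)"
    proof (rule nn_integral_mono)
      fix x
      have "norm (s i x) \<le> 2 * norm (f x)"
        using dom[where i = i and x = x] norm_triangle_ineq4[of "f x" "f x - s i x"] by simp
      then show "ennreal (norm (s i x)) \<le> 2 * ennreal (norm (f x))"
        by (metis ennreal_leI ennreal_mult' ennreal_numeral zero_le_numeral)
    qed
    also have "\<dots> < \<infinity>" using fin by (simp add: nn_integral_cmult ennreal_mult_less_top)
    finally show "(\<integral>\<^sup>+x. norm (s i x) \<partial>M) < \<infinity>" .
  qed
  have lim0: "(\<lambda>i. \<integral>\<^sup>+x. ennreal (norm (f x - s i x)) \<partial>M) \<longlonglongrightarrow> (\<integral>\<^sup>+x. 0 \<partial>M)"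
  proof (rule nn_integral_dominated_convergence[where w = "\<lambda>x. ennreal (norm (f x))"])
    show "(\<lambda>x. ennreal (norm (f x - s i x))) \<in> borel_measurable M" for i
      by (rule strongly_measurable_ennreal_norm[OF M strongly_measurable_diff[OF f s_sm]])
    show "AE x in M. (\<lambda>i. ennreal (norm (f x - s i x))) \<longlonglongrightarrow> 0"
      using lim
    proof eventually_elim
      case (elim x)
      have "(\<lambda>i. ennreal (norm (f x - s i x))) \<longlonglongrightarrow> ennreal (norm (f x - f x))"
        by (intro tendsto_intros elim)
      then show ?case by simp
    qed
  qed (use dom fin in \<open>auto intro: ennreal_leI\<close>)
  let ?I = "\<lambda>i. Bochner_Integration.simple_bochner_integral M (s i)"
  have "Cauchy ?I"
  proof (rule metric_CauchyI)
    fix e :: real assume e: "0 < e"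
    have "eventually (\<lambda>i. (\<integral>\<^sup>+x. ennreal (norm (f x - s i x)) \<partial>M) < ennreal (e/2)) sequentially"
      using lim0 e by (intro order_tendstoD) auto
    then obtain N where N: "\<And>i. N \<le> i \<Longrightarrow> (\<integral>\<^sup>+x. ennreal (norm (f x - s i x)) \<partial>M) < ennreal (e/2)"
      by (auto simp: eventually_sequentially)
    have "dist (?I i) (?I j) < e" if "N \<le> i" "N \<le> j" for i j
    proof -
      have "ennreal (dist (?I i) (?I j)) \<le> (\<integral>\<^sup>+x. norm (f x - s i x) \<partial>M) + (\<integral>\<^sup>+x. norm (f x - s j x) \<partial>M)"
        using simple_bochner_integral_norm_diff_le[OF M f f int[of i] int[of j]] by (simp add: dist_norm)
      also have "\<dots> < ennreal (e/2) + ennreal (e/2)"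
        by (rule add_strict_mono[OF N N]) (use that in auto)
      also have "\<dots> = ennreal e" using e by (simp flip: ennreal_plus)
      finally show ?thesis by (simp add: ennreal_less_iff)
    qed
    then show "\<exists>N. \<forall>i\<ge>N. \<forall>j\<ge>N. dist (?I i) (?I j) < e" by auto
  qed
  then obtain z where "?I \<longlonglongrightarrow> z" using Cauchy_convergent_iff convergent_def by blast
  with lim0 int f show ?thesis
    unfolding has_strong_bochner_integral_def by auto
qed

text \<open>Extension by zero moves an integral to the whole line, where integrals with different
  end points can be compared and translated.\<close>

lemma has_strong_bochner_integral_lebesgue_on:
  assumes S: "S \<in> sets lebesgue" and f: "has_strong_bochner_integral (lebesgue_on S) f z"
  shows "has_strong_bochner_integral lebesgue (\<lambda>x. indicator S x *\<^sub>R f x) z"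
proof -
  have S': "S \<inter> space lebesgue \<in> sets lebesgue" using S by auto
  obtain s where s: "\<And>i::nat. Bochner_Integration.simple_bochner_integrable (lebesgue_on S) (s i)"
      "(\<lambda>i. \<integral>\<^sup>+x. ennreal (norm (f x - s i x)) \<partial>lebesgue_on S) \<longlonglongrightarrow> 0"
      "(\<lambda>i. Bochner_Integration.simple_bochner_integral (lebesgue_on S) (s i)) \<longlonglongrightarrow> z"
    using has_strong_bochner_integralE[OF f] by blast
  have "(\<integral>\<^sup>+x. ennreal (norm (f x - s i x)) \<partial>lebesgue_on S) =
      (\<integral>\<^sup>+x. ennreal (norm (indicator S x *\<^sub>R f x - indicator S x *\<^sub>R s i x)) \<partial>lebesgue)" for i
    unfolding nn_integral_restrict_space[OF S'] by (rule nn_integral_cong) (auto split: split_indicator)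
  then show ?thesis
    using f s(2,3) s(1)[unfolded simple_bochner_integrable_restrict_space[OF S']]
    unfolding has_strong_bochner_integral_def strongly_measurable_lebesgue_on[OF S]
      simple_bochner_integral_restrict_space[OF S' s(1)]
    by (auto intro!: exI[of _ "\<lambda>i x. indicator S x *\<^sub>R s i x"])
qed

lemma has_strong_bochner_integral_translation:
  fixes a :: real
  assumes f: "has_strong_bochner_integral lebesgue f z"
  shows "has_strong_bochner_integral lebesgue (\<lambda>x. f (a + x)) z"
proof -
  obtain s where s: "\<And>i::nat. Bochner_Integration.simple_bochner_integrable lebesgue (s i)"
      "(\<lambda>i. \<integral>\<^sup>+x. ennreal (norm (f x - s i x)) \<partial>lebesgue) \<longlonglongrightarrow> 0"
      "(\<lambda>i. Bochner_Integration.simple_bochner_integral lebesgue (s i)) \<longlonglongrightarrow> z"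
    using has_strong_bochner_integralE[OF f] by blast
  have fs: "strongly_measurable lebesgue f"
    using f by (auto simp: has_strong_bochner_integral_def)
  have s_simple: "simple_function lebesgue (s i)" for i
    using s(1) by (auto simp: simple_bochner_integrable.simps)
  have s_sm: "strongly_measurable lebesgue (s i)" for i
    by (rule simple_bochner_integrable_imp_strongly_measurable[OF s(1)])
  have nn: "(\<integral>\<^sup>+x. ennreal (norm (f (a + x) - s i (a + x))) \<partial>lebesgue) = (\<integral>\<^sup>+x. ennreal (norm (f x - s i x)) \<partial>lebesgue)" for i
    by (intro nn_integral_lebesgue_translation strongly_measurable_ennreal_norm
        complete_measure_lebesgue strongly_measurable_diff fs s_sm)
  \<comment> \<open>The level sets of the translated simple functions are translates of the old
    ones, so their measures and hence the simple integrals do not change.\<close>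
  have em: "emeasure lebesgue {x. P (a + x)} = emeasure lebesgue {x. P x}" if "{x. P x} \<in> sets lebesgue" for P
  proof -
    have "emeasure lebesgue {x. P x} = emeasure (distr lebesgue lebesgue (\<lambda>x. a + x)) {x. P x}"
      by (simp only: lebesgue_translation)
    also have "\<dots> = emeasure lebesgue {x. P (a + x)}"
      using that by (subst emeasure_distr[OF lebesgue_translation(1)]) (auto simp: vimage_def)
    finally show ?thesis by simp
  qed
  have sets: "{x. s i x \<in> Y} \<in> sets lebesgue" for i Y
    using simple_functionD(2)[OF s_simple[of i], of Y] by (simp add: vimage_def)
  have int: "Bochner_Integration.simple_bochner_integrable lebesgue (\<lambda>x. s i (a + x))" for i
    using s(1)[of i] em[OF sets, of i "- {0}"] simple_function_comp[OF lebesgue_translation(1) s_simple]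
    unfolding simple_bochner_integrable.simps by simp
  have "range (\<lambda>x. s i (a + x)) = range (s i)" for i
  proof -
    have "s i x \<in> range (\<lambda>x. s i (a + x))" for x
      using rangeI[of "\<lambda>x. s i (a + x)" "x - a"] by simp
    then show ?thesis by auto
  qed
  moreover have "measure lebesgue {x. s i (a + x) = y} = measure lebesgue {x. s i x = y}" for i y
    using em[OF sets, of i "{y}"] by (simp add: measure_def)
  ultimately have "Bochner_Integration.simple_bochner_integral lebesgue (\<lambda>x. s i (a + x)) = Bochner_Integration.simple_bochner_integral lebesgue (s i)" for i
    unfolding simple_bochner_integral_def by simp
  then show ?thesis
    using s(2,3) int nn strongly_measurable_translation[OF fs]
    unfolding has_strong_bochner_integral_def
    by (intro conjI exI[of _ "\<lambda>i x. s i (a + x)"]) simp_all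
qed

section \<open>The semigroup\<close>

lemma bounded_bilinear_scaleC:
  "bounded_bilinear (\<lambda>z (x::'a::complex_banach). z *\<^sub>C x)"
proof
  fix z w :: complex and x y :: 'a and r :: real
  show "(z + w) *\<^sub>C x = z *\<^sub>C x + w *\<^sub>C x" by (rule scaleC_add_left)
  show "z *\<^sub>C (x + y) = z *\<^sub>C x + z *\<^sub>C y" by (rule scaleC_add_right)
  show "(r *\<^sub>R z) *\<^sub>C x = r *\<^sub>R (z *\<^sub>C x)"
    by (metis scaleC_of_real scaleC_scaleC scaleR_conv_of_real)
  show "z *\<^sub>C (r *\<^sub>R x) = r *\<^sub>R (z *\<^sub>C x)"
    by (metis mult.commute scaleC_of_real scaleC_scaleC)
  show "\<exists>K. \<forall>a (b::'a). norm (a *\<^sub>C b) \<le> norm a * norm b * K"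
    by (intro exI[of _ 1]) (simp add: norm_scaleC)
qed

lemma resolvent_apply:
  assumes "z \<in> resolvent_set A"
  shows "mlo_inverse (mlo_shift z A) y = {blinfun_apply (resolvent A z) y}"
proof -
  obtain R :: "'a \<Rightarrow>\<^sub>L 'a" where R: "\<forall>y. mlo_inverse (mlo_shift z A) y = {blinfun_apply R y}"
    using assms unfolding resolvent_set_def by auto
  then have "resolvent A z = R"
    unfolding resolvent_def by (intro the_equality) (auto intro: blinfun_eqI)
  then show ?thesis using R by simp
qed

text \<open>The resolvent identity for a multivalued operator, as an estimate: if \<open>y\<close>
  lies in \<open>w x - A x\<close>, then the same element of \<open>A x\<close> shows that
  \<open>y + (z - w) x\<close> lies in \<open>z x - A x\<close>. It makes the resolvent norm
  continuous along the contour.\<close>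

lemma norm_resolvent_diff_le:
  assumes z: "z \<in> resolvent_set A" and w: "w \<in> resolvent_set A"
  shows "norm (resolvent A w - resolvent A z) \<le> cmod (z - w) * norm (resolvent A z) * norm (resolvent A w)"
proof (rule norm_blinfun_bound)
  fix y
  define x where "x = blinfun_apply (resolvent A w) y"
  have "x \<in> mlo_inverse (mlo_shift w A) y" unfolding resolvent_apply[OF w] x_def by simp
  then obtain a where a: "a \<in> A x" "y = w *\<^sub>C x - a"
    unfolding mlo_inverse_def mlo_shift_def by auto
  have "z *\<^sub>C x = w *\<^sub>C x + (z - w) *\<^sub>C x"
    by (simp flip: scaleC_add_left)
  then have "z *\<^sub>C x - a = y + (z - w) *\<^sub>C x" using a(2) by simp
  then have "x \<in> mlo_inverse (mlo_shift z A) (y + (z - w) *\<^sub>C x)"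
    using a(1) unfolding mlo_inverse_def mlo_shift_def by force
  then have "x = blinfun_apply (resolvent A z) (y + (z - w) *\<^sub>C x)"
    unfolding resolvent_apply[OF z] by simp
  then have "blinfun_apply (resolvent A w - resolvent A z) y = blinfun_apply (resolvent A z) ((z - w) *\<^sub>C x)"
    by (simp add: x_def[symmetric] blinfun.diff_left blinfun.add_right algebra_simps)
  also have "norm \<dots> \<le> norm (resolvent A z) * (cmod (z - w) * norm x)"
    using norm_blinfun[of "resolvent A z" "(z - w) *\<^sub>C x"] by (simp add: norm_scaleC)
  also have "\<dots> \<le> norm (resolvent A z) * (cmod (z - w) * (norm (resolvent A w) * norm y))"
    unfolding x_def by (intro mult_left_mono norm_blinfun) auto
  finally show "norm (blinfun_apply (resolvent A w - resolvent A z) y)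
      \<le> cmod (z - w) * norm (resolvent A z) * norm (resolvent A w) * norm y"
    by (simp add: mult_ac)
qed auto

lemma borel_measurable_lebesgue_ident [measurable]: "(\<lambda>x::real. x) \<in> borel_measurable lebesgue"
  by (rule measurable_completion) simp

lemma nn_integral_exp_minus_abs:
  fixes a :: real
  assumes "a > 0"
  shows "(\<integral>\<^sup>+x. ennreal (exp (- (a * \<bar>x\<bar>))) \<partial>lborel) < \<infinity>"
proof -
  have half: "(\<integral>\<^sup>+x. ennreal (exp (- (a * x))) * indicator {0..} x \<partial>lborel) = ennreal (0 - (- exp (- (a * 0)) / a))"
  proof (rule nn_integral_FTC_atLeast)
    show "((\<lambda>x. - exp (- (a * x)) / a) has_real_derivative exp (- (a * x))) (at x)" if "0 \<le> x" for x
      using assms by (auto intro!: derivative_eq_intros)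
    have "((\<lambda>x. exp (- (a * x))) \<longlongrightarrow> 0) at_top"
      using assms by (intro filterlim_compose[OF exp_at_bot])
        (auto simp: filterlim_uminus_at_bot intro!: filterlim_tendsto_pos_mult_at_top[OF tendsto_const _ filterlim_ident])
    from tendsto_minus[OF tendsto_divide[OF this tendsto_const[of a]]]
    show "((\<lambda>x. - exp (- (a * x)) / a) \<longlongrightarrow> 0) at_top" using assms by simp
  qed auto
  have half': "(\<integral>\<^sup>+x. ennreal (exp (a * x)) * indicator {..0} x \<partial>lborel) =
      (\<integral>\<^sup>+x. ennreal (exp (- (a * x))) * indicator {0..} x \<partial>lborel)"
    by (subst nn_integral_real_affine[where c = "-1" and t = 0])
      (auto intro!: nn_integral_cong split: split_indicator)
  have "(\<integral>\<^sup>+x. ennreal (exp (- (a * \<bar>x\<bar>))) \<partial>lborel) \<le>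
      (\<integral>\<^sup>+x. ennreal (exp (- (a * x))) * indicator {0..} x + ennreal (exp (a * x)) * indicator {..0} x \<partial>lborel)"
    by (intro nn_integral_mono) (auto split: split_indicator)
  also have "\<dots> < \<infinity>"
    by (subst nn_integral_add) (auto simp: half half')
  finally show ?thesis .
qed

lemma strongly_measurable_cong_AE:
  assumes "complete_measure M" "strongly_measurable M f" "AE x in M. f x = g x"
  shows "strongly_measurable M g"
proof (rule strongly_measurable_AE_LIMSEQ[OF assms(1)])
  show "strongly_measurable M f" for i :: nat by (rule assms(2))
  show "AE x in M. (\<lambda>i::nat. f x) \<longlonglongrightarrow> g x"
    using assms(3) by eventually_elim simp
qed

text \<open>The contour is affine on each side of its corner at \<open>\<eta> = 0\<close>; the
  corner itself is a null set of parameters.\<close>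

lemma vector_derivative_Gamma_curve:
  assumes "\<eta> \<noteq> 0"
  shows "vector_derivative (Gamma_curve c) (at \<eta>) = Complex (- c * sgn \<eta>) 1"
proof (rule vector_derivative_at)
  let ?g = "\<lambda>x. of_real (- c * (sgn \<eta> * x + 1)) + of_real x * \<i>"
  have "(?g has_vector_derivative Complex (- c * sgn \<eta>) 1) (at \<eta>)"
    by (auto intro!: derivative_eq_intros simp: complex_eq_iff)
  moreover have "open {x. sgn x = sgn \<eta>}"
  proof -
    have "{x. sgn x = sgn \<eta>} = (if \<eta> > 0 then {0<..} else {..<0})"
      using assms by (auto simp: sgn_if split: if_splits)
    then show ?thesis by auto
  qed
  moreover have "?g x = Gamma_curve c x" if "x \<in> {x. sgn x = sgn \<eta>}" for x
    using that assms by (auto simp: Gamma_curve_def complex_eq_iff sgn_if split: if_splits)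
  ultimately show "(Gamma_curve c has_vector_derivative Complex (- c * sgn \<eta>) 1) (at \<eta>)"
    using has_vector_derivative_transform_within_open[of ?g _ \<eta> "{x. sgn x = sgn \<eta>}" "Gamma_curve c"]
    by auto
qed

lemma continuous_on_Gamma_curve: "continuous_on S (Gamma_curve c)"
  unfolding Gamma_curve_def by (intro continuous_intros)

text \<open>Dominated convergence in the contour integral. The real part of the contour goes to
  minus infinity linearly, so for \<open>t\<close> bounded away from \<open>0\<close> the
  exponential yields one integrable majorant.\<close>

lemma degenerate_semigroup_continuous:
  fixes A :: "'a::complex_banach \<Rightarrow> 'a set"
  assumes P: "condition_P A c \<beta>"
  shows "continuous_on {0<..} (degenerate_semigroup A c)"
proof -
  obtain M0 where c: "c > 0" and M0: "M0 > 0"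
    and res: "\<And>z. Re z \<ge> - c * (\<bar>Im z\<bar> + 1) \<Longrightarrow> z \<in> resolvent_set A"
    and bnd: "\<And>z. Re z \<ge> - c * (\<bar>Im z\<bar> + 1) \<Longrightarrow> norm (resolvent A z) \<le> M0 * (1 + cmod z) powr (- \<beta>)"
    and \<beta>: "\<beta> > 0"
    using P unfolding condition_P_def by blast
  define R where "R \<eta> = resolvent A (Gamma_curve c \<eta>)" for \<eta>
  have G: "Re (Gamma_curve c \<eta>) \<ge> - c * (\<bar>Im (Gamma_curve c \<eta>)\<bar> + 1)" for \<eta>
    by (simp add: Gamma_curve_def)
  have R_bound: "norm (R \<eta>) \<le> M0" for \<eta>
  proof -
    have "norm (R \<eta>) \<le> M0 * (1 + cmod (Gamma_curve c \<eta>)) powr (- \<beta>)"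
      unfolding R_def by (rule bnd[OF G])
    also have "\<dots> \<le> M0 * 1"
      using M0 \<beta> powr_mono2'[of "- \<beta>" 1 "1 + cmod (Gamma_curve c \<eta>)"] by (intro mult_left_mono) auto
    finally show ?thesis by simp
  qed
  have R_cont: "continuous_on UNIV R"
  proof -
    have "(\<lambda>n. R (x n)) \<longlonglongrightarrow> R y" if x: "x \<longlonglongrightarrow> y" for x y
    proof -
      have lim: "(\<lambda>n. cmod (Gamma_curve c y - Gamma_curve c (x n)) * (M0 * M0)) \<longlonglongrightarrow> cmod (Gamma_curve c y - Gamma_curve c y) * (M0 * M0)"
        using continuous_on_tendsto_compose[OF continuous_on_Gamma_curve[of UNIV c] x] by (intro tendsto_intros) auto
      have le: "norm (R (x n) - R y) \<le> cmod (Gamma_curve c y - Gamma_curve c (x n)) * (M0 * M0)" for n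
      proof -
        have "norm (R (x n) - R y) \<le> cmod (Gamma_curve c y - Gamma_curve c (x n)) * (norm (R y) * norm (R (x n)))"
          using norm_resolvent_diff_le[OF res[OF G[of y]] res[OF G[of "x n"]]] by (simp add: R_def mult.assoc)
        also have "\<dots> \<le> cmod (Gamma_curve c y - Gamma_curve c (x n)) * (M0 * M0)"
          using R_bound M0 by (intro mult_left_mono mult_mono) auto
        finally show ?thesis .
      qed
      have "(\<lambda>n. R (x n) - R y) \<longlonglongrightarrow> 0"
        by (rule Lim_null_comparison[OF _ lim[simplified]]) (simp add: le)
      then show ?thesis by (simp add: LIM_zero_iff)
    qed
    then show ?thesis by (simp add: continuous_on_sequentially comp_def)
  qed
  define E where "E t \<eta> = (exp (Gamma_curve c \<eta> * of_real t) * vector_derivative (Gamma_curve c) (at \<eta>)) *\<^sub>C R \<eta>"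
    for t \<eta>
  have AE0: "AE \<eta> in lebesgue. \<eta> \<noteq> (0::real)"
    using AE_completion[OF AE_lborel_singleton[of 0]] by simp
  have E_meas: "strongly_measurable lebesgue (E t)" for t
  proof (rule strongly_measurable_cong_AE[OF complete_measure_lebesgue])
    let ?f = "\<lambda>\<eta>. (exp (Gamma_curve c \<eta> * of_real t) * Complex (- c * sgn \<eta>) 1) *\<^sub>C R \<eta>"
    show "strongly_measurable lebesgue (\<lambda>\<eta>. indicator (- {0}) \<eta> *\<^sub>R ?f \<eta>)"
    proof (rule continuous_on_imp_strongly_measurable)
      have "continuous_on (- {0}) (\<lambda>\<eta>::real. Complex (- c * sgn \<eta>) 1)"
        unfolding sgn_div_norm by (intro continuous_intros) auto
      then show "continuous_on (- {0}) ?f"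
        using continuous_on_subset[OF R_cont, of "- {0}"]
        by (intro bounded_bilinear.continuous_on[OF bounded_bilinear_scaleC] continuous_intros
            continuous_on_Gamma_curve) auto
    qed auto
    show "AE \<eta> in lebesgue. indicator (- {0}) \<eta> *\<^sub>R ?f \<eta> = E t \<eta>"
      using AE0 by eventually_elim (simp add: E_def vector_derivative_Gamma_curve)
  qed
  \<comment> \<open>Majorant valid for all \<open>t \<ge> a\<close>: the factor \<open>c + 1\<close>
    bounds the speed of the contour and \<open>M0\<close> bounds the resolvent.\<close>
  define w where "w a \<eta> = exp (- (c * a * \<bar>\<eta>\<bar>)) * ((c + 1) * M0)" for a \<eta> :: real
  have E_norm: "norm (E t \<eta>) \<le> w a \<eta>" if "\<eta> \<noteq> 0" "a \<le> t" "0 < a" for a t \<eta>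
  proof -
    have "norm (E t \<eta>) = exp (- c * (\<bar>\<eta>\<bar> + 1) * t) * cmod (Complex (- c * sgn \<eta>) 1) * norm (R \<eta>)"
      using that by (simp add: E_def norm_scaleC norm_mult vector_derivative_Gamma_curve Gamma_curve_def norm_exp_eq_Re)
    also have "\<dots> \<le> exp (- (c * a * \<bar>\<eta>\<bar>)) * (c + 1) * M0"
    proof (intro mult_mono)
      have "a * \<bar>\<eta>\<bar> \<le> t * \<bar>\<eta>\<bar> + t * 1"
        using that mult_right_mono[of a t "\<bar>\<eta>\<bar>"] by linarith
      then have "c * (a * \<bar>\<eta>\<bar>) \<le> c * (t * \<bar>\<eta>\<bar> + t * 1)" using c by (intro mult_left_mono) auto
      then show "exp (- c * (\<bar>\<eta>\<bar> + 1) * t) \<le> exp (- (c * a * \<bar>\<eta>\<bar>))" by (simp add: algebra_simps)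
      show "cmod (Complex (- c * sgn \<eta>) 1) \<le> c + 1"
        using cmod_le[of "Complex (- c * sgn \<eta>) 1"] c that(1) by (simp add: abs_mult abs_sgn_eq)
    qed (use c R_bound in auto)
    finally show ?thesis by (simp add: w_def mult.assoc)
  qed
  have w_fin: "(\<integral>\<^sup>+\<eta>. ennreal (w a \<eta>) \<partial>lebesgue) < \<infinity>" if "0 < a" for a
  proof -
    have "(\<integral>\<^sup>+\<eta>. ennreal (w a \<eta>) \<partial>lebesgue) = (\<integral>\<^sup>+\<eta>. ennreal (exp (- (c * a * \<bar>\<eta>\<bar>))) * ennreal ((c + 1) * M0) \<partial>lborel)"
      unfolding nn_integral_completion w_def using c M0 by (simp add: ennreal_mult)
    also have "\<dots> < \<infinity>"
      using nn_integral_exp_minus_abs[of "c * a"] c that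
      by (subst nn_integral_multc) (auto simp: ennreal_mult_less_top)
    finally show ?thesis .
  qed
  define J where "J t = strong_bochner_integral lebesgue (E t)" for t
  have J: "has_strong_bochner_integral lebesgue (E t) (J t)" if "t > 0" for t
  proof -
    have "(\<integral>\<^sup>+\<eta>. ennreal (norm (E t \<eta>)) \<partial>lebesgue) \<le> (\<integral>\<^sup>+\<eta>. ennreal (w t \<eta>) \<partial>lebesgue)"
      by (rule nn_integral_mono_AE) (use AE0 in eventually_elim, use that in \<open>auto intro!: ennreal_leI E_norm\<close>)
    also note w_fin[OF that]
    finally obtain z where z: "has_strong_bochner_integral lebesgue (E t) z"
      using has_strong_bochner_integral_exists[OF complete_measure_lebesgue E_meas, of t] by blast
    show ?thesis
      unfolding J_def strong_bochner_integral_def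
      using z has_strong_bochner_integral_unique[OF complete_measure_lebesgue _ z] by (rule theI)
  qed
  \<comment> \<open>The majorant \<open>w a\<close> degenerates as \<open>a\<close> tends to
    \<open>0\<close>, so continuity is obtained on each half-line \<open>{a<..}\<close> and then
    localised, with \<open>a = t / 2\<close>.\<close>
  have "continuous_on {a<..} J" if a: "a > 0" for a
    unfolding continuous_on_sequentially comp_def
  proof (intro allI ballI impI)
    fix x t assume t: "t \<in> {a<..}" and x: "(\<forall>n. x n \<in> {a<..}) \<and> x \<longlonglongrightarrow> t"
    have ub: "ennreal (norm (J (x n) - J t)) \<le> (\<integral>\<^sup>+\<eta>. ennreal (norm (E (x n) \<eta> - E t \<eta>)) \<partial>lebesgue)" for n
      using x t a by (intro has_strong_bochner_integral_norm_diff_le[OF complete_measure_lebesgue] J) (auto intro: less_trans)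
    have "(\<lambda>n. \<integral>\<^sup>+\<eta>. ennreal (norm (E (x n) \<eta> - E t \<eta>)) \<partial>lebesgue) \<longlonglongrightarrow> (\<integral>\<^sup>+\<eta>. 0 \<partial>(lebesgue :: real measure))"
    proof (rule nn_integral_dominated_convergence[where w = "\<lambda>\<eta>. 2 * ennreal (w a \<eta>)"])
      show "(\<lambda>\<eta>. ennreal (norm (E (x n) \<eta> - E t \<eta>))) \<in> borel_measurable lebesgue" for n
        by (intro strongly_measurable_ennreal_norm complete_measure_lebesgue strongly_measurable_diff E_meas)
      show w_meas: "(\<lambda>\<eta>. 2 * ennreal (w a \<eta>)) \<in> borel_measurable lebesgue"
        unfolding w_def by measurable
      show "AE \<eta> in lebesgue. ennreal (norm (E (x n) \<eta> - E t \<eta>)) \<le> 2 * ennreal (w a \<eta>)" for n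
        using AE0
      proof eventually_elim
        case (elim \<eta>)
        have "norm (E (x n) \<eta> - E t \<eta>) \<le> 2 * w a \<eta>"
          using E_norm[OF elim, of a "x n"] E_norm[OF elim, of a t] x t a
            norm_triangle_ineq4[of "E (x n) \<eta>" "E t \<eta>"] by (auto simp: less_imp_le)
        then show ?case
          by (metis ennreal_leI ennreal_mult' ennreal_numeral zero_le_numeral)
      qed
      show "(\<integral>\<^sup>+\<eta>. 2 * ennreal (w a \<eta>) \<partial>lebesgue) < \<infinity>"
      proof (subst nn_integral_cmult)
        show "(\<lambda>\<eta>. ennreal (w a \<eta>)) \<in> borel_measurable lebesgue"
          unfolding w_def by measurable
      qed (use w_fin[OF a] in \<open>auto simp: ennreal_mult_less_top\<close>)
      show "AE \<eta> in lebesgue. (\<lambda>n. ennreal (norm (E (x n) \<eta> - E t \<eta>))) \<longlonglongrightarrow> 0"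
      proof (rule AE_I2)
        fix \<eta>
        have "(\<lambda>n. E (x n) \<eta>) \<longlonglongrightarrow> E t \<eta>"
          unfolding E_def using x
          by (intro bounded_bilinear.tendsto[OF bounded_bilinear_scaleC] tendsto_intros) auto
        then have "(\<lambda>n. ennreal (norm (E (x n) \<eta> - E t \<eta>))) \<longlonglongrightarrow> ennreal (norm (E t \<eta> - E t \<eta>))"
          by (intro tendsto_intros)
        then show "(\<lambda>n. ennreal (norm (E (x n) \<eta> - E t \<eta>))) \<longlonglongrightarrow> 0" by simp
      qed
    qed auto
    then have "(\<lambda>n. \<integral>\<^sup>+\<eta>. ennreal (norm (E (x n) \<eta> - E t \<eta>)) \<partial>lebesgue) \<longlonglongrightarrow> 0" by simp
    then have "(\<lambda>n. ennreal (norm (J (x n) - J t))) \<longlonglongrightarrow> 0"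
    proof (rule tendsto_sandwich[OF _ _ tendsto_const, rotated 2])
      show "\<forall>\<^sub>F n in sequentially. 0 \<le> ennreal (norm (J (x n) - J t))" by simp
    qed (intro always_eventually allI ub)
    then have "(\<lambda>n. norm (J (x n) - J t)) \<longlonglongrightarrow> 0"
      by (simp flip: ennreal_0 del: ennreal_0)
    then show "(\<lambda>n. J (x n)) \<longlonglongrightarrow> J t"
      by (simp add: tendsto_norm_zero_iff LIM_zero_iff)
  qed
  then have "isCont J t" if "t > 0" for t
    using that continuous_on_interior[of "{t/2<..}" J t] by (auto simp: interior_open)
  then have "continuous_on {0<..} J"
    by (intro continuous_at_imp_continuous_on) auto
  then show ?thesis
    unfolding degenerate_semigroup_def J_def E_def R_def
    by (intro bounded_bilinear.continuous_on[OF bounded_bilinear_scaleC] continuous_on_const)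
qed

section \<open>Convolution with a weakly singular kernel\<close>

text \<open>Young's inequality with constants \<open>1\<close>: either
  \<open>a \<le> b powr (q - 1)\<close>, and the product is at most \<open>b powr q\<close>, or
  \<open>b\<close> is at most \<open>a powr (1 / (q - 1))\<close>, and it is at most the other
  power.\<close>

lemma mult_le_powr_conjugate:
  fixes a b q :: real
  assumes "0 \<le> a" "0 \<le> b" "q > 1"
  shows "a * b \<le> a powr (q / (q - 1)) + b powr q"
proof (cases "a = 0 \<or> b = 0")
  case False
  then have ab: "a > 0" "b > 0" using assms by auto
  show ?thesis
  proof (cases "a \<le> b powr (q - 1)")
    case True
    then have "a * b \<le> b powr (q - 1) * b powr 1" using ab by (simp add: mult_right_mono)
    also have "\<dots> = b powr (q - 1 + 1)" by (simp only: powr_add)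
    finally show ?thesis by (simp add: add_increasing)
  next
    case False
    then have "(b powr (q - 1)) powr (1 / (q - 1)) \<le> a powr (1 / (q - 1))"
      using assms by (intro powr_mono2) auto
    then have "b \<le> a powr (1 / (q - 1))" using assms ab by (simp add: powr_powr)
    then have "a * b \<le> a powr 1 * a powr (1 / (q - 1))" using ab by (simp add: mult_left_mono)
    also have "\<dots> = a powr (1 + 1 / (q - 1))" by (simp only: powr_add)
    also have "1 + 1 / (q - 1) = q / (q - 1)" using assms by (simp add: field_simps)
    finally show ?thesis using powr_ge_zero[of b q] by linarith
  qed
qed auto

text \<open>Stands in for the inclusion of \<open>L\<^sup>p\<close> in \<open>L\<^sup>q\<close> on
  windows of length one, so that a bound with exponent \<open>q\<close> serves every larger
  exponent.\<close>

lemma powr_le_1_plus_powr: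
  fixes y q p :: real
  assumes "0 \<le> y" "0 \<le> q" "q \<le> p"
  shows "y powr q \<le> 1 + y powr p"
proof (cases "y \<le> 1")
  case True
  then have "y powr q \<le> 1" using assms powr_mono2[of q y 1] by simp
  then show ?thesis using powr_ge_zero[of y p] by linarith
next
  case False
  then have "y powr q \<le> y powr p" using assms by (intro powr_mono) auto
  then show ?thesis by simp
qed

lemma nn_integral_powr_0_1:
  assumes "a > -1"
  shows "(\<integral>\<^sup>+x\<in>{0..1}. ennreal (x powr a) \<partial>lebesgue) < \<infinity>"
  unfolding nn_integral_completion
  using nn_integral_has_integral_lebesgue'[OF _ has_integral_powr_from_0[OF assms, of 1]] by simp

abbreviation window_integral :: "real \<Rightarrow> (real \<Rightarrow> real) \<Rightarrow> real \<Rightarrow> ennreal" where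
  "window_integral p \<phi> a \<equiv> (\<integral>\<^sup>+s\<in>{a..a+1}. ennreal (\<phi> s powr p) \<partial>lebesgue)"

locale weakly_singular_kernel =
  fixes M c \<beta> :: real
  assumes M_pos: "M > 0" and c_pos: "c > 0" and beta_pos: "\<beta> > 0" and beta_le_1: "\<beta> \<le> 1"
begin

text \<open>The value \<open>0\<close> for \<open>x \<le> 0\<close> cuts off the future:
  \<open>kconv\<close> can integrate over all \<open>s \<ge> 0\<close> without an upper limit
  depending on \<open>t\<close>.\<close>

definition k :: "real \<Rightarrow> real" where
  "k x = (if x > 0 then M * exp (- c * x) * x powr (\<beta> - 1) else 0)"

definition kconv :: "(real \<Rightarrow> ennreal) \<Rightarrow> real \<Rightarrow> ennreal" where
  "kconv \<phi> t = (\<integral>\<^sup>+s\<in>{0..}. ennreal (k (t - s)) * \<phi> s \<partial>lebesgue)"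

lemma k_nonneg [simp]: "0 \<le> k x"
  using M_pos by (simp add: k_def)

lemma k_borel [measurable]: "k \<in> borel_measurable borel"
  unfolding k_def[abs_def] by measurable

text \<open>The exponential factor splits and the power is decreasing, as
  \<open>\<beta> \<le> 1\<close>. Every later statement that the distant past is forgotten rests on
  this inequality.\<close>

lemma k_shift_le:
  assumes "0 < x" "0 \<le> y"
  shows "k (x + y) \<le> exp (- c * y) * k x"
proof -
  have "(x + y) powr (\<beta> - 1) \<le> x powr (\<beta> - 1)"
    using assms beta_le_1 by (intro powr_mono2') auto
  then have "M * exp (- c * (x + y)) * (x + y) powr (\<beta> - 1) \<le> M * exp (- c * (x + y)) * x powr (\<beta> - 1)"
    using M_pos by (intro mult_left_mono) auto
  also have "\<dots> = exp (- c * y) * k x"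
    using assms by (simp add: k_def algebra_simps flip: exp_add)
  finally show ?thesis using assms by (simp add: k_def)
qed

lemma k_antimono:
  assumes "0 < x" "x \<le> y"
  shows "k y \<le> k x"
proof -
  have "k y \<le> exp (- c * (y - x)) * k x" using k_shift_le[of x "y - x"] assms by simp
  also have "\<dots> \<le> 1 * k x" using assms c_pos by (intro mult_right_mono) auto
  finally show ?thesis by simp
qed

lemma kconv_mono_AE:
  assumes "AE s in lebesgue. 0 \<le> s \<longrightarrow> \<phi> s \<le> \<psi> s"
  shows "kconv \<phi> t \<le> kconv \<psi> t"
  unfolding kconv_def
  by (rule nn_integral_mono_AE) (use assms in eventually_elim, auto intro!: mult_left_mono split: split_indicator)

lemma kconv_mono: "(\<And>s. 0 \<le> s \<Longrightarrow> \<phi> s \<le> \<psi> s) \<Longrightarrow> kconv \<phi> t \<le> kconv \<psi> t"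
  by (rule kconv_mono_AE) auto

lemma kconv_add:
  assumes "\<phi> \<in> borel_measurable lebesgue" "\<psi> \<in> borel_measurable lebesgue"
  shows "kconv (\<lambda>s. \<phi> s + \<psi> s) t = kconv \<phi> t + kconv \<psi> t"
  unfolding kconv_def distrib_left distrib_right
  by (rule nn_integral_add) (use assms in measurable)

lemma kconv_cmult:
  assumes "\<phi> \<in> borel_measurable lebesgue"
  shows "kconv (\<lambda>s. a * \<phi> s) t = a * kconv \<phi> t"
proof -
  have "kconv (\<lambda>s. a * \<phi> s) t = (\<integral>\<^sup>+s. a * (ennreal (k (t - s)) * \<phi> s * indicator {0..} s) \<partial>lebesgue)"
    unfolding kconv_def by (simp add: ac_simps)
  also have "\<dots> = a * kconv \<phi> t"
    unfolding kconv_def by (rule nn_integral_cmult) (use assms in measurable)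
  finally show ?thesis .
qed

lemma kconv_0 [simp]: "kconv (\<lambda>s. 0) t = 0"
  by (simp add: kconv_def)

lemma kconv_sum:
  assumes "finite I" "\<And>i. i \<in> I \<Longrightarrow> \<phi> i \<in> borel_measurable lebesgue"
  shows "kconv (\<lambda>s. \<Sum>i\<in>I. \<phi> i s) t = (\<Sum>i\<in>I. kconv (\<phi> i) t)"
  using assms by (induction I rule: finite_induct) (simp_all add: kconv_add)

text \<open>After the substitution the left side integrates over \<open>s \<ge> \<sigma>\<close>
  only, the right side over \<open>s \<ge> 0\<close>; hence an inequality.\<close>

lemma kconv_shift:
  assumes \<phi>: "\<phi> \<in> borel_measurable lebesgue" and \<sigma>: "0 \<le> \<sigma>"
  shows "kconv (\<lambda>s. \<phi> (s + \<sigma>)) t \<le> kconv \<phi> (t + \<sigma>)"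
proof -
  have "kconv (\<lambda>s. \<phi> (s + \<sigma>)) t \<le>
      (\<integral>\<^sup>+s. ennreal (k (t + \<sigma> - (\<sigma> + s))) * \<phi> (\<sigma> + s) * indicator {0..} (\<sigma> + s) \<partial>lebesgue)"
    unfolding kconv_def using \<sigma>
    by (intro nn_integral_mono) (auto simp: add.commute split: split_indicator)
  also have "\<dots> = kconv \<phi> (t + \<sigma>)"
    unfolding kconv_def
    by (rule nn_integral_lebesgue_translation[of "\<lambda>s. ennreal (k (t + \<sigma> - s)) * \<phi> s * indicator {0..} s"])
      (use \<phi> in measurable)
  finally show ?thesis .
qed

text \<open>What happened before \<open>m\<close> reaches time \<open>t\<close> only through
  \<open>k (t - s)\<close>, which is \<open>k (m - s)\<close> damped by the elapsed time.\<close>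

lemma kconv_decay:
  assumes \<phi>: "\<phi> \<in> borel_measurable lebesgue" and t: "m \<le> t"
  shows "kconv (\<lambda>s. \<phi> s * indicator {..<m} s) t \<le> ennreal (exp (- c * (t - m))) * kconv \<phi> m"
proof -
  have "kconv (\<lambda>s. \<phi> s * indicator {..<m} s) t \<le>
      (\<integral>\<^sup>+s. ennreal (exp (- c * (t - m))) * (ennreal (k (m - s)) * \<phi> s * indicator {0..} s) \<partial>lebesgue)"
    unfolding kconv_def
  proof (intro nn_integral_mono)
    fix s
    have "ennreal (k (t - s)) \<le> ennreal (exp (- c * (t - m))) * ennreal (k (m - s))" if "s < m"
      using k_shift_le[of "m - s" "t - m"] that t
      by (auto simp flip: ennreal_mult intro!: ennreal_leI)
    from mult_right_mono[OF this, of "\<phi> s"]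
    show "ennreal (k (t - s)) * (\<phi> s * indicator {..<m} s) * indicator {0..} s
        \<le> ennreal (exp (- c * (t - m))) * (ennreal (k (m - s)) * \<phi> s * indicator {0..} s)"
      by (auto split: split_indicator simp: mult.assoc)
  qed
  also have "\<dots> = ennreal (exp (- c * (t - m))) * kconv \<phi> m"
    unfolding kconv_def by (rule nn_integral_cmult) (use \<phi> in measurable)
  finally show ?thesis .
qed

lemma nn_integral_k_le:
  assumes "0 \<le> \<delta>"
  shows "(\<integral>\<^sup>+s. ennreal (k (t - s)) * indicator {t - \<delta><..} s \<partial>lebesgue) \<le> ennreal (M * \<delta> powr \<beta> / \<beta>)"
proof -
  have "(\<integral>\<^sup>+s. ennreal (k (t - s)) * indicator {t - \<delta><..} s \<partial>lebesgue) =
      (\<integral>\<^sup>+s. ennreal (k (t - s)) * indicator {t - \<delta><..} s \<partial>lborel)"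
    by (rule nn_integral_completion)
  also have "\<dots> = (\<integral>\<^sup>+x. ennreal (k x) * indicator {..<\<delta>} x \<partial>lborel)"
    by (subst nn_integral_real_affine[where c = "-1" and t = t])
      (auto intro!: nn_integral_cong split: split_indicator)
  also have "\<dots> \<le> (\<integral>\<^sup>+x. ennreal (M * x powr (\<beta> - 1)) * indicator {0..\<delta>} x \<partial>lborel)"
  proof (intro nn_integral_mono)
    fix x
    have "k x \<le> M * x powr (\<beta> - 1)"
    proof (cases "x > 0")
      case True
      then have "M * exp (- c * x) * x powr (\<beta> - 1) \<le> M * 1 * x powr (\<beta> - 1)"
        using M_pos c_pos by (intro mult_right_mono mult_left_mono) auto
      then show ?thesis using True by (simp add: k_def)
    qed (use M_pos in \<open>simp add: k_def\<close>)
    then show "ennreal (k x) * indicator {..<\<delta>} x \<le> ennreal (M * x powr (\<beta> - 1)) * indicator {0..\<delta>} x"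
      by (auto split: split_indicator intro!: ennreal_leI simp: k_def)
  qed
  also have "\<dots> = ennreal (M * (\<delta> powr (\<beta> - 1 + 1) / (\<beta> - 1 + 1)))"
    by (intro nn_integral_has_integral_lebesgue' has_integral_mult_right has_integral_powr_from_0)
      (use M_pos beta_pos assms in auto)
  finally show ?thesis by simp
qed

end

text \<open>For \<open>q > 1\<close> the condition says that \<open>k\<close> belongs to
  \<open>L\<^sup>q'\<close> near \<open>0\<close>, where \<open>q' = q / (q - 1)\<close> is the
  conjugate exponent; for \<open>q = 1\<close> the kernel has to be bounded, which means
  \<open>\<beta> = 1\<close>.\<close>

locale weakly_singular_kernel_Lq = weakly_singular_kernel +
  fixes q :: real
  assumes exponent: "(q = 1 \<and> \<beta> = 1) \<or> (q > 1 \<and> q / (q - 1) * (1 - \<beta>) < 1)"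
begin

lemma q_ge_1: "q \<ge> 1"
  using exponent by auto

text \<open>Separates kernel and function pointwise, which treats both cases of the exponent
  condition alike: for \<open>q > 1\<close> the function \<open>W\<close> is the conjugate power of
  \<open>k\<close>, for \<open>q = 1\<close> it is \<open>0\<close> and
  \<open>C = M\<close>.\<close>

lemma k_mult_le:
  obtains W C where "W \<in> borel_measurable borel" "0 \<le> C" "\<And>x. 0 \<le> W x"
    "(\<integral>\<^sup>+x\<in>{0..1}. ennreal (W x) \<partial>lebesgue) < \<infinity>"
    "\<And>x y p. x \<le> 1 \<Longrightarrow> 0 \<le> y \<Longrightarrow> q \<le> p \<Longrightarrow> k x * y \<le> W x + C + C * y powr p"
proof (cases "q = 1")
  case True
  then have "\<beta> = 1" using exponent by auto
  show ?thesis
  proof (rule that[of "\<lambda>_. 0" M])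
    fix x y p :: real assume xy: "x \<le> 1" "0 \<le> y" "q \<le> p"
    have "k x \<le> M"
      unfolding k_def using M_pos c_pos \<open>\<beta> = 1\<close> by (auto simp: mult_le_cancel_left1)
    then have "k x * y \<le> M * (1 + y powr p)"
      using powr_le_1_plus_powr[of y 1 p] xy True M_pos by (intro mult_mono) auto
    then show "k x * y \<le> 0 + M + M * y powr p" by (simp add: algebra_simps)
  qed (use M_pos in auto)
next
  case False
  then have q: "q > 1" "q / (q - 1) * (1 - \<beta>) < 1" using exponent by auto
  let ?q' = "q / (q - 1)"
  show ?thesis
  proof (rule that[of "\<lambda>x. k x powr ?q'" 1])
    have "(\<integral>\<^sup>+x\<in>{0..1}. ennreal (k x powr ?q') \<partial>lebesgue)
        \<le> (\<integral>\<^sup>+x. ennreal (M powr ?q') * (ennreal (x powr ((\<beta> - 1) * ?q')) * indicator {0..1} x) \<partial>lebesgue)"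
    proof (rule nn_integral_mono)
      fix x :: real
      have "k x powr ?q' \<le> M powr ?q' * x powr ((\<beta> - 1) * ?q')" if "0 \<le> x"
      proof (cases "x = 0")
        case False
        have "M * exp (- c * x) * x powr (\<beta> - 1) \<le> M * 1 * x powr (\<beta> - 1)"
          using M_pos c_pos that by (intro mult_right_mono mult_left_mono) auto
        then have "k x powr ?q' \<le> (M * x powr (\<beta> - 1)) powr ?q'"
          using False that q M_pos by (intro powr_mono2) (auto simp: k_def)
        also have "\<dots> = M powr ?q' * x powr ((\<beta> - 1) * ?q')"
          using M_pos by (simp add: powr_mult powr_powr)
        finally show ?thesis .
      qed (simp add: k_def)
      then show "ennreal (k x powr ?q') * indicator {0..1} x
          \<le> ennreal (M powr ?q') * (ennreal (x powr ((\<beta> - 1) * ?q')) * indicator {0..1} x)"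
        by (auto split: split_indicator intro!: ennreal_leI simp flip: ennreal_mult)
    qed
    also have "\<dots> = ennreal (M powr ?q') * (\<integral>\<^sup>+x\<in>{0..1}. ennreal (x powr ((\<beta> - 1) * ?q')) \<partial>lebesgue)"
      by (rule nn_integral_cmult) measurable
    also have "\<dots> < \<infinity>"
    proof -
      have "(\<beta> - 1) * x = - (x * (1 - \<beta>))" for x by (simp add: algebra_simps)
      from this[of ?q'] have "(\<beta> - 1) * ?q' > -1" using q(2) by linarith
      from nn_integral_powr_0_1[OF this] show ?thesis by (simp add: ennreal_mult_less_top)
    qed
    finally show "(\<integral>\<^sup>+x\<in>{0..1}. ennreal (k x powr ?q') \<partial>lebesgue) < \<infinity>" .
    fix x y p :: real assume xy: "x \<le> 1" "0 \<le> y" "q \<le> p"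
    show "k x * y \<le> k x powr ?q' + 1 + 1 * y powr p"
      using mult_le_powr_conjugate[of "k x" y q] powr_le_1_plus_powr[of y q p] xy q by simp
  qed auto
qed

lemma unit_window_bound:
  obtains C where "C > 0"
    "\<And>p \<phi> a. q \<le> p \<Longrightarrow> \<phi> \<in> borel_measurable lebesgue \<Longrightarrow> (\<And>s. 0 \<le> \<phi> s) \<Longrightarrow>
       window_integral p \<phi> a \<le> 1 \<Longrightarrow>
       (\<integral>\<^sup>+s\<in>{a..<a+1}. ennreal (k (a + 1 - s)) * ennreal (\<phi> s) \<partial>lebesgue) \<le> ennreal C"
proof -
  obtain W C where [measurable]: "W \<in> borel_measurable borel" and C: "0 \<le> C" and W0: "\<And>x. 0 \<le> W x"
    and W: "(\<integral>\<^sup>+x\<in>{0..1}. ennreal (W x) \<partial>lebesgue) < \<infinity>"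
    and le: "\<And>x y p. x \<le> 1 \<Longrightarrow> 0 \<le> y \<Longrightarrow> q \<le> p \<Longrightarrow> k x * y \<le> W x + C + C * y powr p"
    by (rule k_mult_le) blast
  obtain w where w: "(\<integral>\<^sup>+x\<in>{0..1}. ennreal (W x) \<partial>lebesgue) = ennreal w" "0 \<le> w"
    using W by (auto simp: less_top_ennreal)
  \<comment> \<open>The mass \<open>w\<close> of \<open>W\<close> on a unit interval, one
    \<open>C\<close> for the constant term and one for the power term; the final \<open>1\<close>
    only makes the constant positive.\<close>
  show ?thesis
  proof (rule that[of "w + C + C + 1"])
    fix p a :: real and \<phi> :: "real \<Rightarrow> real"
    assume p: "q \<le> p" and \<phi>[measurable]: "\<phi> \<in> borel_measurable lebesgue" and \<phi>0: "\<And>s. 0 \<le> \<phi> s"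
      and I: "window_integral p \<phi> a \<le> 1"
    have "(\<integral>\<^sup>+s\<in>{a..<a+1}. ennreal (k (a + 1 - s)) * ennreal (\<phi> s) \<partial>lebesgue)
      \<le> (\<integral>\<^sup>+s. ennreal (W (a + 1 - s)) * indicator {a..a+1} s + ennreal C * indicator {a..a+1} s
            + ennreal C * (ennreal (\<phi> s powr p) * indicator {a..a+1} s) \<partial>lebesgue)"
    proof (intro nn_integral_mono)
      fix s
      have "ennreal (k (a + 1 - s)) * ennreal (\<phi> s) \<le> ennreal (W (a + 1 - s)) + ennreal C + ennreal C * ennreal (\<phi> s powr p)"
        if "a \<le> s" "s < a + 1"
        using le[of "a + 1 - s" "\<phi> s" p] that p \<phi>0[of s] C W0[of "a + 1 - s"]
        by (auto simp flip: ennreal_mult ennreal_plus intro!: ennreal_leI)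
      then show "ennreal (k (a + 1 - s)) * ennreal (\<phi> s) * indicator {a..<a + 1} s
         \<le> ennreal (W (a + 1 - s)) * indicator {a..a + 1} s + ennreal C * indicator {a..a + 1} s +
            ennreal C * (ennreal (\<phi> s powr p) * indicator {a..a + 1} s)"
        by (auto split: split_indicator)
    qed
    also have "\<dots> = (\<integral>\<^sup>+s. ennreal (W (a + 1 - s)) * indicator {a..a+1} s \<partial>lebesgue)
        + (\<integral>\<^sup>+s. ennreal C * indicator {a..a+1} s \<partial>lebesgue)
        + ennreal C * window_integral p \<phi> a"
    proof -
      have m1: "(\<lambda>s. ennreal (W (a + 1 - s)) * indicator {a..a+1} s) \<in> borel_measurable lebesgue"
        and m2: "(\<lambda>s. ennreal C * indicator {a..a+1} s) \<in> borel_measurable lebesgue"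
        and m3: "(\<lambda>s. ennreal (\<phi> s powr p) * indicator {a..a+1} s) \<in> borel_measurable lebesgue"
        and m4: "(\<lambda>s. ennreal C * (ennreal (\<phi> s powr p) * indicator {a..a+1} s)) \<in> borel_measurable lebesgue"
        and m5: "(\<lambda>s. ennreal (W (a + 1 - s)) * indicator {a..a+1} s + ennreal C * indicator {a..a+1} s) \<in> borel_measurable lebesgue"
        by measurable
      show ?thesis
        by (simp only: nn_integral_add[OF m5 m4]
            nn_integral_add[OF m1 m2] nn_integral_cmult[OF m3])
    qed
    also have "(\<integral>\<^sup>+s. ennreal (W (a + 1 - s)) * indicator {a..a+1} s \<partial>lebesgue) = ennreal w"
      unfolding w(1)[symmetric] nn_integral_completion
      by (subst nn_integral_real_affine[where c = "-1" and t = "a + 1"])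
        (auto intro!: nn_integral_cong split: split_indicator)
    also have "(\<integral>\<^sup>+s. ennreal C * indicator {a..a+1} s \<partial>lebesgue) = ennreal C"
      by (subst nn_integral_cmult_indicator) auto
    also have "ennreal w + ennreal C + ennreal C * window_integral p \<phi> a
        \<le> ennreal w + ennreal C + ennreal C * 1"
      by (intro add_mono mult_left_mono I) auto
    also have "\<dots> \<le> ennreal (w + C + C + 1)"
      using w(2) C by (simp flip: ennreal_plus)
    finally show "(\<integral>\<^sup>+s\<in>{a..<a+1}. ennreal (k (a + 1 - s)) * ennreal (\<phi> s) \<partial>lebesgue) \<le> ennreal (w + C + C + 1)" .
  qed (use w C in auto)
qed

text \<open>Convolution with \<open>k\<close> maps functions with small Stepanov norm to small
  functions. One constant covers all exponents from \<open>q\<close> upwards, so that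
  \<open>g\<close>, \<open>h\<close> and the Lipschitz function of \<open>g\<close> can be treated
  together.\<close>

definition window_bound :: "real \<Rightarrow> bool" where
  "window_bound C \<longleftrightarrow> C > 0 \<and> (\<forall>p \<phi> \<epsilon> t. q \<le> p \<longrightarrow> \<phi> \<in> borel_measurable lebesgue \<longrightarrow>
     (\<forall>s. 0 \<le> \<phi> s) \<longrightarrow> 0 < \<epsilon> \<longrightarrow> (\<forall>a\<ge>0. window_integral p \<phi> a \<le> ennreal (\<epsilon> powr p)) \<longrightarrow>
     kconv (\<lambda>s. ennreal (\<phi> s)) t \<le> ennreal (C * \<epsilon>))"

text \<open>The line is cut into unit windows backwards from \<open>t\<close>. The window at
  distance \<open>j\<close> contributes at most \<open>exp (- c) ^ j\<close> times the bound for a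
  single window, and the geometric series gives \<open>1 / (1 - exp (- c))\<close>.\<close>

lemma window_bound_exists: "\<exists>C. window_bound C"
proof -
  obtain C where C: "C > 0" and win: "\<And>p \<phi> a. q \<le> p \<Longrightarrow> \<phi> \<in> borel_measurable lebesgue \<Longrightarrow> (\<And>s. 0 \<le> \<phi> s) \<Longrightarrow>
       window_integral p \<phi> a \<le> 1 \<Longrightarrow>
       (\<integral>\<^sup>+s\<in>{a..<a+1}. ennreal (k (a + 1 - s)) * ennreal (\<phi> s) \<partial>lebesgue) \<le> ennreal C"
    by (rule unit_window_bound) blast
  let ?S = "1 / (1 - exp (- c))"
  have ec: "exp (- c) < 1" using c_pos by simp
  have "window_bound (?S * C)"
    unfolding window_bound_def
  proof (intro conjI allI impI)
    show "0 < ?S * C" using C ec by simp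
    fix p \<epsilon> t :: real and \<phi> :: "real \<Rightarrow> real"
    assume p: "q \<le> p" and [measurable]: "\<phi> \<in> borel_measurable lebesgue" and "\<forall>s. 0 \<le> \<phi> s" and \<epsilon>: "0 < \<epsilon>"
      and "\<forall>a\<ge>0. window_integral p \<phi> a \<le> ennreal (\<epsilon> powr p)"
    then have \<phi>0: "\<And>s. 0 \<le> \<phi> s" and I: "\<And>a. 0 \<le> a \<Longrightarrow> window_integral p \<phi> a \<le> ennreal (\<epsilon> powr p)"
      by auto
    \<comment> \<open>Normalised to unit size and cut off at \<open>0\<close>: a window starting at
      \<open>a < 0\<close> then sees only part of the window starting at \<open>0\<close>, so the
      bound holds for every real \<open>a\<close>.\<close>
    define \<psi> where "\<psi> s = indicator {0..} s * (\<phi> s / \<epsilon>)" for s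
    have [measurable]: "\<psi> \<in> borel_measurable lebesgue" unfolding \<psi>_def[abs_def] by measurable
    have \<psi>0: "0 \<le> \<psi> s" for s using \<phi>0 \<epsilon> by (simp add: \<psi>_def)
    have "window_integral p \<psi> a \<le> 1" for a
    proof -
      have "window_integral p \<psi> a
          \<le> (\<integral>\<^sup>+s. ennreal (1 / \<epsilon> powr p) * (ennreal (\<phi> s powr p) * indicator {max a 0..max a 0 + 1} s) \<partial>lebesgue)"
        using \<phi>0 \<epsilon>
        by (intro nn_integral_mono)
          (auto simp: \<psi>_def powr_divide split: split_indicator simp flip: ennreal_mult intro!: ennreal_leI)
      also have "\<dots> = ennreal (1 / \<epsilon> powr p) * window_integral p \<phi> (max a 0)"
        by (rule nn_integral_cmult) measurable
      also have "\<dots> \<le> ennreal (1 / \<epsilon> powr p) * ennreal (\<epsilon> powr p)"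
        by (intro mult_left_mono I) auto
      also have "\<dots> = 1" using \<epsilon> by (simp flip: ennreal_mult)
      finally show ?thesis .
    qed
    then have win': "(\<integral>\<^sup>+s\<in>{a..<a+1}. ennreal (k (a + 1 - s)) * ennreal (\<psi> s) \<partial>lebesgue) \<le> ennreal C" for a
      using win[OF p _ \<psi>0] by simp
    define \<Phi> where "\<Phi> j s = ennreal (exp (- c) ^ j) * (ennreal (k (t - real j - s)) * ennreal (\<psi> s) * indicator {t - real j - 1..<t - real j} s)" for j s
    have \<Phi>_meas: "\<Phi> j \<in> borel_measurable lebesgue" for j
      unfolding \<Phi>_def[abs_def] by measurable
    have "ennreal (k (t - s)) * ennreal (\<psi> s) \<le> (\<Sum>j. \<Phi> j s)" for s
    proof (cases "s < t")
      case True
      \<comment> \<open>Chosen with \<open>j < t - s\<close> and \<open>t - s \<le> j + 1\<close>,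
        so that the remaining kernel argument \<open>t - j - s\<close> stays positive and at most
        \<open>1\<close>.\<close>
      define j where "j = nat (\<lceil>t - s\<rceil> - 1)"
      have j: "t - real j - 1 \<le> s" "s < t - real j"
        using True by (auto simp: j_def nat_less_iff) linarith+
      have "k (t - s) \<le> exp (- c) ^ j * k (t - real j - s)"
        using k_shift_le[of "t - real j - s" "real j"] j exp_of_nat_mult[of j "- c"]
        by (simp add: mult.commute)
      then have "ennreal (k (t - s)) * ennreal (\<psi> s) \<le> ennreal (exp (- c) ^ j * k (t - real j - s)) * ennreal (\<psi> s)"
        by (intro mult_right_mono ennreal_leI) auto
      also have "\<dots> = \<Phi> j s" using j by (simp add: \<Phi>_def ennreal_mult mult.assoc)
      also have "\<dots> \<le> (\<Sum>j. \<Phi> j s)"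
        using sum_le_suminf[of "\<lambda>j. \<Phi> j s" "{j}"] by simp
      finally show ?thesis .
    qed (simp add: k_def)
    then have "(\<integral>\<^sup>+s. ennreal (k (t - s)) * ennreal (\<psi> s) \<partial>lebesgue) \<le> (\<integral>\<^sup>+s. (\<Sum>j. \<Phi> j s) \<partial>lebesgue)"
      by (rule nn_integral_mono)
    also have "\<dots> = (\<Sum>j. \<integral>\<^sup>+s. \<Phi> j s \<partial>lebesgue)"
      by (rule nn_integral_suminf[OF \<Phi>_meas])
    also have "\<dots> \<le> (\<Sum>j. ennreal (exp (- c) ^ j * C))"
    proof (rule suminf_le)
      fix j
      have "(\<integral>\<^sup>+s. \<Phi> j s \<partial>lebesgue) = ennreal (exp (- c) ^ j) * (\<integral>\<^sup>+s\<in>{t - real j - 1..<t - real j - 1 + 1}. ennreal (k (t - real j - 1 + 1 - s)) * ennreal (\<psi> s) \<partial>lebesgue)"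
        unfolding \<Phi>_def by (subst nn_integral_cmult) auto
      also have "\<dots> \<le> ennreal (exp (- c) ^ j) * ennreal C"
        by (intro mult_left_mono win') auto
      finally show "(\<integral>\<^sup>+s. \<Phi> j s \<partial>lebesgue) \<le> ennreal (exp (- c) ^ j * C)"
        using C by (simp add: ennreal_mult)
    qed auto
    also have "\<dots> = ennreal (?S * C)"
      using C ec by (intro suminf_ennreal_eq sums_mult2 geometric_sums) auto
    finally have *: "(\<integral>\<^sup>+s. ennreal (k (t - s)) * ennreal (\<psi> s) \<partial>lebesgue) \<le> ennreal (?S * C)" .
    have "kconv (\<lambda>s. ennreal (\<phi> s)) t = (\<integral>\<^sup>+s. ennreal \<epsilon> * (ennreal (k (t - s)) * ennreal (\<psi> s)) \<partial>lebesgue)"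
      unfolding kconv_def using \<phi>0 \<epsilon>
      by (intro nn_integral_cong) (auto simp: \<psi>_def split: split_indicator simp flip: ennreal_mult)
    also have "\<dots> = ennreal \<epsilon> * (\<integral>\<^sup>+s. ennreal (k (t - s)) * ennreal (\<psi> s) \<partial>lebesgue)"
      by (rule nn_integral_cmult) measurable
    also have "\<dots> \<le> ennreal \<epsilon> * ennreal (?S * C)" by (intro mult_left_mono *) auto
    also have "\<dots> = ennreal (?S * C * \<epsilon>)" using \<epsilon> C ec
      by (subst ennreal_mult[symmetric]) (auto simp: mult_ac)
    finally show "kconv (\<lambda>s. ennreal (\<phi> s)) t \<le> ennreal (?S * C * \<epsilon>)" .
  qed
  then show ?thesis by blast
qed

definition window_const :: real where
  "window_const = (SOME C. window_bound C)"

lemma window_bound_const: "window_bound window_const"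
  unfolding window_const_def by (rule someI_ex[OF window_bound_exists])

lemma window_const_pos: "window_const > 0"
  using window_bound_const by (simp add: window_bound_def)

lemma kconv_le_of_windows:
  assumes "q \<le> p" "\<phi> \<in> borel_measurable lebesgue" "\<And>s. 0 \<le> \<phi> s" "0 < \<epsilon>"
    and "\<And>a. 0 \<le> a \<Longrightarrow> window_integral p \<phi> a \<le> ennreal (\<epsilon> powr p)"
  shows "kconv (\<lambda>s. ennreal (\<phi> s)) t \<le> ennreal (window_const * \<epsilon>)"
  using window_bound_const assms by (simp add: window_bound_def)

end

section \<open>Uniform smallness of the convolution near the singularity\<close>

context weakly_singular_kernel
begin

text \<open>Controls the part of the convolution where the kernel is singular, uniformly in
  \<open>t\<close>. The cut-off at \<open>b\<close> makes local information about
  \<open>\<phi>\<close> enough.\<close>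

definition small_near :: "real \<Rightarrow> (real \<Rightarrow> ennreal) \<Rightarrow> bool" where
  "small_near b \<phi> \<longleftrightarrow> (\<forall>\<epsilon>>0. \<exists>\<delta>>0. \<forall>t. kconv (\<lambda>s. \<phi> s * indicator ({..b} \<inter> {t - \<delta><..}) s) t \<le> ennreal \<epsilon>)"

lemma small_near_mono_AE:
  assumes \<psi>: "small_near b \<psi>" and le: "AE s in lebesgue. 0 \<le> s \<longrightarrow> s \<le> b \<longrightarrow> \<phi> s \<le> \<psi> s"
  shows "small_near b \<phi>"
  unfolding small_near_def
proof (intro allI impI)
  fix \<epsilon> :: real assume "\<epsilon> > 0"
  then obtain \<delta> where \<delta>: "\<delta> > 0" "\<And>t. kconv (\<lambda>s. \<psi> s * indicator ({..b} \<inter> {t - \<delta><..}) s) t \<le> ennreal \<epsilon>"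
    using \<psi> unfolding small_near_def by blast
  have "kconv (\<lambda>s. \<phi> s * indicator ({..b} \<inter> {t - \<delta><..}) s) t \<le> kconv (\<lambda>s. \<psi> s * indicator ({..b} \<inter> {t - \<delta><..}) s) t" for t
    by (rule kconv_mono_AE) (use le in eventually_elim, auto split: split_indicator)
  with \<delta> show "\<exists>\<delta>>0. \<forall>t. kconv (\<lambda>s. \<phi> s * indicator ({..b} \<inter> {t - \<delta><..}) s) t \<le> ennreal \<epsilon>"
    using order_trans by blast
qed

lemma kconv_near_mono:
  assumes "\<delta> \<le> \<delta>'"
  shows "kconv (\<lambda>s. \<phi> s * indicator ({..b} \<inter> {t - \<delta><..}) s) t \<le> kconv (\<lambda>s. \<phi> s * indicator ({..b} \<inter> {t - \<delta>'<..}) s) t"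
  by (rule kconv_mono) (use assms in \<open>auto split: split_indicator\<close>)

lemma small_near_add:
  assumes \<phi>: "small_near b \<phi>" and \<psi>: "small_near b \<psi>"
    and [measurable]: "\<phi> \<in> borel_measurable lebesgue" "\<psi> \<in> borel_measurable lebesgue"
  shows "small_near b (\<lambda>s. \<phi> s + \<psi> s)"
  unfolding small_near_def
proof (intro allI impI)
  fix \<epsilon> :: real assume \<epsilon>: "\<epsilon> > 0"
  obtain \<delta> where \<delta>: "\<delta> > 0" "\<And>t. kconv (\<lambda>s. \<phi> s * indicator ({..b} \<inter> {t - \<delta><..}) s) t \<le> ennreal (\<epsilon> / 2)"
    using \<phi> \<epsilon> unfolding small_near_def by (meson half_gt_zero)
  obtain \<delta>' where \<delta>': "\<delta>' > 0" "\<And>t. kconv (\<lambda>s. \<psi> s * indicator ({..b} \<inter> {t - \<delta>'<..}) s) t \<le> ennreal (\<epsilon> / 2)"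
    using \<psi> \<epsilon> unfolding small_near_def by (meson half_gt_zero)
  let ?\<delta> = "min \<delta> \<delta>'"
  have "kconv (\<lambda>s. (\<phi> s + \<psi> s) * indicator ({..b} \<inter> {t - ?\<delta><..}) s) t \<le> ennreal \<epsilon>" for t
  proof -
    have "kconv (\<lambda>s. (\<phi> s + \<psi> s) * indicator ({..b} \<inter> {t - ?\<delta><..}) s) t
        = kconv (\<lambda>s. \<phi> s * indicator ({..b} \<inter> {t - ?\<delta><..}) s) t + kconv (\<lambda>s. \<psi> s * indicator ({..b} \<inter> {t - ?\<delta><..}) s) t"
      unfolding distrib_right by (rule kconv_add) measurable
    also have "\<dots> \<le> ennreal (\<epsilon> / 2) + ennreal (\<epsilon> / 2)"
      by (intro add_mono order_trans[OF kconv_near_mono \<delta>(2)] order_trans[OF kconv_near_mono \<delta>'(2)]) auto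
    also have "\<dots> = ennreal \<epsilon>" using \<epsilon> by (simp flip: ennreal_plus)
    finally show ?thesis .
  qed
  then show "\<exists>\<delta>>0. \<forall>t. kconv (\<lambda>s. (\<phi> s + \<psi> s) * indicator ({..b} \<inter> {t - \<delta><..}) s) t \<le> ennreal \<epsilon>"
    using \<delta> \<delta>' by (intro exI[of _ ?\<delta>]) auto
qed

lemma small_near_const:
  assumes "0 \<le> B"
  shows "small_near b (\<lambda>s. ennreal B)"
  unfolding small_near_def
proof (intro allI impI)
  fix \<epsilon> :: real assume \<epsilon>: "\<epsilon> > 0"
  \<comment> \<open>The solution of
    \<open>M * \<delta> powr \<beta> / \<beta> = \<epsilon> / (B + 1)\<close>, the left side being
    the bound for the mass of \<open>k\<close> on an interval of length \<open>\<delta>\<close> at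
    the singularity; \<open>B + 1\<close> covers the case \<open>B = 0\<close>.\<close>
  define \<delta> where "\<delta> = (\<epsilon> * \<beta> / (M * (B + 1))) powr (1 / \<beta>)"
  have \<delta>: "\<delta> > 0" "\<delta> powr \<beta> = \<epsilon> * \<beta> / (M * (B + 1))"
    using assms \<epsilon> beta_pos M_pos by (auto simp: \<delta>_def powr_powr)
  have "kconv (\<lambda>s. ennreal B * indicator ({..b} \<inter> {t - \<delta><..}) s) t \<le> ennreal \<epsilon>" for t
  proof -
    have "kconv (\<lambda>s. ennreal B * indicator ({..b} \<inter> {t - \<delta><..}) s) t
        \<le> (\<integral>\<^sup>+s. ennreal B * (ennreal (k (t - s)) * indicator {t - \<delta><..} s) \<partial>lebesgue)"
      unfolding kconv_def by (intro nn_integral_mono) (auto split: split_indicator simp: mult_ac)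
    also have "\<dots> = ennreal B * (\<integral>\<^sup>+s. ennreal (k (t - s)) * indicator {t - \<delta><..} s \<partial>lebesgue)"
      by (rule nn_integral_cmult) measurable
    also have "\<dots> \<le> ennreal B * ennreal (M * \<delta> powr \<beta> / \<beta>)"
      using \<delta>(1) by (intro mult_left_mono nn_integral_k_le) auto
    also have "\<dots> = ennreal (B * (\<epsilon> / (B + 1)))"
    proof -
      have "M * \<delta> powr \<beta> / \<beta> = \<epsilon> / (B + 1)"
        unfolding \<delta>(2) using M_pos beta_pos by simp
      then show ?thesis using assms \<epsilon> by (simp flip: ennreal_mult)
    qed
    also have "\<dots> \<le> ennreal \<epsilon>"
      using assms \<epsilon> by (intro ennreal_leI) (simp add: field_simps)
    finally show ?thesis .
  qed
  then show "\<exists>\<delta>>0. \<forall>t. kconv (\<lambda>s. ennreal B * indicator ({..b} \<inter> {t - \<delta><..}) s) t \<le> ennreal \<epsilon>"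
    using \<delta>(1) by blast
qed

end

text \<open>Truncation at height \<open>N\<close>: where \<open>\<phi>\<close> is larger, its
  \<open>p\<close>-norm is small, and the window bound makes the convolution small for all
  \<open>t\<close>; where it is smaller, the case of a constant applies.\<close>

lemma (in weakly_singular_kernel_Lq) small_near_Lp:
  assumes p: "q \<le> p" and [measurable]: "\<phi> \<in> borel_measurable lebesgue" and \<phi>0: "\<And>s. 0 \<le> \<phi> s"
    and fin: "(\<integral>\<^sup>+s\<in>{0..b}. ennreal (\<phi> s powr p) \<partial>lebesgue) < \<infinity>"
  shows "small_near b (\<lambda>s. ennreal (\<phi> s))"
  unfolding small_near_def
proof (intro allI impI)
  fix \<epsilon> :: real assume \<epsilon>: "\<epsilon> > 0"
  note C = window_const_pos and kconvC = kconv_le_of_windows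
  let ?\<eta> = "\<epsilon> / (2 * window_const)"
  have \<eta>: "?\<eta> > 0" using \<epsilon> C by simp
  define \<psi> where "\<psi> N s = \<phi> s * indicator {s. real N < \<phi> s} s * indicator {0..b} s" for N :: nat and s
  have [measurable]: "\<psi> N \<in> borel_measurable lebesgue" for N
    unfolding \<psi>_def[abs_def] by measurable
  have "(\<lambda>N. \<integral>\<^sup>+s. ennreal (\<psi> N s powr p) \<partial>lebesgue) \<longlonglongrightarrow> (\<integral>\<^sup>+s. 0 \<partial>(lebesgue :: real measure))"
  proof (rule nn_integral_dominated_convergence[where w = "\<lambda>s. ennreal (\<phi> s powr p) * indicator {0..b} s"])
    show "AE s in lebesgue. ennreal (\<psi> N s powr p) \<le> ennreal (\<phi> s powr p) * indicator {0..b} s" for N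
      by (auto simp: \<psi>_def split: split_indicator)
    show "AE s in lebesgue. (\<lambda>N. ennreal (\<psi> N s powr p)) \<longlonglongrightarrow> 0"
    proof (rule AE_I2)
      fix s
      obtain N0 :: nat where "\<phi> s \<le> real N0" using real_arch_simple by blast
      then have "\<psi> N s = 0" if "N0 \<le> N" for N
        using that by (auto simp: \<psi>_def split: split_indicator)
      then have "\<forall>\<^sub>F N in sequentially. ennreal (\<psi> N s powr p) = 0"
        unfolding eventually_sequentially by (intro exI[of _ N0]) auto
      then show "(\<lambda>N. ennreal (\<psi> N s powr p)) \<longlonglongrightarrow> 0" by (rule tendsto_eventually)
    qed
  qed (use fin in measurable)
  then have "\<forall>\<^sub>F N in sequentially. (\<integral>\<^sup>+s. ennreal (\<psi> N s powr p) \<partial>lebesgue) < ennreal (?\<eta> powr p)"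
    using \<eta> by (intro order_tendstoD) auto
  then obtain N where N: "(\<integral>\<^sup>+s. ennreal (\<psi> N s powr p) \<partial>lebesgue) < ennreal (?\<eta> powr p)"
    by (auto simp: eventually_sequentially)
  have \<psi>_kconv: "kconv (\<lambda>s. ennreal (\<psi> N s)) t \<le> ennreal (\<epsilon> / 2)" for t
  proof -
    have "kconv (\<lambda>s. ennreal (\<psi> N s)) t \<le> ennreal (window_const * ?\<eta>)"
    proof (rule kconvC[OF p _ _ \<eta>])
      show "0 \<le> \<psi> N s" for s using \<phi>0 by (simp add: \<psi>_def)
      fix a :: real
      have "window_integral p (\<lambda>s. \<psi> N s) a \<le> (\<integral>\<^sup>+s. ennreal (\<psi> N s powr p) \<partial>lebesgue)"
        by (intro nn_integral_mono) (auto split: split_indicator)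
      with N show "window_integral p (\<lambda>s. \<psi> N s) a \<le> ennreal (?\<eta> powr p)"
        by simp
    qed measurable
    then show ?thesis using C by simp
  qed
  obtain \<delta> where \<delta>: "\<delta> > 0" "\<And>t. kconv (\<lambda>s. ennreal (real N) * indicator ({..b} \<inter> {t - \<delta><..}) s) t \<le> ennreal (\<epsilon> / 2)"
    using small_near_const[of "real N" b] \<epsilon> unfolding small_near_def by (meson half_gt_zero of_nat_0_le_iff)
  have "kconv (\<lambda>s. ennreal (\<phi> s) * indicator ({..b} \<inter> {t - \<delta><..}) s) t \<le> ennreal \<epsilon>" for t
  proof -
    have "kconv (\<lambda>s. ennreal (\<phi> s) * indicator ({..b} \<inter> {t - \<delta><..}) s) t
        \<le> kconv (\<lambda>s. ennreal (\<psi> N s) + ennreal (real N) * indicator ({..b} \<inter> {t - \<delta><..}) s) t"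
    proof (rule kconv_mono)
      fix s :: real assume "0 \<le> s"
      then show "ennreal (\<phi> s) * indicator ({..b} \<inter> {t - \<delta><..}) s
          \<le> ennreal (\<psi> N s) + ennreal (real N) * indicator ({..b} \<inter> {t - \<delta><..}) s"
        by (auto simp: \<psi>_def not_less split: split_indicator intro: ennreal_leI)
    qed
    also have "\<dots> = kconv (\<lambda>s. ennreal (\<psi> N s)) t + kconv (\<lambda>s. ennreal (real N) * indicator ({..b} \<inter> {t - \<delta><..}) s) t"
      by (rule kconv_add) measurable
    also have "\<dots> \<le> ennreal (\<epsilon> / 2) + ennreal (\<epsilon> / 2)"
      by (intro add_mono \<psi>_kconv \<delta>(2))
    also have "\<dots> = ennreal \<epsilon>" using \<epsilon> by (simp flip: ennreal_plus)
    finally show ?thesis .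
  qed
  then show "\<exists>\<delta>>0. \<forall>t. kconv (\<lambda>s. ennreal (\<phi> s) * indicator ({..b} \<inter> {t - \<delta><..}) s) t \<le> ennreal \<epsilon>"
    using \<delta>(1) by blast
qed

section \<open>Asymptotically almost periodic functions\<close>

lemma norm_add_diff_le:
  fixes a b d :: "'a::real_normed_vector"
  shows "norm (a + b - d) \<le> norm a + norm b + norm d"
  using norm_triangle_ineq[of a b] norm_triangle_ineq4[of "a + b" d] by linarith

lemma aap_almost_periods:
  assumes "asymptotically_almost_periodic u" "\<epsilon> > 0"
  obtains l m where "l > 0" "m > 0"
    "\<And>a. 0 \<le> a \<Longrightarrow> \<exists>\<tau>\<in>{a..a + l}. \<forall>t\<ge>m. norm (u (t + \<tau>) - u t) \<le> \<epsilon>"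
  using assms unfolding asymptotically_almost_periodic_def by blast

text \<open>Total boundedness of the range: an almost period carries every late time back into a
  fixed compact interval at the cost of \<open>\<delta> / 2\<close>.\<close>

lemma aap_finite_net:
  fixes u :: "real \<Rightarrow> 'a::real_normed_vector"
  assumes u: "asymptotically_almost_periodic u" and \<delta>: "\<delta> > 0"
  obtains X where "finite X" "\<And>t. 0 \<le> t \<Longrightarrow> \<exists>x\<in>X. norm (u t - x) < \<delta>"
proof -
  have cont: "continuous_on {0..} u" using u by (simp add: asymptotically_almost_periodic_def)
  obtain l m where lm: "l > 0" "m > 0"
      and ap: "\<And>a. 0 \<le> a \<Longrightarrow> \<exists>\<tau>\<in>{a..a + l}. \<forall>t\<ge>m. norm (u (t + \<tau>) - u t) \<le> \<delta> / 2"
    using aap_almost_periods[OF u half_gt_zero[OF \<delta>]] by blast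
  have "compact (u ` {0..m + l})"
    using continuous_on_subset[OF cont, of "{0..m + l}"] by (intro compact_continuous_image) auto
  then obtain X where X: "finite X" "u ` {0..m + l} \<subseteq> (\<Union>x\<in>X. ball x (\<delta> / 2))"
    using half_gt_zero[OF \<delta>] unfolding compact_eq_totally_bounded by blast
  have near: "\<exists>x\<in>X. norm (u t - x) < \<delta> / 2" if "0 \<le> t" "t \<le> m + l" for t
  proof -
    have "u t \<in> (\<Union>x\<in>X. ball x (\<delta> / 2))" using X(2) that by force
    then show ?thesis by (auto simp: dist_norm norm_minus_commute)
  qed
  show ?thesis
  proof (rule that[OF X(1)])
    fix t :: real assume "0 \<le> t"
    show "\<exists>x\<in>X. norm (u t - x) < \<delta>"
    proof (cases "t \<le> m + l")
      case True
      then obtain x where "x \<in> X" "norm (u t - x) < \<delta> / 2" using near \<open>0 \<le> t\<close> by blast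
      then show ?thesis using \<delta> by (intro bexI[of _ x]) auto
    next
      case False
      \<comment> \<open>With this window \<open>t - \<tau>\<close> falls into
        \<open>[m, m + l]\<close>: late enough for the almost period, early enough for the
        net.\<close>
      then obtain \<tau> where \<tau>: "\<tau> \<in> {t - m - l..t - m - l + l}" "\<forall>t\<ge>m. norm (u (t + \<tau>) - u t) \<le> \<delta> / 2"
        using ap[of "t - m - l"] by auto
      then obtain x where x: "x \<in> X" "norm (u (t - \<tau>) - x) < \<delta> / 2"
        using near[of "t - \<tau>"] lm by auto
      have "norm (u t - u (t - \<tau>)) \<le> \<delta> / 2" using \<tau>(2)[rule_format, of "t - \<tau>"] \<tau>(1) by simp
      then have "norm (u t - x) < \<delta>"
        using x(2) norm_diff_triangle_ineq[of "u t" "u (t - \<tau>)" "u (t - \<tau>)" x] by simp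
      then show ?thesis using x by blast
    qed
  qed
qed

text \<open>Again late times are moved back into a compact interval. The interval is longer by
  \<open>1\<close>, and \<open>\<delta>\<close> is capped at \<open>1\<close>, because both points
  move by the same almost period and only the earlier one is placed in
  \<open>[m, m + l]\<close>.\<close>

lemma aap_uniformly_continuous:
  fixes u :: "real \<Rightarrow> 'a::real_normed_vector"
  assumes u: "asymptotically_almost_periodic u" and e: "\<epsilon> > 0"
  obtains \<delta> where "\<delta> > 0" "\<And>s t. 0 \<le> s \<Longrightarrow> 0 \<le> t \<Longrightarrow> \<bar>s - t\<bar> < \<delta> \<Longrightarrow> norm (u s - u t) \<le> \<epsilon>"
proof -
  have cont: "continuous_on {0..} u" using u by (simp add: asymptotically_almost_periodic_def)
  have e3: "\<epsilon> / 3 > 0" using e by simp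
  obtain l m where lm: "l > 0" "m > 0"
      and ap: "\<And>a. 0 \<le> a \<Longrightarrow> \<exists>\<tau>\<in>{a..a + l}. \<forall>t\<ge>m. norm (u (t + \<tau>) - u t) \<le> \<epsilon> / 3"
    using aap_almost_periods[OF u e3] by blast
  have "uniformly_continuous_on {0..m + l + 1} u"
    using continuous_on_subset[OF cont, of "{0..m + l + 1}"] by (intro compact_uniformly_continuous) auto
  then obtain \<delta> where \<delta>: "\<delta> > 0"
      "\<And>s t. s \<in> {0..m+l+1} \<Longrightarrow> t \<in> {0..m+l+1} \<Longrightarrow> dist t s < \<delta> \<Longrightarrow> dist (u t) (u s) < \<epsilon> / 3"
    using e3 unfolding uniformly_continuous_on_def by blast
  have main: "norm (u s - u t) \<le> \<epsilon>" if "0 \<le> t" "t \<le> s" "s - t < min \<delta> 1" for s t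
  proof (cases "s \<le> m + l + 1")
    case True
    then show ?thesis using \<delta>(2)[of t s] that e by (auto simp: dist_norm)
  next
    case False
    then have "0 \<le> t - m - l" using that by linarith
    from ap[OF this] obtain \<tau> where \<tau>: "\<tau> \<in> {t - m - l..t - m - l + l}" "\<forall>t\<ge>m. norm (u (t + \<tau>) - u t) \<le> \<epsilon> / 3"
      by blast
    have 1: "norm (u s - u (s - \<tau>)) \<le> \<epsilon> / 3" using \<tau>(2)[rule_format, of "s - \<tau>"] \<tau>(1) that by simp
    have 2: "norm (u t - u (t - \<tau>)) \<le> \<epsilon> / 3" using \<tau>(2)[rule_format, of "t - \<tau>"] \<tau>(1) by simp
    have 3: "norm (u (s - \<tau>) - u (t - \<tau>)) \<le> \<epsilon> / 3"
      using \<delta>(2)[of "t - \<tau>" "s - \<tau>"] \<tau>(1) that lm by (auto simp: dist_norm)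
    have "norm (u s - u t) = norm ((u s - u (s - \<tau>)) + (u (s - \<tau>) - u (t - \<tau>)) - (u t - u (t - \<tau>)))" by simp
    also have "\<dots> \<le> norm (u s - u (s - \<tau>)) + norm (u (s - \<tau>) - u (t - \<tau>)) + norm (u t - u (t - \<tau>))"
      by (rule norm_add_diff_le)
    finally show ?thesis using 1 2 3 by linarith
  qed
  show ?thesis
  proof (rule that[of "min \<delta> 1"])
    fix s t :: real assume "0 \<le> s" "0 \<le> t" "\<bar>s - t\<bar> < min \<delta> 1"
    then show "norm (u s - u t) \<le> \<epsilon>"
      using main[of t s] main[of s t] by (cases "t \<le> s") (auto simp: norm_minus_commute)
  qed (use \<delta> in auto)
qed

text \<open>Bohr's pigeonhole argument: differences of nearby pairs of almost periods of \<open>P\<close> and \<open>Q\<close>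
  are, up to \<open>\<delta>\<close>, common almost periods.\<close>

lemma common_almost_periods:
  fixes P Q :: "real set"
  assumes P: "lP > 0" "\<And>a. 0 \<le> a \<Longrightarrow> \<exists>\<tau>\<in>{a..a + lP}. \<tau> \<in> P"
    and Q: "lQ > 0" "\<And>a. 0 \<le> a \<Longrightarrow> \<exists>\<tau>\<in>{a..a + lQ}. \<tau> \<in> Q"
    and \<delta>: "\<delta> > 0"
  obtains L where "L > 0"
    "\<And>a. 0 \<le> a \<Longrightarrow> \<exists>\<alpha>\<in>P. \<exists>\<alpha>'\<in>P. \<exists>\<beta>\<in>Q. \<exists>\<beta>'\<in>Q. 0 \<le> \<alpha>' \<and> 0 \<le> \<beta>' \<and>
       \<alpha> - \<alpha>' \<in> {a..a + L} \<and> 0 \<le> \<beta> - \<beta>' \<and> \<bar>(\<alpha> - \<alpha>') - (\<beta> - \<beta>')\<bar> < \<delta>"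
proof -
  define l where "l = max lP lQ"
  have l: "l > 0" "lP \<le> l" "lQ \<le> l" using P by (auto simp: l_def)
  have "\<exists>\<tau>. \<tau> \<in> P \<and> real i * l \<le> \<tau> \<and> \<tau> \<le> real i * l + l" for i :: nat
    using P(2)[of "real i * l"] l by force
  then obtain \<alpha> where \<alpha>: "\<And>i::nat. \<alpha> i \<in> P \<and> real i * l \<le> \<alpha> i \<and> \<alpha> i \<le> real i * l + l"
    by metis
  have "\<exists>\<tau>. \<tau> \<in> Q \<and> real i * l \<le> \<tau> \<and> \<tau> \<le> real i * l + l" for i :: nat
    using Q(2)[of "real i * l"] l by force
  then obtain \<beta> where \<beta>: "\<And>i::nat. \<beta> i \<in> Q \<and> real i * l \<le> \<beta> i \<and> \<beta> i \<le> real i * l + l"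
    by metis
  \<comment> \<open>Both \<open>\<alpha> i\<close> and \<open>\<beta> i\<close> lie in the
    \<open>i\<close>-th interval of length \<open>l\<close>, so their difference lies in
    \<open>[- l, l]\<close>, which meets finitely many cells of width \<open>\<delta>\<close>.
    Indices in one cell have almost equal increments of \<open>\<alpha>\<close> and
    \<open>\<beta>\<close>.\<close>
  define cell where "cell i = \<lfloor>(\<alpha> i - \<beta> i) / \<delta>\<rfloor>" for i
  have cell_range: "cell i \<in> {\<lfloor>- l / \<delta>\<rfloor>..\<lfloor>l / \<delta>\<rfloor>}" for i
    using \<alpha>[of i] \<beta>[of i] \<delta> unfolding cell_def atLeastAtMost_iff
    by (intro conjI floor_mono divide_right_mono) linarith+
  define rep where "rep i = (LEAST j. cell j = cell i)" for i
  have rep: "cell (rep i) = cell i" for i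
    unfolding rep_def by (rule LeastI) simp
  have "range rep \<subseteq> (\<lambda>z. LEAST j. cell j = z) ` {\<lfloor>- l / \<delta>\<rfloor>..\<lfloor>l / \<delta>\<rfloor>}"
    unfolding rep_def using cell_range by blast
  then have "finite (range rep)" by (rule finite_subset) auto
  then obtain N where N: "\<And>i. rep i \<le> N"
    by (metis finite_nat_set_iff_bounded_le rangeI)
  have diff: "\<bar>(\<alpha> i - \<alpha> (rep i)) - (\<beta> i - \<beta> (rep i))\<bar> < \<delta>" for i
  proof -
    have "\<bar>(\<alpha> i - \<beta> i) / \<delta> - (\<alpha> (rep i) - \<beta> (rep i)) / \<delta>\<bar> < 1"
      using rep[of i] unfolding cell_def by linarith
    then have "\<bar>((\<alpha> i - \<beta> i) - (\<alpha> (rep i) - \<beta> (rep i))) / \<delta>\<bar> < 1"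
      by (simp add: diff_divide_distrib)
    then have "\<bar>(\<alpha> i - \<beta> i) - (\<alpha> (rep i) - \<beta> (rep i))\<bar> < \<delta>"
      using \<delta> by (simp add: abs_divide)
    then show ?thesis by (simp add: algebra_simps)
  qed
  show ?thesis
  proof (rule that[of "(real N + 4) * l"])
    show "0 < (real N + 4) * l" using l by simp
    fix a :: real assume a: "0 \<le> a"
    \<comment> \<open>Large enough that \<open>\<alpha> i\<close> exceeds
      \<open>\<alpha> (rep i)\<close>, which is at most \<open>(N + 1) * l\<close>, by
      \<open>a\<close> or more; the difference is at most \<open>a + (N + 3) * l\<close>.\<close>
    define i where "i = nat \<lceil>a / l\<rceil> + N + 1"
    have "real (nat \<lceil>a / l\<rceil>) = of_int \<lceil>a / l\<rceil>" using a l by simp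
    then have "a / l \<le> real (nat \<lceil>a / l\<rceil>)" "real (nat \<lceil>a / l\<rceil>) \<le> a / l + 1" by linarith+
    then have n: "a \<le> real (nat \<lceil>a / l\<rceil>) * l" "real (nat \<lceil>a / l\<rceil>) * l \<le> a + l"
      using l by (simp_all add: field_simps)
    have il: "real i * l = real (nat \<lceil>a / l\<rceil>) * l + real N * l + l"
      by (simp add: i_def algebra_simps)
    have rl: "0 \<le> real (rep i) * l" "real (rep i) * l \<le> real N * l"
      using N[of i] l by (auto intro: mult_right_mono)
    have L: "(real N + 4) * l = real N * l + 4 * l" by (simp add: algebra_simps)
    show "\<exists>\<alpha>\<in>P. \<exists>\<alpha>'\<in>P. \<exists>\<beta>\<in>Q. \<exists>\<beta>'\<in>Q. 0 \<le> \<alpha>' \<and> 0 \<le> \<beta>' \<and>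
       \<alpha> - \<alpha>' \<in> {a..a + (real N + 4) * l} \<and> 0 \<le> \<beta> - \<beta>' \<and> \<bar>(\<alpha> - \<alpha>') - (\<beta> - \<beta>')\<bar> < \<delta>"
    proof (intro bexI conjI)
      show "0 \<le> \<alpha> (rep i)" "0 \<le> \<beta> (rep i)"
        using \<alpha>[of "rep i"] \<beta>[of "rep i"] rl by linarith+
      show "\<alpha> i - \<alpha> (rep i) \<in> {a..a + (real N + 4) * l}"
        using \<alpha>[of i] \<alpha>[of "rep i"] n il rl L l unfolding atLeastAtMost_iff by linarith
      show "0 \<le> \<beta> i - \<beta> (rep i)"
        using \<beta>[of i] \<beta>[of "rep i"] n il rl l a by linarith
    qed (use \<alpha> \<beta> diff in auto)
  qed
qed

text \<open>Gives closedness in the sup norm. Since one good index per \<open>\<epsilon>\<close> is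
  asked, a constant sequence also shows that the values on the negative half-line are
  irrelevant.\<close>

lemma aap_uniform_limit:
  fixes u :: "real \<Rightarrow> 'a::real_normed_vector"
  assumes U: "\<And>n. asymptotically_almost_periodic (U n)"
    and cont: "continuous_on {0..} u" and bdd: "bounded (u ` {0..})"
    and lim: "\<And>\<epsilon>. \<epsilon> > 0 \<Longrightarrow> \<exists>n::nat. \<forall>t\<ge>0. norm (U n t - u t) \<le> \<epsilon>"
  shows "asymptotically_almost_periodic u"
  unfolding asymptotically_almost_periodic_def
proof (intro conjI allI impI cont bdd)
  fix \<epsilon> :: real assume "\<epsilon> > 0"
  then have e3: "\<epsilon> / 3 > 0" by simp
  obtain n where n: "\<And>t. 0 \<le> t \<Longrightarrow> norm (U n t - u t) \<le> \<epsilon> / 3" using lim[OF e3] by blast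
  obtain l m where lm: "l > 0" "m > 0"
      and ap: "\<And>a. 0 \<le> a \<Longrightarrow> \<exists>\<tau>\<in>{a..a + l}. \<forall>t\<ge>m. norm (U n (t + \<tau>) - U n t) \<le> \<epsilon> / 3"
    using aap_almost_periods[OF U[of n] e3] by blast
  have "\<exists>\<tau>\<in>{a..a + l}. \<forall>t\<ge>m. norm (u (t + \<tau>) - u t) \<le> \<epsilon>" if a: "0 \<le> a" for a
  proof -
    obtain \<tau> where \<tau>: "\<tau> \<in> {a..a+l}" "\<And>t. t \<ge> m \<Longrightarrow> norm (U n (t + \<tau>) - U n t) \<le> \<epsilon> / 3"
      using ap[OF a] by blast
    have "norm (u (t + \<tau>) - u t) \<le> \<epsilon>" if t: "t \<ge> m" for t
    proof -
      have "norm (u (t + \<tau>) - u t) = norm ((U n (t + \<tau>) - U n t) + (U n t - u t) - (U n (t + \<tau>) - u (t + \<tau>)))"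
        by simp
      also have "\<dots> \<le> norm (U n (t + \<tau>) - U n t) + norm (U n t - u t) + norm (U n (t + \<tau>) - u (t + \<tau>))"
        by (rule norm_add_diff_le)
      finally show ?thesis using \<tau>(2)[OF t] n[of t] n[of "t + \<tau>"] t lm a \<tau>(1) by auto
    qed
    then show ?thesis using \<tau>(1) by blast
  qed
  then show "\<exists>l>0. \<exists>m>0. \<forall>a\<ge>0. \<exists>\<tau>\<in>{a..a + l}. \<forall>t\<ge>m. norm (u (t + \<tau>) - u t) \<le> \<epsilon>"
    using lm by blast
qed

section \<open>Convolution with the semigroup\<close>

lemma has_strong_bochner_integral_AE_unique:
  assumes M: "complete_measure M" and f: "has_strong_bochner_integral M f y" and g: "has_strong_bochner_integral M g z"
    and eq: "AE x in M. f x = g x"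
  shows "y = z"
proof -
  have "(\<integral>\<^sup>+x. norm (f x - g x) \<partial>M) = (\<integral>\<^sup>+x. 0 \<partial>M)"
    by (rule nn_integral_cong_AE) (use eq in eventually_elim, simp)
  then show ?thesis using has_strong_bochner_integral_norm_diff_le[OF M f g] by simp
qed

lemma (in weakly_singular_kernel) exp_decay_le:
  assumes "B \<ge> 0" "\<epsilon> > 0"
  obtains m where "m > 0" "\<And>t. t \<ge> m \<Longrightarrow> exp (- c * (t - a)) * B \<le> \<epsilon>"
proof -
  have "((\<lambda>t. exp (- c * (t - a)) * B) \<longlongrightarrow> 0 * B) at_top"
  proof (intro tendsto_intros filterlim_compose[OF exp_at_bot])
    have "filterlim (\<lambda>t. c * (- a + t)) at_top at_top"
      using c_pos by (intro filterlim_tendsto_pos_mult_at_top[OF tendsto_const]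
          filterlim_tendsto_add_at_top[OF tendsto_const] filterlim_ident)
    then show "filterlim (\<lambda>t. - c * (t - a)) at_bot at_top"
      by (simp add: filterlim_uminus_at_bot)
  qed
  then have "\<forall>\<^sub>F t in at_top. exp (- c * (t - a)) * B < \<epsilon>"
    using assms by (intro order_tendstoD) auto
  then obtain N where N: "\<And>t. t \<ge> N \<Longrightarrow> exp (- c * (t - a)) * B < \<epsilon>"
    by (auto simp: eventually_at_top_linorder)
  show ?thesis by (rule that[of "max N 1"]) (use N in \<open>auto intro: less_imp_le\<close>)
qed

locale singular_semigroup = weakly_singular_kernel M c \<beta> for M c \<beta> :: real +
  fixes T :: "real \<Rightarrow> 'a::banach \<Rightarrow>\<^sub>L 'a"
  assumes T_continuous: "continuous_on {0<..} T"
    and T_bound: "t > 0 \<Longrightarrow> norm (T t) \<le> k t"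
begin

text \<open>The upper limit is an indicator on the operator, so integrands for different
  \<open>t\<close> live on the same line and can be subtracted and shifted; the lower limit is
  enforced by \<open>admissible\<close>, which makes \<open>F\<close> vanish at negative
  times.\<close>

definition integrand :: "(real \<Rightarrow> 'a) \<Rightarrow> real \<Rightarrow> real \<Rightarrow> 'a" where
  "integrand F t s = blinfun_apply (indicator {..<t} s *\<^sub>R T (t - s)) (F s)"

definition Tconv :: "(real \<Rightarrow> 'a) \<Rightarrow> real \<Rightarrow> 'a" where
  "Tconv F t = strong_bochner_integral lebesgue (integrand F t)"

definition admissible :: "(real \<Rightarrow> 'a) \<Rightarrow> bool" where
  "admissible F \<longleftrightarrow> strongly_measurable lebesgue F \<and> (\<forall>s<0. F s = 0) \<and>
     (\<forall>t. kconv (\<lambda>s. ennreal (norm (F s))) t < \<infinity>)"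

lemma admissible_measurable:
  assumes "admissible F"
  shows "(\<lambda>s. ennreal (norm (F s))) \<in> borel_measurable lebesgue"
  using assms by (intro strongly_measurable_ennreal_norm complete_measure_lebesgue) (simp add: admissible_def)

text \<open>With \<open>\<delta> = 0\<close> this is the operator of the convolution, with
  \<open>\<delta> > 0\<close> the same operator frozen at \<open>T \<delta>\<close> near the
  singularity.\<close>

lemma T_strongly_measurable:
  "strongly_measurable lebesgue (\<lambda>s. indicator {..<t} s *\<^sub>R T (max (t - s) \<delta>))" if "0 \<le> \<delta>"
proof (rule continuous_on_imp_strongly_measurable)
  show "continuous_on {..<t} (\<lambda>s. T (max (t - s) \<delta>))"
    by (rule continuous_on_compose2[OF T_continuous]) (auto intro!: continuous_intros)
qed auto

lemma T_indicator_bound: "norm (indicator {..<t} s *\<^sub>R T (t - s)) \<le> k (t - s)"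
  using T_bound[of "t - s"] by (auto split: split_indicator)

lemma integrand_measurable:
  assumes "admissible F"
  shows "strongly_measurable lebesgue (integrand F t)"
proof -
  have "strongly_measurable lebesgue (\<lambda>s. blinfun_apply (indicator {..<t} s *\<^sub>R T (max (t - s) 0)) (F s))"
    using assms by (intro strongly_measurable_blinfun_apply T_strongly_measurable) (auto simp: admissible_def)
  also have "(\<lambda>s. blinfun_apply (indicator {..<t} s *\<^sub>R T (max (t - s) 0)) (F s)) = integrand F t"
    by (auto simp: integrand_def fun_eq_iff split: split_indicator)
  finally show ?thesis .
qed

lemma norm_integrand_diff_le:
  "norm (integrand F t s - integrand G t s) \<le> k (t - s) * norm (F s - G s)"
proof -
  have "norm (integrand F t s - integrand G t s) = norm (blinfun_apply (indicator {..<t} s *\<^sub>R T (t - s)) (F s - G s))"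
    by (simp add: integrand_def blinfun.diff_right)
  also have "\<dots> \<le> norm (indicator {..<t} s *\<^sub>R T (t - s)) * norm (F s - G s)"
    by (rule norm_blinfun)
  also have "\<dots> \<le> k (t - s) * norm (F s - G s)"
    by (intro mult_right_mono T_indicator_bound) auto
  finally show ?thesis .
qed

lemma nn_integral_integrand_diff_le:
  assumes "admissible F" "admissible G"
  shows "(\<integral>\<^sup>+s. ennreal (norm (integrand F t s - integrand G t s)) \<partial>lebesgue)
    \<le> kconv (\<lambda>s. ennreal (norm (F s - G s))) t"
  unfolding kconv_def
proof (rule nn_integral_mono)
  fix s
  have "F s = 0 \<and> G s = 0" if "s < 0" using assms that by (simp add: admissible_def)
  then show "ennreal (norm (integrand F t s - integrand G t s))
      \<le> ennreal (k (t - s)) * ennreal (norm (F s - G s)) * indicator {0..} s"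
    using norm_integrand_diff_le[of F t s G]
    by (cases "s < 0") (auto simp: integrand_def simp flip: ennreal_mult intro!: ennreal_leI split: split_indicator)
qed

lemma admissible_0: "admissible (\<lambda>_. 0)"
  unfolding admissible_def strongly_measurable_def by (auto intro!: exI[of _ "\<lambda>_ _. 0"])

lemma nn_integral_integrand_le:
  assumes "admissible F"
  shows "(\<integral>\<^sup>+s. ennreal (norm (integrand F t s)) \<partial>lebesgue) \<le> kconv (\<lambda>s. ennreal (norm (F s))) t"
  using nn_integral_integrand_diff_le[OF assms admissible_0] by (simp add: integrand_def)

lemma Tconv_integral:
  assumes F: "admissible F"
  shows "has_strong_bochner_integral lebesgue (integrand F t) (Tconv F t)"
proof -
  have "(\<integral>\<^sup>+s. ennreal (norm (integrand F t s)) \<partial>lebesgue) < \<infinity>"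
    using nn_integral_integrand_le[OF F, of t] F by (auto simp: admissible_def intro: le_less_trans)
  then obtain z where z: "has_strong_bochner_integral lebesgue (integrand F t) z"
    using has_strong_bochner_integral_exists[OF complete_measure_lebesgue integrand_measurable[OF F]] by blast
  show ?thesis
    unfolding Tconv_def strong_bochner_integral_def
    using z has_strong_bochner_integral_unique[OF complete_measure_lebesgue _ z] by (rule theI)
qed

lemma norm_Tconv_diff_le:
  assumes "admissible F" "admissible G"
  shows "ennreal (norm (Tconv F t - Tconv G t)) \<le> kconv (\<lambda>s. ennreal (norm (F s - G s))) t"
  using has_strong_bochner_integral_norm_diff_le[OF complete_measure_lebesgue Tconv_integral[OF assms(1)] Tconv_integral[OF assms(2)]]
    nn_integral_integrand_diff_le[OF assms] by (rule order_trans)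

lemma norm_Tconv_le:
  assumes "admissible F"
  shows "ennreal (norm (Tconv F t)) \<le> kconv (\<lambda>s. ennreal (norm (F s))) t"
  using has_strong_bochner_integral_norm_le[OF complete_measure_lebesgue Tconv_integral[OF assms]]
    nn_integral_integrand_le[OF assms] by (rule order_trans)

text \<open>The bridge to the integral in the definition of a mild solution, which differs from
  \<open>integrand\<close> only at the null set \<open>s = t\<close>. Existence on the interval
  follows from the norm bound, and the value is identified after extension by zero.\<close>

lemma has_strong_bochner_integral_interval_iff:
  assumes F: "admissible F"
  shows "has_strong_bochner_integral (lebesgue_on {0..t}) (\<lambda>s. blinfun_apply (T (t - s)) (F s)) J \<longleftrightarrow> J = Tconv F t"
proof -
  let ?G = "\<lambda>s. blinfun_apply (T (t - s)) (F s)"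
  have "AE s in lebesgue. s \<noteq> t"
    using AE_completion[OF AE_lborel_singleton[of t]] by simp
  then have eq: "AE s in lebesgue. integrand F t s = indicator {0..t} s *\<^sub>R ?G s"
    by eventually_elim (use F in \<open>auto simp: integrand_def admissible_def not_le split: split_indicator\<close>)
  have uniq: "z = Tconv F t" if "has_strong_bochner_integral (lebesgue_on {0..t}) ?G z" for z
    using has_strong_bochner_integral_AE_unique[OF complete_measure_lebesgue Tconv_integral[OF F]
        has_strong_bochner_integral_lebesgue_on[OF _ that] eq] by simp
  have "strongly_measurable (lebesgue_on {0..t}) ?G"
    unfolding strongly_measurable_lebesgue_on[OF lmeasurable_cbox[THEN fmeasurableD], of 0 t, simplified]
    using eq by (rule strongly_measurable_cong_AE[OF complete_measure_lebesgue integrand_measurable[OF F]])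
  moreover have "(\<integral>\<^sup>+s. ennreal (norm (?G s)) \<partial>lebesgue_on {0..t}) < \<infinity>"
  proof -
    have "(\<integral>\<^sup>+s. ennreal (norm (?G s)) \<partial>lebesgue_on {0..t}) = (\<integral>\<^sup>+s. ennreal (norm (?G s)) * indicator {0..t} s \<partial>lebesgue)"
      by (subst nn_integral_restrict_space) auto
    also have "\<dots> = (\<integral>\<^sup>+s. ennreal (norm (integrand F t s)) \<partial>lebesgue)"
      by (rule nn_integral_cong_AE) (use eq in eventually_elim, auto split: split_indicator)
    also have "\<dots> < \<infinity>"
      using nn_integral_integrand_le[OF F, of t] F by (auto simp: admissible_def intro: le_less_trans)
    finally show ?thesis .
  qed
  ultimately obtain z where "has_strong_bochner_integral (lebesgue_on {0..t}) ?G z"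
    using has_strong_bochner_integral_exists[OF complete_measure_lebesgue_on, of "{0..t}"] by auto
  with uniq show ?thesis by metis
qed

text \<open>After translating the first integral by \<open>\<tau>\<close>, both carry the kernel
  \<open>T (t - s)\<close>. For \<open>s \<ge> 0\<close> the functions are compared; on
  \<open>[- \<tau>, 0)\<close> only the shifted function is present, and there
  \<open>k (t - s)\<close> is at most \<open>exp (- c * t) * k (- s)\<close>.\<close>

lemma norm_Tconv_shift_diff_le:
  assumes F: "admissible F" and t: "0 \<le> t" and \<tau>: "0 \<le> \<tau>"
  shows "ennreal (norm (Tconv F (t + \<tau>) - Tconv F t)) \<le>
    kconv (\<lambda>s. ennreal (norm (F (s + \<tau>) - F s))) t + ennreal (exp (- c * t)) * kconv (\<lambda>s. ennreal (norm (F s))) \<tau>"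
proof -
  have sm: "strongly_measurable lebesgue F" using F by (simp add: admissible_def)
  let ?D = "\<lambda>s. ennreal (norm (F (\<tau> + s) - F s))"
  have [measurable]: "?D \<in> borel_measurable lebesgue"
    by (intro strongly_measurable_ennreal_norm complete_measure_lebesgue strongly_measurable_diff
        strongly_measurable_translation sm)
  note [measurable] = admissible_measurable[OF F]
  have "has_strong_bochner_integral lebesgue (\<lambda>s. integrand F (t + \<tau>) (\<tau> + s)) (Tconv F (t + \<tau>))"
    by (rule has_strong_bochner_integral_translation[OF Tconv_integral[OF F]])
  from has_strong_bochner_integral_norm_diff_le[OF complete_measure_lebesgue this Tconv_integral[OF F, of t]]
  have "ennreal (norm (Tconv F (t + \<tau>) - Tconv F t))
      \<le> (\<integral>\<^sup>+s. ennreal (norm (integrand F (t + \<tau>) (\<tau> + s) - integrand F t s)) \<partial>lebesgue)" .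
  also have "\<dots> \<le> (\<integral>\<^sup>+s. ennreal (k (t - s)) * ?D s * indicator {0..} s +
      ennreal (exp (- c * t)) * (ennreal (k (\<tau> - (\<tau> + s))) * ennreal (norm (F (\<tau> + s))) * indicator {0..} (\<tau> + s)) \<partial>lebesgue)"
  proof (rule nn_integral_mono)
    fix s
    have "integrand F (t + \<tau>) (\<tau> + s) = integrand (\<lambda>s. F (\<tau> + s)) t s"
      by (auto simp: integrand_def split: split_indicator)
    then have le: "norm (integrand F (t + \<tau>) (\<tau> + s) - integrand F t s) \<le> k (t - s) * norm (F (\<tau> + s) - F s)"
      using norm_integrand_diff_le[of "\<lambda>s. F (\<tau> + s)" t s F] by simp
    show "ennreal (norm (integrand F (t + \<tau>) (\<tau> + s) - integrand F t s)) \<le>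
      ennreal (k (t - s)) * ?D s * indicator {0..} s +
      ennreal (exp (- c * t)) * (ennreal (k (\<tau> - (\<tau> + s))) * ennreal (norm (F (\<tau> + s))) * indicator {0..} (\<tau> + s))"
    proof (cases "s < 0")
      case False
      then have "ennreal (norm (integrand F (t + \<tau>) (\<tau> + s) - integrand F t s)) \<le> ennreal (k (t - s)) * ?D s * indicator {0..} s"
        using le by (auto simp flip: ennreal_mult intro!: ennreal_leI)
      then show ?thesis by (rule add_increasing2[rotated]) simp
    next
      case s: True
      then have Fs: "F s = 0" using F by (simp add: admissible_def)
      show ?thesis
      proof (cases "\<tau> + s < 0")
        case True
        then have "F (\<tau> + s) = 0" using F by (simp add: admissible_def)
        then show ?thesis using Fs le by simp
      next
        case False
        have "k (t - s) \<le> exp (- c * t) * k (- s)"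
          using k_shift_le[of "- s" t] s t by (simp add: add.commute)
        then have "k (t - s) * norm (F (\<tau> + s) - F s) \<le> exp (- c * t) * k (- s) * norm (F (\<tau> + s))"
          using Fs by (simp add: mult_right_mono)
        with le have "norm (integrand F (t + \<tau>) (\<tau> + s) - integrand F t s) \<le> exp (- c * t) * (k (- s) * norm (F (\<tau> + s)))"
          by (simp add: mult.assoc)
        then have "ennreal (norm (integrand F (t + \<tau>) (\<tau> + s) - integrand F t s)) \<le>
            ennreal (exp (- c * t)) * (ennreal (k (\<tau> - (\<tau> + s))) * ennreal (norm (F (\<tau> + s))) * indicator {0..} (\<tau> + s))"
          using False by (auto simp flip: ennreal_mult intro!: ennreal_leI)
        then show ?thesis by (rule add_increasing[rotated]) simp
      qed
    qed
  qed
  also have "\<dots> = kconv ?D t + (\<integral>\<^sup>+s. ennreal (exp (- c * t)) * (ennreal (k (\<tau> - (\<tau> + s))) * ennreal (norm (F (\<tau> + s))) * indicator {0..} (\<tau> + s)) \<partial>lebesgue)"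
    unfolding kconv_def
  proof (rule nn_integral_add)
    show "(\<lambda>s. ennreal (exp (- c * t)) * (ennreal (k (\<tau> - (\<tau> + s))) * ennreal (norm (F (\<tau> + s))) * indicator {0..} (\<tau> + s))) \<in> borel_measurable lebesgue"
      by (rule measurable_compose[OF lebesgue_translation(1),
          of "\<lambda>s. ennreal (exp (- c * t)) * (ennreal (k (\<tau> - s)) * ennreal (norm (F s)) * indicator {0..} s)"]) measurable
  qed measurable
  also have "(\<integral>\<^sup>+s. ennreal (exp (- c * t)) * (ennreal (k (\<tau> - (\<tau> + s))) * ennreal (norm (F (\<tau> + s))) * indicator {0..} (\<tau> + s)) \<partial>lebesgue)
      = (\<integral>\<^sup>+s. ennreal (exp (- c * t)) * (ennreal (k (\<tau> - s)) * ennreal (norm (F s)) * indicator {0..} s) \<partial>lebesgue)"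
    by (rule nn_integral_lebesgue_translation[of "\<lambda>s. ennreal (exp (- c * t)) * (ennreal (k (\<tau> - s)) * ennreal (norm (F s)) * indicator {0..} s)"]) measurable
  also have "\<dots> = ennreal (exp (- c * t)) * kconv (\<lambda>s. ennreal (norm (F s))) \<tau>"
    unfolding kconv_def by (rule nn_integral_cmult) measurable
  finally show ?thesis by (simp add: add.commute)
qed

text \<open>Local integrability is read off from the convolution at time \<open>b + 1\<close>, since
  the decreasing kernel is at least \<open>k (b + 1) > 0\<close> there.\<close>

lemma nn_integral_Icc_less_top:
  assumes F: "admissible F"
  shows "(\<integral>\<^sup>+s\<in>{..b}. ennreal (norm (F s)) \<partial>lebesgue) < \<infinity>"
proof (cases "b \<ge> 0")
  case True
  note [measurable] = admissible_measurable[OF F]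
  have "k (b + 1) > 0" using True M_pos by (simp add: k_def)
  have "ennreal (k (b + 1)) * (\<integral>\<^sup>+s\<in>{..b}. ennreal (norm (F s)) \<partial>lebesgue)
      = (\<integral>\<^sup>+s. ennreal (k (b + 1)) * (ennreal (norm (F s)) * indicator {..b} s) \<partial>lebesgue)"
    by (rule nn_integral_cmult[symmetric]) measurable
  also have "\<dots> \<le> kconv (\<lambda>s. ennreal (norm (F s))) (b + 1)"
    unfolding kconv_def
  proof (rule nn_integral_mono)
    fix s
    have "k (b + 1) \<le> k (b + 1 - s)" if "0 \<le> s" "s \<le> b" using that by (intro k_antimono) auto
    moreover have "F s = 0" if "s < 0" using F that by (simp add: admissible_def)
    ultimately show "ennreal (k (b + 1)) * (ennreal (norm (F s)) * indicator {..b} s)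
      \<le> ennreal (k (b + 1 - s)) * ennreal (norm (F s)) * indicator {0..} s"
      by (cases "s < 0") (auto split: split_indicator intro!: mult_right_mono ennreal_leI)
  qed
  also have "\<dots> < \<infinity>" using F by (simp add: admissible_def)
  finally show ?thesis using \<open>k (b + 1) > 0\<close> by (auto simp: ennreal_mult_less_top)
next
  case False
  then have "(\<integral>\<^sup>+s\<in>{..b}. ennreal (norm (F s)) \<partial>lebesgue) = (\<integral>\<^sup>+s. 0 \<partial>(lebesgue :: real measure))"
    using F by (intro nn_integral_cong) (auto simp: admissible_def split: split_indicator)
  then show ?thesis by simp
qed

lemma Tconv_continuous:
  assumes F: "admissible F" and small: "\<And>b. small_near b (\<lambda>s. ennreal (norm (F s)))"
  shows "continuous_on {0..} (Tconv F)"
  unfolding continuous_on_sequentially comp_def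
proof (intro allI ballI impI)
  fix x :: "nat \<Rightarrow> real" and t :: real
  assume t: "t \<in> {0..}" and x: "(\<forall>n. x n \<in> {0..}) \<and> x \<longlonglongrightarrow> t"
  note [measurable] = admissible_measurable[OF F]
  \<comment> \<open>A convergent sequence of times is bounded; the integrands vanish beyond
    \<open>b\<close>, so the local smallness of \<open>F\<close> applies to all of them at
    once.\<close>
  obtain b where b: "\<And>n. x n \<le> b" "t \<le> b"
  proof -
    obtain B where B: "\<And>n. \<bar>x n\<bar> \<le> B"
      using convergent_imp_Bseq[of x] x by (auto simp: convergent_def Bseq_def)
    then show ?thesis by (intro that[of "max B t"]) (auto intro: order_trans[OF abs_ge_self] max.coboundedI1)
  qed
  show "(\<lambda>n. Tconv F (x n)) \<longlonglongrightarrow> Tconv F t"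
  proof (rule metric_LIMSEQ_I)
    fix e :: real assume "e > 0"
    then have e8: "e / 8 > 0" by simp
    obtain \<delta> where \<delta>: "\<delta> > 0" "\<And>t. kconv (\<lambda>s. ennreal (norm (F s)) * indicator ({..b} \<inter> {t - \<delta><..}) s) t \<le> ennreal (e / 8)"
      using small e8 unfolding small_near_def by blast
    define R where "R t s = indicator {..<t} s *\<^sub>R T (max (t - s) \<delta>)" for t s
    \<comment> \<open>The freezing error: both \<open>T (t - s)\<close> and
      \<open>T \<delta>\<close> have norm at most \<open>k (t - s)\<close> when
      \<open>t - s < \<delta>\<close>, whence the factor \<open>2\<close>.\<close>
    define r where "r t s = 2 * (ennreal (k (t - s)) * (ennreal (norm (F s)) * indicator ({..b} \<inter> {t - \<delta><..}) s) * indicator {0..} s)" for t s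
    define D where "D n s = ennreal (norm (R (x n) s - R t s)) * (ennreal (norm (F s)) * indicator {..b} s)" for n s
    have R_sm: "strongly_measurable lebesgue (R t)" for t
      unfolding R_def[abs_def] using \<delta> by (intro T_strongly_measurable) auto
    have [measurable]: "(\<lambda>s. ennreal (norm (R (x n) s - R t s))) \<in> borel_measurable lebesgue" for n
      by (intro strongly_measurable_ennreal_norm complete_measure_lebesgue strongly_measurable_diff R_sm)
    have D_meas [measurable]: "D n \<in> borel_measurable lebesgue" for n
      unfolding D_def[abs_def] by measurable
    have r_meas [measurable]: "r t \<in> borel_measurable lebesgue" for t
      unfolding r_def[abs_def] by measurable
    have r_int: "(\<integral>\<^sup>+s. r t s \<partial>lebesgue) \<le> ennreal (e / 4)" for t
    proof -
      have "(\<integral>\<^sup>+s. r t s \<partial>lebesgue) = 2 * kconv (\<lambda>s. ennreal (norm (F s)) * indicator ({..b} \<inter> {t - \<delta><..}) s) t"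
        unfolding r_def kconv_def by (rule nn_integral_cmult) measurable
      also have "\<dots> \<le> 2 * ennreal (e / 8)" by (intro mult_left_mono \<delta>) auto
      also have "\<dots> = ennreal (e / 4)"
        using e8 ennreal_mult[of 2 "e / 8"] by simp
      finally show ?thesis .
    qed
    have R_near: "norm (indicator {..<t} s *\<^sub>R T (t - s) - R t s) * norm (F s) \<le> 2 * (k (t - s) * (norm (F s) * indicator {t - \<delta><..} s))" for t s
    proof (cases "s < t \<and> t - \<delta> < s")
      case True
      then have "norm (T (t - s)) \<le> k (t - s)" "norm (T \<delta>) \<le> k (t - s)"
        using T_bound[of "t - s"] T_bound[of \<delta>] k_antimono[of "t - s" \<delta>] \<delta> by auto
      then have "norm (T (t - s) - T \<delta>) \<le> 2 * k (t - s)"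
        using norm_triangle_ineq4[of "T (t - s)" "T \<delta>"] by linarith
      from mult_right_mono[OF this, of "norm (F s)"] show ?thesis
        using True by (simp add: R_def mult.assoc)
    next
      case False
      then have "s < t \<Longrightarrow> max (t - s) \<delta> = t - s" by auto
      then have "indicator {..<t} s *\<^sub>R T (t - s) - R t s = 0"
        by (auto simp: R_def split: split_indicator)
      then show ?thesis by simp
    qed
    have split: "ennreal (norm (integrand F (x n) s - integrand F t s)) \<le> D n s + r (x n) s + r t s" for n s
    proof (cases "s < 0 \<or> s > b")
      case True
      then have "integrand F (x n) s = 0" "integrand F t s = 0"
        using F b(1)[of n] b(2) by (auto simp: integrand_def admissible_def split: split_indicator)
      then show ?thesis by simp
    next
      case False
      let ?A = "\<lambda>t. indicator {..<t} s *\<^sub>R T (t - s)"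
      have "norm (integrand F (x n) s - integrand F t s) = norm (blinfun_apply (?A (x n) - ?A t) (F s))"
        by (simp add: integrand_def blinfun.diff_left)
      also have "\<dots> \<le> norm (?A (x n) - ?A t) * norm (F s)" by (rule norm_blinfun)
      also have "\<dots> \<le> (norm (R (x n) s - R t s) + norm (?A (x n) - R (x n) s) + norm (?A t - R t s)) * norm (F s)"
      proof (rule mult_right_mono)
        have "norm (?A (x n) - ?A t) = norm ((R (x n) s - R t s) + (?A (x n) - R (x n) s) - (?A t - R t s))" by simp
        also have "\<dots> \<le> norm (R (x n) s - R t s) + norm (?A (x n) - R (x n) s) + norm (?A t - R t s)"
          by (rule norm_add_diff_le)
        finally show "norm (?A (x n) - ?A t) \<le> norm (R (x n) s - R t s) + norm (?A (x n) - R (x n) s) + norm (?A t - R t s)" .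
      qed simp
      also have "\<dots> \<le> norm (R (x n) s - R t s) * norm (F s) + 2 * (k (x n - s) * (norm (F s) * indicator {x n - \<delta><..} s))
          + 2 * (k (t - s) * (norm (F s) * indicator {t - \<delta><..} s))"
        unfolding distrib_right by (intro add_mono R_near order_refl)
      finally have "ennreal (norm (integrand F (x n) s - integrand F t s)) \<le> ennreal (norm (R (x n) s - R t s) * norm (F s)
          + 2 * (k (x n - s) * (norm (F s) * indicator {x n - \<delta><..} s)) + 2 * (k (t - s) * (norm (F s) * indicator {t - \<delta><..} s)))"
        by (rule ennreal_leI)
      also have "\<dots> = D n s + r (x n) s + r t s"
        using False by (auto simp: D_def r_def ennreal_mult split: split_indicator)
      finally show ?thesis .
    qed
    have "(\<lambda>n. \<integral>\<^sup>+s. D n s \<partial>lebesgue) \<longlonglongrightarrow> (\<integral>\<^sup>+s. 0 \<partial>(lebesgue :: real measure))"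
    proof (rule nn_integral_dominated_convergence[where w = "\<lambda>s. ennreal (2 * k \<delta>) * (ennreal (norm (F s)) * indicator {..b} s)"])
      have Rb: "norm (R t s) \<le> k \<delta>" for t s
      proof -
        have "0 < max (t - s) \<delta>" "\<delta> \<le> max (t - s) \<delta>" using \<delta>(1) by auto
        then have "norm (T (max (t - s) \<delta>)) \<le> k \<delta>"
          using T_bound[of "max (t - s) \<delta>"] k_antimono[of \<delta> "max (t - s) \<delta>"] \<delta>(1) by linarith
        then show ?thesis by (auto simp: R_def split: split_indicator)
      qed
      have "norm (R (x n) s - R t s) \<le> 2 * k \<delta>" for n s
        using norm_triangle_ineq4[of "R (x n) s" "R t s"] Rb[of "x n" s] Rb[of t s] by linarith
      then show "AE s in lebesgue. D n s \<le> ennreal (2 * k \<delta>) * (ennreal (norm (F s)) * indicator {..b} s)" for n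
        unfolding D_def by (intro AE_I2 mult_right_mono ennreal_leI) auto
      have "(\<integral>\<^sup>+s. ennreal (2 * k \<delta>) * (ennreal (norm (F s)) * indicator {..b} s) \<partial>lebesgue)
          = ennreal (2 * k \<delta>) * (\<integral>\<^sup>+s\<in>{..b}. ennreal (norm (F s)) \<partial>lebesgue)"
        by (rule nn_integral_cmult) measurable
      then show "(\<integral>\<^sup>+s. ennreal (2 * k \<delta>) * (ennreal (norm (F s)) * indicator {..b} s) \<partial>lebesgue) < \<infinity>"
        using nn_integral_Icc_less_top[OF F, of b] by (simp add: ennreal_mult_less_top)
      \<comment> \<open>At \<open>s = t\<close> the cut-off may jump along the sequence; away from
        it the cut-off is eventually constant and \<open>T\<close> is continuous.\<close>
      have "AE s in lebesgue. s \<noteq> t"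
        using AE_completion[OF AE_lborel_singleton[of t]] by simp
      then show "AE s in lebesgue. (\<lambda>n. D n s) \<longlonglongrightarrow> 0"
      proof eventually_elim
        case (elim s)
        have "(\<lambda>n. R (x n) s) \<longlonglongrightarrow> R t s"
        proof (cases "s < t")
          case True
          have ev: "\<forall>\<^sub>F n in sequentially. s < x n" using x True by (auto intro: order_tendstoD)
          have "isCont T (max (t - s) \<delta>)"
            using T_continuous True \<delta> by (intro continuous_on_interior[of "{0<..}"]) (auto simp: interior_open)
          moreover have "(\<lambda>n. max (x n - s) \<delta>) \<longlonglongrightarrow> max (t - s) \<delta>"
            using x by (intro tendsto_intros) auto
          ultimately have "(\<lambda>n. T (max (x n - s) \<delta>)) \<longlonglongrightarrow> T (max (t - s) \<delta>)"
            by (rule isCont_tendsto_compose)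
          then have "(\<lambda>n. T (max (x n - s) \<delta>)) \<longlonglongrightarrow> R t s" using True by (simp add: R_def)
          moreover have "\<forall>\<^sub>F n in sequentially. T (max (x n - s) \<delta>) = R (x n) s"
            using ev by eventually_elim (simp add: R_def)
          ultimately show ?thesis by (rule Lim_transform_eventually)
        next
          case False
          then have "\<forall>\<^sub>F n in sequentially. x n < s" using x elim by (auto intro: order_tendstoD)
          then have "\<forall>\<^sub>F n in sequentially. R (x n) s = R t s"
            by eventually_elim (use False in \<open>simp add: R_def\<close>)
          then show ?thesis by (rule tendsto_eventually)
        qed
        then have "(\<lambda>n. ennreal (norm (R (x n) s - R t s) * (norm (F s) * indicator {..b} s)))
            \<longlonglongrightarrow> ennreal (norm (R t s - R t s) * (norm (F s) * indicator {..b} s))"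
          by (intro tendsto_intros)
        then show ?case by (simp add: D_def ennreal_mult ennreal_indicator)
      qed
    qed measurable
    then have "\<forall>\<^sub>F n in sequentially. (\<integral>\<^sup>+s. D n s \<partial>lebesgue) < ennreal (e / 4)"
      using e8 by (intro order_tendstoD) auto
    then obtain N where N: "\<And>n. N \<le> n \<Longrightarrow> (\<integral>\<^sup>+s. D n s \<partial>lebesgue) < ennreal (e / 4)"
      by (auto simp: eventually_sequentially)
    have "dist (Tconv F (x n)) (Tconv F t) < e" if n: "N \<le> n" for n
    proof -
      have "ennreal (dist (Tconv F (x n)) (Tconv F t)) \<le> (\<integral>\<^sup>+s. ennreal (norm (integrand F (x n) s - integrand F t s)) \<partial>lebesgue)"
        unfolding dist_norm
        by (rule has_strong_bochner_integral_norm_diff_le[OF complete_measure_lebesgue Tconv_integral[OF F] Tconv_integral[OF F]])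
      also have "\<dots> \<le> (\<integral>\<^sup>+s. D n s + r (x n) s + r t s \<partial>lebesgue)"
        by (intro nn_integral_mono split)
      also have "\<dots> = (\<integral>\<^sup>+s. D n s \<partial>lebesgue) + (\<integral>\<^sup>+s. r (x n) s \<partial>lebesgue) + (\<integral>\<^sup>+s. r t s \<partial>lebesgue)"
        by (simp only: nn_integral_add[OF borel_measurable_add[OF D_meas r_meas] r_meas] nn_integral_add[OF D_meas r_meas])
      also have "\<dots> \<le> ennreal (e / 4) + ennreal (e / 4) + ennreal (e / 4)"
        by (intro add_mono r_int less_imp_le[OF N[OF n]])
      also have "\<dots> = ennreal (3 * e / 4)" using e8 by (simp flip: ennreal_plus)
      finally have "dist (Tconv F (x n)) (Tconv F t) \<le> 3 * e / 4" using e8 by (simp add: ennreal_le_iff)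
      then show ?thesis using e8 by simp
    qed
    then show "\<exists>no. \<forall>n\<ge>no. dist (Tconv F (x n)) (Tconv F t) < e" by blast
  qed
qed

text \<open>Almost periodicity of \<open>F\<close> is needed only in the norm given by convolution
  with \<open>k\<close>. The boundary term of the shift estimate is at most
  \<open>exp (- c * t) * B\<close> whatever the shift, and disappears for late
  \<open>t\<close>.\<close>

lemma aap_Tconv:
  assumes F: "admissible F" and small: "\<And>b. small_near b (\<lambda>s. ennreal (norm (F s)))"
    and B: "0 \<le> B" "\<And>t. kconv (\<lambda>s. ennreal (norm (F s))) t \<le> ennreal B"
    and ap: "\<And>\<epsilon>. \<epsilon> > 0 \<Longrightarrow> \<exists>l>0. \<exists>m>0. \<forall>a\<ge>0. \<exists>\<tau>\<in>{a..a + l}. \<forall>t\<ge>m. kconv (\<lambda>s. ennreal (norm (F (s + \<tau>) - F s))) t \<le> ennreal \<epsilon>"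
  shows "asymptotically_almost_periodic (Tconv F)"
  unfolding asymptotically_almost_periodic_def
proof (intro conjI allI impI)
  show "continuous_on {0..} (Tconv F)" by (rule Tconv_continuous[OF F small])
  show "bounded (Tconv F ` {0..})"
  proof (rule boundedI[of _ B])
    fix y assume "y \<in> Tconv F ` {0..}"
    then obtain t where "y = Tconv F t" by blast
    then have "ennreal (norm y) \<le> ennreal B" using norm_Tconv_le[OF F, of t] B(2)[of t] by auto
    then show "norm y \<le> B" using B by (simp add: ennreal_le_iff)
  qed
  fix \<epsilon> :: real assume "\<epsilon> > 0"
  then have e2: "\<epsilon> / 2 > 0" by simp
  obtain l m where lm: "l > 0" "m > 0" and ap': "\<And>a. a \<ge> 0 \<Longrightarrow> \<exists>\<tau>\<in>{a..a + l}. \<forall>t\<ge>m. kconv (\<lambda>s. ennreal (norm (F (s + \<tau>) - F s))) t \<le> ennreal (\<epsilon> / 2)"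
    using ap[OF e2] by blast
  obtain m' where m': "m' > 0" "\<And>t. t \<ge> m' \<Longrightarrow> exp (- c * (t - 0)) * B \<le> \<epsilon> / 2"
    using exp_decay_le[OF B(1) e2, of 0] by blast
  have "\<exists>\<tau>\<in>{a..a + l}. \<forall>t\<ge>max m m'. norm (Tconv F (t + \<tau>) - Tconv F t) \<le> \<epsilon>" if a: "a \<ge> 0" for a
  proof -
    obtain \<tau> where \<tau>: "\<tau> \<in> {a..a + l}" "\<And>t. t \<ge> m \<Longrightarrow> kconv (\<lambda>s. ennreal (norm (F (s + \<tau>) - F s))) t \<le> ennreal (\<epsilon> / 2)"
      using ap'[OF a] by blast
    have "norm (Tconv F (t + \<tau>) - Tconv F t) \<le> \<epsilon>" if t: "t \<ge> max m m'" for t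
    proof -
      have "ennreal (norm (Tconv F (t + \<tau>) - Tconv F t)) \<le>
          kconv (\<lambda>s. ennreal (norm (F (s + \<tau>) - F s))) t + ennreal (exp (- c * t)) * kconv (\<lambda>s. ennreal (norm (F s))) \<tau>"
        using t lm a \<tau>(1) by (intro norm_Tconv_shift_diff_le[OF F]) auto
      also have "\<dots> \<le> ennreal (\<epsilon> / 2) + ennreal (exp (- c * t)) * ennreal B"
        using t by (intro add_mono \<tau>(2) mult_left_mono B) auto
      also have "\<dots> \<le> ennreal (\<epsilon> / 2) + ennreal (\<epsilon> / 2)"
        using m'(2)[of t] t B by (intro add_left_mono) (auto simp flip: ennreal_mult intro!: ennreal_leI)
      also have "\<dots> = ennreal \<epsilon>" using e2 by (simp flip: ennreal_plus)
      finally show ?thesis using e2 by (simp add: ennreal_le_iff)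
    qed
    then show ?thesis using \<tau>(1) by blast
  qed
  then show "\<exists>l>0. \<exists>m>0. \<forall>a\<ge>0. \<exists>\<tau>\<in>{a..a + l}. \<forall>t\<ge>m. norm (Tconv F (t + \<tau>) - Tconv F t) \<le> \<epsilon>"
    using lm m' by (intro exI[of _ l] conjI exI[of _ "max m m'"]) auto
qed

end

section \<open>The nonlinearity along an asymptotically almost periodic function\<close>

text \<open>The Stepanov hypotheses in their final form: all data live on the whole line, and every
  norm has become a convolution with \<open>k\<close>, bounded by the common constant
  \<open>K\<close>. Almost periods of \<open>g\<close> are asked for finite sets, the decay of
  \<open>h\<close> for single points, as these are the instances met along a net.\<close>

locale semilinear_inclusion = singular_semigroup M c \<beta> T
  for M c \<beta> :: real and T :: "real \<Rightarrow> 'a::banach \<Rightarrow>\<^sub>L 'a" +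
  fixes f g h :: "real \<Rightarrow> 'a \<Rightarrow> 'a" and lf lg :: "real \<Rightarrow> real" and K :: real
  assumes f_neg: "s < 0 \<Longrightarrow> f s x = 0" and h_neg: "s < 0 \<Longrightarrow> h s x = 0"
    and f_eq: "f s x = g s x + h s x"
    and g_measurable: "strongly_measurable lebesgue (\<lambda>s. g s x)"
    and h_measurable: "strongly_measurable lebesgue (\<lambda>s. h s x)"
    and lf_measurable [measurable]: "lf \<in> borel_measurable lebesgue"
    and lg_measurable [measurable]: "lg \<in> borel_measurable lebesgue"
    and lf_nonneg: "0 \<le> lf s" and lg_nonneg: "0 \<le> lg s"
    and g_Lipschitz: "norm (g s x - g s y) \<le> lg s * norm (x - y)"
    and f_Lipschitz: "AE s in lebesgue. \<forall>x y. norm (f s x - f s y) \<le> lf s * norm (x - y)"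
    and lf_locally_bounded: "\<exists>B\<ge>0. \<forall>s\<le>b. lf s \<le> B"
    and K_nonneg: "0 \<le> K"
    and kconv_lf: "kconv (\<lambda>s. ennreal (lf s)) t \<le> ennreal K"
    and kconv_lg: "kconv (\<lambda>s. ennreal (lg s)) t \<le> ennreal K"
    and kconv_g0: "kconv (\<lambda>s. ennreal (norm (g s 0))) t \<le> ennreal K"
    and kconv_h0: "kconv (\<lambda>s. ennreal (norm (h s 0))) t \<le> ennreal K"
    and small_g0: "small_near b (\<lambda>s. ennreal (norm (g s 0)))"
    and small_h0: "small_near b (\<lambda>s. ennreal (norm (h s 0)))"
    and g_almost_periods: "finite X \<Longrightarrow> \<epsilon> > 0 \<Longrightarrow> \<exists>l>0. \<forall>a\<ge>0. \<exists>\<tau>\<in>{a..a + l}. \<forall>x\<in>X. \<forall>t.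
      kconv (\<lambda>s. ennreal (norm (g (s + \<tau>) x - g s x))) t \<le> ennreal \<epsilon>"
    and h_vanishes: "\<epsilon> > 0 \<Longrightarrow> \<exists>m. \<forall>t\<ge>m. kconv (\<lambda>s. ennreal (norm (h s x))) t \<le> ennreal \<epsilon>"
begin

lemma f_measurable: "strongly_measurable lebesgue (\<lambda>s. f s x)"
  unfolding f_eq by (intro strongly_measurable_add g_measurable h_measurable)

text \<open>\<open>h\<close> carries no Lipschitz condition of its own; it inherits one as the
  difference of \<open>f\<close> and \<open>g\<close>. This permits replacing \<open>u s\<close> by
  a net point inside \<open>h\<close>.\<close>

lemma h_Lipschitz: "AE s in lebesgue. \<forall>x y. norm (h s x - h s y) \<le> (lf s + lg s) * norm (x - y)"
  using f_Lipschitz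
proof eventually_elim
  case (elim s)
  show ?case
  proof (intro allI)
    fix x y
    have "h s x - h s y = (f s x - f s y) - (g s x - g s y)" by (simp add: f_eq)
    then have "norm (h s x - h s y) \<le> norm (f s x - f s y) + norm (g s x - g s y)"
      by (metis norm_triangle_ineq4)
    also have "\<dots> \<le> lf s * norm (x - y) + lg s * norm (x - y)"
      using elim g_Lipschitz by (intro add_mono) auto
    finally show "norm (h s x - h s y) \<le> (lf s + lg s) * norm (x - y)" by (simp add: distrib_right)
  qed
qed

text \<open>The argument for Caratheodory functions: \<open>u\<close> is sampled at the grid points
  just below \<open>s\<close>, which leaves countably many values, and the Lipschitz condition for
  almost every \<open>s\<close> carries the approximation to the limit. Grid points below a
  nonnegative \<open>s\<close> are nonnegative.\<close>

lemma composition_measurable: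
  fixes u :: "real \<Rightarrow> 'a" and G :: "real \<Rightarrow> 'a \<Rightarrow> 'a"
  assumes step: "\<And>x. strongly_measurable lebesgue (\<lambda>s. G s x)"
    and Lip: "AE s in lebesgue. \<forall>x y. norm (G s x - G s y) \<le> L s * norm (x - y)"
    and neg: "\<And>s x. s < 0 \<Longrightarrow> G s x = 0"
    and u: "continuous_on {0..} u"
  shows "strongly_measurable lebesgue (\<lambda>s. G s (u s))"
proof (rule strongly_measurable_AE_LIMSEQ[OF complete_measure_lebesgue])
  let ?n = "\<lambda>n. real (Suc n)"
  show "strongly_measurable lebesgue (\<lambda>s. G s (u (real_of_int \<lfloor>s * ?n n\<rfloor> / ?n n)))" for n
  proof (rule strongly_measurable_compose_countable[OF complete_measure_lebesgue,
        where F = "\<lambda>i s. G s (u (real_of_int i / ?n n))" and g = "\<lambda>s. \<lfloor>s * ?n n\<rfloor>"])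
    show "(\<lambda>s. \<lfloor>s * ?n n\<rfloor>) \<in> lebesgue \<rightarrow>\<^sub>M count_space UNIV"
      by measurable
  qed (rule step)
  show "AE s in lebesgue. (\<lambda>n. G s (u (real_of_int \<lfloor>s * ?n n\<rfloor> / ?n n))) \<longlonglongrightarrow> G s (u s)"
    using Lip
  proof eventually_elim
    case (elim s)
    show ?case
    proof (cases "s < 0")
      case False
      let ?x = "\<lambda>n. real_of_int \<lfloor>s * ?n n\<rfloor> / ?n n"
      have x: "0 \<le> ?x n" "\<bar>?x n - s\<bar> \<le> 1 / ?n n" for n
      proof -
        show "0 \<le> ?x n" using False by simp
        have "\<bar>real_of_int \<lfloor>s * ?n n\<rfloor> - s * ?n n\<bar> \<le> 1" by linarith
        then have "\<bar>real_of_int \<lfloor>s * ?n n\<rfloor> - s * ?n n\<bar> / ?n n \<le> 1 / ?n n" by (intro divide_right_mono) auto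
        also have "\<bar>real_of_int \<lfloor>s * ?n n\<rfloor> - s * ?n n\<bar> / ?n n = \<bar>?x n - s\<bar>"
        proof -
          have "\<bar>a - s * b\<bar> / b = \<bar>a / b - s\<bar>" if "b > 0" for a b
          proof -
            have "a / b - s = (a - s * b) / b" using that by (simp add: field_simps)
            then show ?thesis using that by simp
          qed
          from this[of "?n n"] show ?thesis by (metis of_nat_0_less_iff zero_less_Suc)
        qed
        finally show "\<bar>?x n - s\<bar> \<le> 1 / ?n n" .
      qed
      have "(\<lambda>n. ?x n - s) \<longlonglongrightarrow> 0"
        by (rule Lim_null_comparison[OF _ LIMSEQ_Suc[OF lim_1_over_n]]) (use x in simp)
      then have "?x \<longlonglongrightarrow> s" by (simp only: LIM_zero_iff)
      then have "(\<lambda>n. u (?x n)) \<longlonglongrightarrow> u s"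
        using x(1) False by (intro continuous_on_tendsto_compose[OF u]) auto
      then have "(\<lambda>n. L s * norm (u (?x n) - u s)) \<longlonglongrightarrow> L s * norm (u s - u s)"
        by (intro tendsto_intros)
      then have "(\<lambda>n. L s * norm (u (?x n) - u s)) \<longlonglongrightarrow> 0" by simp
      then have "(\<lambda>n. G s (u (?x n)) - G s (u s)) \<longlonglongrightarrow> 0"
        by (rule Lim_null_comparison[rotated]) (simp add: elim)
      then show ?thesis by (simp only: LIM_zero_iff)
    qed (simp add: neg)
  qed
qed

text \<open>The superposition (Nemytskii) operator of \<open>f\<close>.\<close>

definition F :: "(real \<Rightarrow> 'a) \<Rightarrow> real \<Rightarrow> 'a" where
  "F u s = f s (u s)"

lemma F_le:
  assumes U: "\<And>s. 0 \<le> s \<Longrightarrow> norm (u s) \<le> U"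
  shows "AE s in lebesgue. 0 \<le> s \<longrightarrow> norm (F u s) \<le> norm (g s 0) + norm (h s 0) + lf s * U"
  using f_Lipschitz
proof eventually_elim
  case (elim s)
  show ?case
  proof
    assume s: "0 \<le> s"
    have "F u s = g s 0 + h s 0 + (f s (u s) - f s 0)" by (simp add: F_def f_eq)
    then have "norm (F u s) \<le> norm (g s 0) + norm (h s 0) + norm (f s (u s) - f s 0)"
      by (metis norm_triangle_le norm_triangle_ineq add_right_mono)
    also have "norm (f s (u s) - f s 0) \<le> lf s * norm (u s)" using elim[rule_format, of "u s" 0] by simp
    also have "\<dots> \<le> lf s * U" using U[OF s] lf_nonneg by (intro mult_left_mono) auto
    finally show "norm (F u s) \<le> norm (g s 0) + norm (h s 0) + lf s * U" by simp
  qed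
qed

lemma norm_g_measurable [measurable]: "(\<lambda>s. ennreal (norm (g s x))) \<in> borel_measurable lebesgue"
  by (intro strongly_measurable_ennreal_norm complete_measure_lebesgue g_measurable)

lemma norm_h_measurable [measurable]: "(\<lambda>s. ennreal (norm (h s x))) \<in> borel_measurable lebesgue"
  by (intro strongly_measurable_ennreal_norm complete_measure_lebesgue h_measurable)

lemma ennreal_lf_measurable: "(\<lambda>s. ennreal (lf s)) \<in> borel_measurable lebesgue"
  and ennreal_lg_measurable: "(\<lambda>s. ennreal (lg s)) \<in> borel_measurable lebesgue"
  by measurable

text \<open>Rewriting with these facts splits the convolution of a finite combination of the data;
  the measurability facts discharge the side conditions on the way.\<close>

lemmas kconv_linear = kconv_add kconv_cmult kconv_sum borel_measurable_add borel_measurable_times_ennreal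
  borel_measurable_const borel_measurable_sum norm_g_measurable norm_h_measurable
  ennreal_lf_measurable ennreal_lg_measurable

lemma kconv_F_le:
  assumes U: "\<And>s. 0 \<le> s \<Longrightarrow> norm (u s) \<le> U"
  shows "kconv (\<lambda>s. ennreal (norm (F u s))) t \<le> ennreal (K + K + K * U)"
proof -
  have U0: "0 \<le> U" using U[of 0] norm_ge_zero[of "u 0"] by linarith
  have FU: "AE s in lebesgue. 0 \<le> s \<longrightarrow> norm (F u s) \<le> norm (g s 0) + norm (h s 0) + lf s * U"
    by (rule F_le) (rule U)
  have "kconv (\<lambda>s. ennreal (norm (F u s))) t \<le> kconv (\<lambda>s. ennreal (norm (g s 0)) + ennreal (norm (h s 0)) + ennreal U * ennreal (lf s)) t"
  proof (rule kconv_mono_AE)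
    show "AE s in lebesgue. 0 \<le> s \<longrightarrow> ennreal (norm (F u s)) \<le> ennreal (norm (g s 0)) + ennreal (norm (h s 0)) + ennreal U * ennreal (lf s)"
      using FU
      by eventually_elim (use U0 lf_nonneg in \<open>auto simp: mult.commute simp flip: ennreal_plus ennreal_mult intro!: ennreal_leI\<close>)
  qed
  also have "\<dots> = kconv (\<lambda>s. ennreal (norm (g s 0))) t + kconv (\<lambda>s. ennreal (norm (h s 0))) t + ennreal U * kconv (\<lambda>s. ennreal (lf s)) t"
    by (simp only: kconv_linear)
  also have "\<dots> \<le> ennreal K + ennreal K + ennreal U * ennreal K"
    by (intro add_mono mult_left_mono kconv_g0 kconv_h0 kconv_lf) auto
  also have "\<dots> = ennreal (K + K + K * U)"
    using K_nonneg U0 by (simp add: mult.commute flip: ennreal_mult ennreal_plus)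
  finally show ?thesis .
qed

lemma F_measurable: "continuous_on {0..} u \<Longrightarrow> strongly_measurable lebesgue (F u)"
  unfolding F_def[abs_def] by (rule composition_measurable[OF f_measurable f_Lipschitz f_neg])

lemma bounded_norm_le:
  assumes "bounded (u ` {0..} :: 'a set)"
  obtains U where "0 \<le> U" "\<And>s::real. 0 \<le> s \<Longrightarrow> norm (u s) \<le> U"
proof -
  obtain U where U: "\<And>y. y \<in> u ` {0..} \<Longrightarrow> norm y \<le> U"
    using assms unfolding bounded_iff by blast
  show ?thesis
  proof (rule that)
    show "0 \<le> U" using order_trans[OF norm_ge_zero U[of "u 0"]] by simp
  qed (use U in auto)
qed

lemma admissible_F:
  assumes u: "continuous_on {0..} u" "bounded (u ` {0..})"
  shows "admissible (F u)"
proof -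
  obtain U where U: "\<And>s. 0 \<le> s \<Longrightarrow> norm (u s) \<le> U" using bounded_norm_le[OF u(2)] by blast
  have "kconv (\<lambda>s. ennreal (norm (F u s))) t < \<infinity>" for t
  proof -
    have "kconv (\<lambda>s. ennreal (norm (F u s))) t \<le> ennreal (K + K + K * U)" by (rule kconv_F_le) (rule U)
    then show ?thesis by (auto intro: le_less_trans)
  qed
  then show ?thesis
    using F_measurable[OF u(1)] by (simp add: admissible_def) (simp add: F_def f_neg)
qed

lemma small_near_F:
  assumes u: "bounded (u ` {0..})"
  shows "small_near b (\<lambda>s. ennreal (norm (F u s)))"
proof -
  obtain U where U: "0 \<le> U" "\<And>s. 0 \<le> s \<Longrightarrow> norm (u s) \<le> U" using bounded_norm_le[OF u] by blast
  have FU: "AE s in lebesgue. 0 \<le> s \<longrightarrow> norm (F u s) \<le> norm (g s 0) + norm (h s 0) + lf s * U"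
    by (rule F_le) (rule U(2))
  obtain B where B: "0 \<le> B" "\<And>s. s \<le> b \<Longrightarrow> lf s \<le> B" using lf_locally_bounded[of b] by blast
  show ?thesis
  proof (rule small_near_mono_AE)
    show "small_near b (\<lambda>s. ennreal (norm (g s 0)) + ennreal (norm (h s 0)) + ennreal (B * U))"
      using U(1) B(1)
      by (intro small_near_add small_g0 small_h0 small_near_const borel_measurable_add
          norm_g_measurable norm_h_measurable borel_measurable_const) simp
    show "AE s in lebesgue. 0 \<le> s \<longrightarrow> s \<le> b \<longrightarrow>
        ennreal (norm (F u s)) \<le> ennreal (norm (g s 0)) + ennreal (norm (h s 0)) + ennreal (B * U)"
      using FU
    proof eventually_elim
      case (elim s)
      show ?case
      proof (intro impI)
        assume s: "0 \<le> s" "s \<le> b"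
        have "norm (F u s) \<le> norm (g s 0) + norm (h s 0) + B * U"
          using elim s mult_right_mono[OF B(2)[OF s(2)] U(1)] by simp
        then show "ennreal (norm (F u s)) \<le> ennreal (norm (g s 0)) + ennreal (norm (h s 0)) + ennreal (B * U)"
          using U(1) B(1) by (simp add: ennreal_leI flip: ennreal_plus)
      qed
    qed
  qed
qed

text \<open>Replacing \<open>u s\<close> by a net point costs at most
  \<open>(lf s + lg s) * \<eta>\<close>, whose convolution is at most \<open>2 * K * \<eta>\<close>;
  finitely many net points then share one late time after which \<open>h\<close> is
  negligible.\<close>

lemma h_composition_vanishes:
  assumes u: "asymptotically_almost_periodic u" and \<eta>: "\<eta> > 0"
  shows "\<exists>m. \<forall>t\<ge>m. kconv (\<lambda>s. ennreal (norm (h s (u s)))) t \<le> ennreal ((2 * K + 1) * \<eta>)"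
proof -
  obtain X where X: "finite X" "\<And>t. 0 \<le> t \<Longrightarrow> \<exists>x\<in>X. norm (u t - x) < \<eta>"
    using aap_finite_net[OF u \<eta>] by blast
  \<comment> \<open>An equal share for each net point, so that the sum over the net stays below
    \<open>\<eta>\<close>; the \<open>1\<close> avoids a division by zero.\<close>
  define \<eta>' where "\<eta>' = \<eta> / (real (card X) + 1)"
  have \<eta>': "\<eta>' > 0" "real (card X) * \<eta>' \<le> \<eta>" using \<eta> by (auto simp: \<eta>'_def field_simps)
  have "\<forall>x. \<exists>m. \<forall>t\<ge>m. kconv (\<lambda>s. ennreal (norm (h s x))) t \<le> ennreal \<eta>'"
    using h_vanishes[OF \<eta>'(1)] by blast
  then obtain m where m: "\<And>x t. t \<ge> m x \<Longrightarrow> kconv (\<lambda>s. ennreal (norm (h s x))) t \<le> ennreal \<eta>'"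
    by metis
  have "kconv (\<lambda>s. ennreal (norm (h s (u s)))) t \<le> ennreal ((2 * K + 1) * \<eta>)" if t: "t \<ge> (\<Sum>x\<in>X. \<bar>m x\<bar>)" for t
  proof -
    have mt: "m x \<le> t" if "x \<in> X" for x
      using t member_le_sum[of x X "\<lambda>x. \<bar>m x\<bar>"] that X(1) by auto
    have "kconv (\<lambda>s. ennreal (norm (h s (u s)))) t
        \<le> kconv (\<lambda>s. (\<Sum>x\<in>X. ennreal (norm (h s x))) + ennreal \<eta> * (ennreal (lf s) + ennreal (lg s))) t"
    proof (rule kconv_mono_AE)
      show "AE s in lebesgue. 0 \<le> s \<longrightarrow> ennreal (norm (h s (u s))) \<le>
          (\<Sum>x\<in>X. ennreal (norm (h s x))) + ennreal \<eta> * (ennreal (lf s) + ennreal (lg s))"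
        using h_Lipschitz
      proof eventually_elim
        case (elim s)
        show ?case
        proof
          assume "0 \<le> s"
          then obtain x where x: "x \<in> X" "norm (u s - x) < \<eta>" using X(2) by blast
          have "norm (h s (u s)) \<le> norm (h s x) + norm (h s (u s) - h s x)"
            using norm_triangle_ineq[of "h s x" "h s (u s) - h s x"] by simp
          also have "norm (h s x) \<le> (\<Sum>x\<in>X. norm (h s x))"
            using x(1) X(1) by (intro member_le_sum) auto
          also have "norm (h s (u s) - h s x) \<le> (lf s + lg s) * norm (u s - x)" using elim by blast
          also have "\<dots> \<le> (lf s + lg s) * \<eta>"
            using x(2) lf_nonneg[of s] lg_nonneg[of s] by (intro mult_left_mono) auto
          finally have "ennreal (norm (h s (u s))) \<le> ennreal ((\<Sum>x\<in>X. norm (h s x)) + (lf s + lg s) * \<eta>)"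
            by (simp add: ennreal_leI)
          also have "\<dots> = (\<Sum>x\<in>X. ennreal (norm (h s x))) + ennreal \<eta> * (ennreal (lf s) + ennreal (lg s))"
            using lf_nonneg[of s] lg_nonneg[of s] \<eta>
            by (simp add: sum_nonneg mult.commute flip: ennreal_mult ennreal_plus)
          finally show "ennreal (norm (h s (u s))) \<le>
            (\<Sum>x\<in>X. ennreal (norm (h s x))) + ennreal \<eta> * (ennreal (lf s) + ennreal (lg s))" .
        qed
      qed
    qed
    also have "\<dots> = (\<Sum>x\<in>X. kconv (\<lambda>s. ennreal (norm (h s x))) t) + ennreal \<eta> * (kconv (\<lambda>s. ennreal (lf s)) t + kconv (\<lambda>s. ennreal (lg s)) t)"
      by (simp only: kconv_linear X(1))
    also have "\<dots> \<le> (\<Sum>x\<in>X. ennreal \<eta>') + ennreal \<eta> * (ennreal K + ennreal K)"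
      by (intro add_mono mult_left_mono kconv_lf kconv_lg sum_mono m mt) auto
    also have "\<dots> = ennreal (real (card X) * \<eta>' + \<eta> * (K + K))"
      using \<eta>' \<eta> K_nonneg
      by (simp add: ennreal_of_nat_eq_real_of_nat flip: ennreal_mult ennreal_plus)
    also have "\<dots> \<le> ennreal ((2 * K + 1) * \<eta>)"
      using \<eta>'(2) by (intro ennreal_leI) (simp add: algebra_simps)
    finally show ?thesis .
  qed
  then show ?thesis by blast
qed

text \<open>The path is \<open>g (s + \<tau>) (u (s + \<tau>))\<close>,
  \<open>g (s + \<tau>) (u s)\<close>, \<open>g (s + \<tau>) x\<close>, \<open>g s x\<close>,
  \<open>g s (u s)\<close> with a net point \<open>x\<close> close to \<open>u s\<close>. Only the
  step from \<open>g (s + \<tau>) x\<close> to \<open>g s x\<close> uses almost periods of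
  \<open>g\<close>, and there the point is fixed; the two terms with \<open>h\<close> vanish at late
  times.\<close>

lemma F_almost_periods:
  assumes u: "asymptotically_almost_periodic u" and \<epsilon>: "\<epsilon> > 0"
  shows "\<exists>l>0. \<exists>m>0. \<forall>a\<ge>0. \<exists>\<tau>\<in>{a..a + l}. \<forall>t\<ge>m.
    kconv (\<lambda>s. ennreal (norm (F u (s + \<tau>) - F u s))) t \<le> ennreal \<epsilon>"
proof -
  \<comment> \<open>The divisor adds up the final errors: \<open>4 * K\<close> and \<open>K\<close>
    from the Lipschitz steps, \<open>1\<close> from the transient of \<open>u\<close>,
    \<open>2\<close> from the net, and \<open>2 * (2 * K + 1)\<close> from the two terms with
    \<open>h\<close>.\<close>
  define \<eta> where "\<eta> = \<epsilon> / (9 * K + 5)"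
  have \<eta>: "\<eta> > 0" "(9 * K + 5) * \<eta> = \<epsilon>" using \<epsilon> K_nonneg by (auto simp: \<eta>_def)
  obtain U where U: "0 \<le> U" "\<And>s. 0 \<le> s \<Longrightarrow> norm (u s) \<le> U"
    using bounded_norm_le[of u] u unfolding asymptotically_almost_periodic_def by blast
  obtain X where X: "finite X" "\<And>t. 0 \<le> t \<Longrightarrow> \<exists>x\<in>X. norm (u t - x) < \<eta>"
    using aap_finite_net[OF u \<eta>(1)] by blast
  define \<eta>' where "\<eta>' = \<eta> / (real (card X) + 1)"
  have \<eta>': "\<eta>' > 0" "real (card X) * \<eta>' \<le> \<eta>" using \<eta> by (auto simp: \<eta>'_def field_simps)
  obtain mh where mh: "\<And>t. t \<ge> mh \<Longrightarrow> kconv (\<lambda>s. ennreal (norm (h s (u s)))) t \<le> ennreal ((2 * K + 1) * \<eta>)"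
    using h_composition_vanishes[OF u \<eta>(1)] by blast
  obtain lu mu where lu: "lu > 0" "mu > 0"
      "\<And>a. 0 \<le> a \<Longrightarrow> \<exists>\<tau>\<in>{a..a + lu}. \<forall>t\<ge>mu. norm (u (t + \<tau>) - u t) \<le> \<eta>"
    using aap_almost_periods[OF u \<eta>(1)] by blast
  obtain lP where lP: "lP > 0" "\<And>a. a \<ge> 0 \<Longrightarrow> \<exists>\<tau>\<in>{a..a + lP}. \<forall>x\<in>X. \<forall>t.
      kconv (\<lambda>s. ennreal (norm (g (s + \<tau>) x - g s x))) t \<le> ennreal \<eta>'"
    using g_almost_periods[OF X(1) \<eta>'(1)] by blast
  obtain \<delta> where \<delta>: "\<delta> > 0" "\<And>s t. 0 \<le> s \<Longrightarrow> 0 \<le> t \<Longrightarrow> \<bar>s - t\<bar> < \<delta> \<Longrightarrow> norm (u s - u t) \<le> \<eta>"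
    using aap_uniformly_continuous[OF u \<eta>(1)] by blast
  define P where "P = {\<tau>. \<forall>x\<in>X. \<forall>t. kconv (\<lambda>s. ennreal (norm (g (s + \<tau>) x - g s x))) t \<le> ennreal \<eta>'}"
  define Q where "Q = {\<tau>. \<forall>t\<ge>mu. norm (u (t + \<tau>) - u t) \<le> \<eta>}"
  have P: "\<exists>\<tau>\<in>{a..a + lP}. \<tau> \<in> P" if "0 \<le> a" for a
    using lP(2)[OF that] unfolding P_def by blast
  have Q: "\<exists>\<tau>\<in>{a..a + lu}. \<tau> \<in> Q" if "0 \<le> a" for a
    using lu(3)[OF that] unfolding Q_def by blast
  obtain L where L: "L > 0"
    "\<And>a. 0 \<le> a \<Longrightarrow> \<exists>\<alpha>\<in>P. \<exists>\<alpha>'\<in>P. \<exists>\<beta>\<in>Q. \<exists>\<beta>'\<in>Q. 0 \<le> \<alpha>' \<and> 0 \<le> \<beta>' \<and>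
       \<alpha> - \<alpha>' \<in> {a..a + L} \<and> 0 \<le> \<beta> - \<beta>' \<and> \<bar>(\<alpha> - \<alpha>') - (\<beta> - \<beta>')\<bar> < \<delta>"
    by (rule common_almost_periods[of lP P lu Q \<delta>]) (use lP(1) P lu(1) Q \<delta>(1) that in blast)+
  \<comment> \<open>Before time \<open>mu\<close> the almost periods of \<open>u\<close> give
    nothing, and \<open>2 * U\<close> is the trivial bound for the change of \<open>u\<close>;
    \<open>m\<close> is the time after which this initial stretch has been forgotten.\<close>
  obtain m where m: "m > 0" "\<And>t. t \<ge> m \<Longrightarrow> exp (- c * (t - mu)) * (2 * U * K) \<le> \<eta>"
    using exp_decay_le[of "2 * U * K" \<eta> mu] U(1) K_nonneg \<eta>(1) by auto
  define m' where "m' = max (max m mu) mh"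
  have m': "m' \<ge> m" "m' \<ge> mu" "m' \<ge> mh" by (auto simp: m'_def)
  have "\<exists>\<tau>\<in>{a..a + L}. \<forall>t\<ge>m'. kconv (\<lambda>s. ennreal (norm (F u (s + \<tau>) - F u s))) t \<le> ennreal \<epsilon>"
    if a: "0 \<le> a" for a
  proof -
    obtain \<alpha> \<alpha>' b b' where ab: "\<alpha> \<in> P" "\<alpha>' \<in> P" "b \<in> Q" "b' \<in> Q" "0 \<le> \<alpha>'" "0 \<le> b'"
        "\<alpha> - \<alpha>' \<in> {a..a + L}" "0 \<le> b - b'" "\<bar>(\<alpha> - \<alpha>') - (b - b')\<bar> < \<delta>"
      using L(2)[OF a] by blast
    define \<tau> where "\<tau> = \<alpha> - \<alpha>'"
    have \<tau>0: "0 \<le> \<tau>" using ab a by (auto simp: \<tau>_def)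
    \<comment> \<open>One \<open>\<eta>\<close> for replacing \<open>\<tau>\<close> by the nearby
      difference \<open>b - b'\<close>, by uniform continuity, and one for each of the almost
      periods \<open>b\<close> and \<open>b'\<close>; the latter is used at the time
      \<open>s + (b - b')\<close>.\<close>
    have u_per: "norm (u (s + \<tau>) - u s) \<le> 3 * \<eta>" if s: "s \<ge> mu" for s
    proof -
      have 1: "norm (u (s + \<tau>) - u (s + (b - b'))) \<le> \<eta>"
        using \<delta>(2)[of "s + \<tau>" "s + (b - b')"] ab \<tau>0 s lu by (auto simp: \<tau>_def)
      have 2: "norm (u (s + b) - u (s + (b - b'))) \<le> \<eta>"
        using ab(4) ab(8) s unfolding Q_def by (auto dest!: spec[of _ "s + (b - b')"])
      have 3: "norm (u (s + b) - u s) \<le> \<eta>" using ab(3) s unfolding Q_def by blast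
      have "norm (u (s + \<tau>) - u s) = norm ((u (s + \<tau>) - u (s + (b - b'))) + (u (s + b) - u s) - (u (s + b) - u (s + (b - b'))))"
        by simp
      also have "\<dots> \<le> norm (u (s + \<tau>) - u (s + (b - b'))) + norm (u (s + b) - u s) + norm (u (s + b) - u (s + (b - b')))"
        by (rule norm_add_diff_le)
      finally show ?thesis using 1 2 3 by simp
    qed
    have u_per': "norm (u (s + \<tau>) - u s) \<le> 3 * \<eta> + 2 * U * indicator {..<mu} s" if s: "s \<ge> 0" for s
    proof (cases "s < mu")
      case True
      have "norm (u (s + \<tau>) - u s) \<le> U + U"
        using U(2)[of s] U(2)[of "s + \<tau>"] s \<tau>0 norm_triangle_ineq4[of "u (s + \<tau>)" "u s"] by linarith
      then show ?thesis using True \<eta> by simp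
    qed (use u_per in simp)
    have g_diff_sm: "strongly_measurable lebesgue (\<lambda>s. g (s + \<sigma>) x - g s x)" for \<sigma> x
      using strongly_measurable_translation[OF g_measurable, of \<sigma> x]
      by (intro strongly_measurable_diff g_measurable) (simp add: add.commute)
    have g_diff_meas: "(\<lambda>s. ennreal (norm (g (s + \<sigma>) x - g s x))) \<in> borel_measurable lebesgue" for \<sigma> x
      by (intro strongly_measurable_ennreal_norm complete_measure_lebesgue g_diff_sm)
    have g_diff2_meas: "(\<lambda>s. ennreal (norm (g ((s + \<tau>) + \<sigma>) x - g (s + \<tau>) x))) \<in> borel_measurable lebesgue" for \<sigma> x
      using strongly_measurable_translation[OF g_diff_sm, of \<tau> \<sigma> x]
      by (intro strongly_measurable_ennreal_norm complete_measure_lebesgue) (simp add: add.commute)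
    \<comment> \<open>The almost period \<open>\<alpha>'\<close> is applied at the shifted time
      \<open>s + \<tau>\<close>, where it leads to \<open>s + \<alpha>\<close>; the shift of the
      convolution is harmless because the bound holds for all \<open>t\<close>.\<close>
    have g_per: "kconv (\<lambda>s. ennreal (norm (g (s + \<tau>) x - g s x))) t \<le> ennreal (2 * \<eta>')" if x: "x \<in> X" for x t
    proof -
      have "kconv (\<lambda>s. ennreal (norm (g (s + \<tau>) x - g s x))) t \<le>
        kconv (\<lambda>s. ennreal (norm (g (s + \<alpha>) x - g s x)) + ennreal (norm (g ((s + \<tau>) + \<alpha>') x - g (s + \<tau>) x))) t"
      proof (rule kconv_mono)
        fix s
        have "(s + \<tau>) + \<alpha>' = s + \<alpha>" by (simp add: \<tau>_def)
        then have "norm (g (s + \<tau>) x - g s x) \<le> norm (g (s + \<alpha>) x - g s x) + norm (g ((s + \<tau>) + \<alpha>') x - g (s + \<tau>) x)"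
          using norm_triangle_ineq4[of "g (s + \<alpha>) x - g s x" "g (s + \<alpha>) x - g (s + \<tau>) x"] by (simp only:) simp
        then show "ennreal (norm (g (s + \<tau>) x - g s x)) \<le>
            ennreal (norm (g (s + \<alpha>) x - g s x)) + ennreal (norm (g ((s + \<tau>) + \<alpha>') x - g (s + \<tau>) x))"
          by (simp add: ennreal_leI flip: ennreal_plus)
      qed
      also have "\<dots> = kconv (\<lambda>s. ennreal (norm (g (s + \<alpha>) x - g s x))) t + kconv (\<lambda>s. ennreal (norm (g ((s + \<tau>) + \<alpha>') x - g (s + \<tau>) x))) t"
        by (rule kconv_add[OF g_diff_meas g_diff2_meas])
      also have "\<dots> \<le> kconv (\<lambda>s. ennreal (norm (g (s + \<alpha>) x - g s x))) t + kconv (\<lambda>s. ennreal (norm (g (s + \<alpha>') x - g s x))) (t + \<tau>)"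
        by (intro add_left_mono kconv_shift[OF g_diff_meas \<tau>0])
      also have "\<dots> \<le> ennreal \<eta>' + ennreal \<eta>'"
        using ab(1,2) x unfolding P_def by (intro add_mono) auto
      also have "\<dots> = ennreal (2 * \<eta>')" using \<eta>' by (simp flip: ennreal_plus)
      finally show ?thesis .
    qed
    have shift_meas: "(\<lambda>s. \<phi> (s + \<tau>)) \<in> borel_measurable lebesgue" if "\<phi> \<in> borel_measurable lebesgue" for \<phi> :: "real \<Rightarrow> ennreal"
      using measurable_compose[OF lebesgue_translation(1) that, of \<tau>] by (simp add: add.commute)
    have lg_t [measurable]: "(\<lambda>s. ennreal (lg (s + \<tau>))) \<in> borel_measurable lebesgue"
      by (rule shift_meas) measurable
    define H where "H s = ennreal (norm (h s (u s)))" for s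
    have [measurable]: "H \<in> borel_measurable lebesgue"
      unfolding H_def[abs_def] using u
      by (intro strongly_measurable_ennreal_norm complete_measure_lebesgue
          composition_measurable[OF h_measurable h_Lipschitz h_neg]) (simp_all add: asymptotically_almost_periodic_def)
    have [measurable]: "(\<lambda>s. H (s + \<tau>)) \<in> borel_measurable lebesgue"
      by (rule shift_meas) measurable
    have meas: "H \<in> borel_measurable lebesgue" "(\<lambda>s. H (s + \<tau>)) \<in> borel_measurable lebesgue"
        "(\<lambda>s. ennreal (lg (s + \<tau>)) * indicator {..<mu} s) \<in> borel_measurable lebesgue"
        "(\<lambda>s. ennreal (lg (s + \<tau>))) \<in> borel_measurable lebesgue"
      by measurable
    \<comment> \<open>The coefficient \<open>4 * \<eta>\<close> joins \<open>3 * \<eta>\<close> for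
      moving from \<open>u (s + \<tau>)\<close> to \<open>u s\<close> and \<open>\<eta>\<close> for
      moving on to the net point.\<close>
    define \<Phi> where "\<Phi> s = ennreal (4 * \<eta>) * ennreal (lg (s + \<tau>)) + ennreal (2 * U) * (ennreal (lg (s + \<tau>)) * indicator {..<mu} s)
        + (\<Sum>x\<in>X. ennreal (norm (g (s + \<tau>) x - g s x))) + ennreal \<eta> * ennreal (lg s) + H (s + \<tau>) + H s" for s
    have F_le: "ennreal (norm (F u (s + \<tau>) - F u s)) \<le> \<Phi> s" if s: "0 \<le> s" for s
    proof -
      let ?i = "indicator {..<mu} s :: real"
      obtain x where x: "x \<in> X" "norm (u s - x) < \<eta>" using X(2)[OF s] by blast
      have 1: "norm (g (s + \<tau>) (u (s + \<tau>)) - g (s + \<tau>) (u s)) \<le> lg (s + \<tau>) * (3 * \<eta> + 2 * U * ?i)"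
        using order_trans[OF g_Lipschitz mult_left_mono[OF u_per'[OF s] lg_nonneg]] .
      have 2: "norm (g (s + \<tau>) (u s) - g (s + \<tau>) x) \<le> lg (s + \<tau>) * \<eta>"
        using order_trans[OF g_Lipschitz mult_left_mono[OF less_imp_le[OF x(2)] lg_nonneg]] .
      have 3: "norm (g s (u s) - g s x) \<le> lg s * \<eta>"
        using order_trans[OF g_Lipschitz mult_left_mono[OF less_imp_le[OF x(2)] lg_nonneg]] .
      have 4: "norm (g (s + \<tau>) x - g s x) \<le> (\<Sum>x\<in>X. norm (g (s + \<tau>) x - g s x))"
        using x(1) X(1) by (intro member_le_sum) auto
      have 5: "norm (g (s + \<tau>) (u s) - g s (u s)) \<le> norm (g (s + \<tau>) (u s) - g (s + \<tau>) x) + norm (g (s + \<tau>) x - g s x) + norm (g s (u s) - g s x)"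
        using norm_add_diff_le[of "g (s + \<tau>) (u s) - g (s + \<tau>) x" "g (s + \<tau>) x - g s x" "g s (u s) - g s x"] by simp
      have 6: "norm (F u (s + \<tau>) - F u s) \<le> norm (g (s + \<tau>) (u (s + \<tau>)) - g (s + \<tau>) (u s))
          + norm (g (s + \<tau>) (u s) - g s (u s)) + norm (h (s + \<tau>) (u (s + \<tau>)) - h s (u s))"
      proof -
        have "F u (s + \<tau>) - F u s = (g (s + \<tau>) (u (s + \<tau>)) - g (s + \<tau>) (u s))
          + (g (s + \<tau>) (u s) - g s (u s)) - (h s (u s) - h (s + \<tau>) (u (s + \<tau>)))"
          by (simp add: F_def f_eq)
        then show ?thesis
          by (metis norm_add_diff_le norm_minus_commute)
      qed
      have 7: "norm (h (s + \<tau>) (u (s + \<tau>)) - h s (u s)) \<le> norm (h (s + \<tau>) (u (s + \<tau>))) + norm (h s (u s))"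
        by (rule norm_triangle_ineq4)
      have "norm (F u (s + \<tau>) - F u s) \<le> lg (s + \<tau>) * (3 * \<eta> + 2 * U * ?i) + (lg (s + \<tau>) * \<eta>
          + (\<Sum>x\<in>X. norm (g (s + \<tau>) x - g s x)) + lg s * \<eta>) + (norm (h (s + \<tau>) (u (s + \<tau>))) + norm (h s (u s)))"
        using 1 2 3 4 5 6 7 by linarith
      also have "\<dots> = 4 * \<eta> * lg (s + \<tau>) + 2 * U * (lg (s + \<tau>) * ?i) + (\<Sum>x\<in>X. norm (g (s + \<tau>) x - g s x))
          + \<eta> * lg s + norm (h (s + \<tau>) (u (s + \<tau>))) + norm (h s (u s))"
        by (simp add: algebra_simps)
      finally have "ennreal (norm (F u (s + \<tau>) - F u s)) \<le> ennreal (4 * \<eta> * lg (s + \<tau>) + 2 * U * (lg (s + \<tau>) * ?i) + (\<Sum>x\<in>X. norm (g (s + \<tau>) x - g s x))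
          + \<eta> * lg s + norm (h (s + \<tau>) (u (s + \<tau>))) + norm (h s (u s)))"
        by (rule ennreal_leI)
      also have "\<dots> = \<Phi> s"
        unfolding \<Phi>_def H_def using lg_nonneg[of s] lg_nonneg[of "s + \<tau>"] \<eta>(1) U(1)
        by (simp add: ennreal_mult sum_nonneg split: split_indicator)
      finally show ?thesis .
    qed
    have "kconv (\<lambda>s. ennreal (norm (F u (s + \<tau>) - F u s))) t \<le> ennreal \<epsilon>" if t: "t \<ge> m'" for t
    proof -
      have lg_shift: "kconv (\<lambda>s. ennreal (lg (s + \<tau>))) t' \<le> ennreal K" for t'
        using kconv_shift[of "\<lambda>s. ennreal (lg s)" \<tau> t'] \<tau>0 kconv_lg[of "t' + \<tau>"] by (auto intro: order_trans)
      have H: "kconv H t' \<le> ennreal ((2 * K + 1) * \<eta>)" if "t' \<ge> t" for t'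
        unfolding H_def using mh[of t'] t m' that by simp
      have "kconv (\<lambda>s. ennreal (norm (F u (s + \<tau>) - F u s))) t \<le> kconv \<Phi> t"
        by (intro kconv_mono F_le)
      also have "\<dots> = ennreal (4 * \<eta>) * kconv (\<lambda>s. ennreal (lg (s + \<tau>))) t
          + ennreal (2 * U) * kconv (\<lambda>s. ennreal (lg (s + \<tau>)) * indicator {..<mu} s) t
          + (\<Sum>x\<in>X. kconv (\<lambda>s. ennreal (norm (g (s + \<tau>) x - g s x))) t) + ennreal \<eta> * kconv (\<lambda>s. ennreal (lg s)) t
          + kconv (\<lambda>s. H (s + \<tau>)) t + kconv H t"
        unfolding \<Phi>_def by (simp only: kconv_linear X(1) meas g_diff_meas)
      also have "\<dots> \<le> ennreal (4 * \<eta>) * ennreal K + ennreal \<eta>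
          + (\<Sum>x\<in>X. ennreal (2 * \<eta>')) + ennreal \<eta> * ennreal K
          + ennreal ((2 * K + 1) * \<eta>) + ennreal ((2 * K + 1) * \<eta>)"
      proof (intro add_mono mult_left_mono sum_mono lg_shift kconv_lg g_per H)
        have "ennreal (2 * U) * kconv (\<lambda>s. ennreal (lg (s + \<tau>)) * indicator {..<mu} s) t
            \<le> ennreal (2 * U) * (ennreal (exp (- c * (t - mu))) * kconv (\<lambda>s. ennreal (lg (s + \<tau>))) mu)"
          using t m' by (intro mult_left_mono kconv_decay) auto
        also have "\<dots> \<le> ennreal (2 * U) * (ennreal (exp (- c * (t - mu))) * ennreal K)"
          by (intro mult_left_mono lg_shift) auto
        also have "\<dots> = ennreal (exp (- c * (t - mu)) * (2 * U * K))"
          using U(1) K_nonneg by (simp add: mult_ac flip: ennreal_mult)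
        also have "\<dots> \<le> ennreal \<eta>" using m(2)[of t] t m' by (intro ennreal_leI) auto
        finally show "ennreal (2 * U) * kconv (\<lambda>s. ennreal (lg (s + \<tau>)) * indicator {..<mu} s) t \<le> ennreal \<eta>" .
        have "kconv (\<lambda>s. H (s + \<tau>)) t \<le> kconv H (t + \<tau>)" by (rule kconv_shift) (use \<tau>0 in measurable)
        also have "\<dots> \<le> ennreal ((2 * K + 1) * \<eta>)" using \<tau>0 by (intro H) auto
        finally show "kconv (\<lambda>s. H (s + \<tau>)) t \<le> ennreal ((2 * K + 1) * \<eta>)" .
      qed auto
      also have "\<dots> = ennreal (4 * \<eta> * K + \<eta> + real (card X) * (2 * \<eta>') + \<eta> * K + (2 * K + 1) * \<eta> + (2 * K + 1) * \<eta>)"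
        using \<eta>' \<eta>(1) K_nonneg
        by (simp add: ennreal_of_nat_eq_real_of_nat flip: ennreal_mult ennreal_plus)
      also have "\<dots> \<le> ennreal \<epsilon>"
        unfolding \<eta>(2)[symmetric] using \<eta>'(2) by (intro ennreal_leI) (simp add: algebra_simps)
      finally show ?thesis .
    qed
    then show ?thesis using ab(7) unfolding \<tau>_def by blast
  qed
  then show ?thesis using L(1) m m' by (intro exI[of _ L] conjI exI[of _ m']) auto
qed

end

section \<open>Iterated kernels\<close>

text \<open>The mass to the left of a point is a continuous function of the point, as single points
  are null and \<open>w\<close> is a majorant; the intermediate value theorem finds where half of it
  is reached.\<close>

lemma nn_integral_half_point:
  fixes w :: "real \<Rightarrow> ennreal"
  assumes [measurable]: "w \<in> borel_measurable lebesgue" and fin: "(\<integral>\<^sup>+s. w s \<partial>lebesgue) < \<infinity>"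
    and neg: "\<And>s. s < 0 \<Longrightarrow> w s = 0" and y: "0 \<le> y"
  obtains z where "0 \<le> z" "z \<le> y" "(\<integral>\<^sup>+s\<in>{..<z}. w s \<partial>lebesgue) = (\<integral>\<^sup>+s\<in>{z..<y}. w s \<partial>lebesgue)"
proof -
  define W where "W y = (\<integral>\<^sup>+s\<in>{..<y}. w s \<partial>lebesgue)" for y
  have W_fin: "W y < \<infinity>" for y
  proof -
    have "W y \<le> (\<integral>\<^sup>+s. w s \<partial>lebesgue)"
      unfolding W_def by (intro nn_integral_mono) (auto split: split_indicator)
    then show ?thesis using fin by (rule le_less_trans)
  qed
  have cont: "continuous_on {0..y} (\<lambda>y. enn2real (W y))"
    unfolding continuous_on_sequentially comp_def
  proof (intro allI ballI impI)
    fix x :: "nat \<Rightarrow> real" and a assume x: "(\<forall>n. x n \<in> {0..y}) \<and> x \<longlonglongrightarrow> a"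
    have "(\<lambda>n. W (x n)) \<longlonglongrightarrow> W a"
      unfolding W_def
    proof (rule nn_integral_dominated_convergence[where w = w])
      show "AE s in lebesgue. w s * indicator {..<x n} s \<le> w s" for n
        by (auto split: split_indicator)
      have "AE s in lebesgue. s \<noteq> a"
        using AE_completion[OF AE_lborel_singleton[of a]] by simp
      then show "AE s in lebesgue. (\<lambda>n. w s * indicator {..<x n} s) \<longlonglongrightarrow> w s * indicator {..<a} s"
      proof eventually_elim
        case (elim s)
        have "\<forall>\<^sub>F n in sequentially. s < x n \<longleftrightarrow> s < a"
        proof (cases "s < a")
          case True
          then have "\<forall>\<^sub>F n in sequentially. s < x n" using x by (auto intro: order_tendstoD)
          then show ?thesis by eventually_elim (use True in auto)
        next
          case False
          then have "\<forall>\<^sub>F n in sequentially. x n < s" using x elim by (auto intro: order_tendstoD)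
          then show ?thesis by eventually_elim (use False in auto)
        qed
        then have "\<forall>\<^sub>F n in sequentially. w s * indicator {..<x n} s = w s * indicator {..<a} s"
          by eventually_elim (auto split: split_indicator)
        then show ?case by (rule tendsto_eventually)
      qed
    qed (use fin in measurable)
    then show "(\<lambda>n. enn2real (W (x n))) \<longlonglongrightarrow> enn2real (W a)"
      using W_fin[of a] by (intro tendsto_enn2real) auto
  qed
  have "W 0 = (\<integral>\<^sup>+s. 0 \<partial>(lebesgue :: real measure))"
    unfolding W_def by (intro nn_integral_cong) (auto simp: neg split: split_indicator)
  then have "enn2real (W 0) \<le> enn2real (W y) / 2" by simp
  then obtain z where z: "0 \<le> z" "z \<le> y" "enn2real (W z) = enn2real (W y) / 2"
    using IVT'[of "\<lambda>y. enn2real (W y)" 0 "enn2real (W y) / 2" y] y cont by auto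
  have sum: "W y = W z + (\<integral>\<^sup>+s\<in>{z..<y}. w s \<partial>lebesgue)"
  proof -
    have "W y = (\<integral>\<^sup>+s. w s * indicator {..<z} s + w s * indicator {z..<y} s \<partial>lebesgue)"
      unfolding W_def using z by (intro nn_integral_cong) (auto split: split_indicator)
    then show ?thesis unfolding W_def by (simp add: nn_integral_add)
  qed
  have "W y = W z + W z"
  proof -
    have "W y = ennreal (enn2real (W y))" "W z = ennreal (enn2real (W z))" using W_fin by auto
    then show ?thesis using z(3) by (metis enn2real_nonneg ennreal_plus field_sum_of_halves)
  qed
  with sum have "W z = (\<integral>\<^sup>+s\<in>{z..<y}. w s \<partial>lebesgue)"
    using W_fin[of z] by (auto simp: ennreal_add_left_cancel)
  then show ?thesis using that[OF z(1,2)] by (simp add: W_def)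
qed

context weakly_singular_kernel
begin

text \<open>The \<open>n\<close>-fold integral behind \<open>M_const\<close>, without the
  exponential prefactors. With the Lipschitz function for \<open>l\<close> it bounds the Lipschitz
  constant of the \<open>n\<close>-th iterate of the fixed point map at time
  \<open>t\<close>.\<close>

primrec iter_kernel :: "(real \<Rightarrow> real) \<Rightarrow> nat \<Rightarrow> real \<Rightarrow> ennreal" where
  "iter_kernel l 0 = (\<lambda>t. 1)"
| "iter_kernel l (Suc n) = (\<lambda>t. kconv (\<lambda>s. ennreal (l s) * iter_kernel l n s) t)"

lemma kconv_le_0: "t \<le> 0 \<Longrightarrow> kconv \<phi> t = 0"
proof -
  assume "t \<le> 0"
  then have "kconv \<phi> t = (\<integral>\<^sup>+s. 0 \<partial>(lebesgue :: real measure))"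
    unfolding kconv_def by (intro nn_integral_cong) (auto simp: k_def split: split_indicator)
  then show ?thesis by simp
qed

text \<open>Measurability in the parameter \<open>t\<close> goes through product measurability for
  Borel functions. So \<open>l\<close> is replaced by a Borel version, which leaves the integral
  unchanged for every \<open>t\<close>.\<close>

lemma iter_kernel_borel:
  assumes l: "l \<in> borel_measurable lebesgue"
  shows "iter_kernel l n \<in> borel_measurable borel"
proof (induction n)
  case (Suc n)
  have "(\<lambda>s. ennreal (l s)) \<in> borel_measurable (completion lborel)" using l by measurable
  from completion_ex_borel_measurable[OF this]
  obtain l' where l': "l' \<in> borel_measurable lborel" "AE s in lborel. ennreal (l s) = l' s" by auto
  have [measurable]: "l' \<in> borel_measurable borel" "iter_kernel l n \<in> borel_measurable borel" using l' Suc by auto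
  have "iter_kernel l (Suc n) = (\<lambda>t. \<integral>\<^sup>+s. ennreal (k (t - s)) * (l' s * iter_kernel l n s) * indicator {0..} s \<partial>lborel)"
  proof
    fix t
    have "iter_kernel l (Suc n) t = (\<integral>\<^sup>+s. ennreal (k (t - s)) * (ennreal (l s) * iter_kernel l n s) * indicator {0..} s \<partial>lborel)"
      by (simp add: kconv_def nn_integral_completion)
    also have "\<dots> = (\<integral>\<^sup>+s. ennreal (k (t - s)) * (l' s * iter_kernel l n s) * indicator {0..} s \<partial>lborel)"
      by (rule nn_integral_cong_AE) (use l'(2) in eventually_elim, simp)
    finally show "iter_kernel l (Suc n) t = (\<integral>\<^sup>+s. ennreal (k (t - s)) * (l' s * iter_kernel l n s) * indicator {0..} s \<partial>lborel)" .
  qed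
  also have "\<dots> \<in> borel_measurable borel"
    by (intro lborel.borel_measurable_nn_integral) measurable
  finally show ?case .
qed simp

lemma iter_kernel_lebesgue:
  assumes "l \<in> borel_measurable lebesgue"
  shows "iter_kernel l n \<in> borel_measurable lebesgue"
  using iter_kernel_borel[OF assms] by (intro measurable_completion) simp

text \<open>By \<open>k_eq\<close> below, each layer turns into a convolution with \<open>k\<close>,
  while the exponential, at first in the innermost variable, is handed outwards. The induction
  strips the outermost variable; \<open>C\<close> absorbs its factors, and the hypothesis ranges
  over all points that agree above index \<open>Suc n\<close>, because the lower entries are
  overwritten.\<close>

lemma iterated_integral_eq_iter_kernel:
  fixes x :: "nat \<Rightarrow> real"
  assumes l: "l \<in> borel_measurable lebesgue" "\<And>s. 0 \<le> l s" "\<And>s. 0 \<le> s \<Longrightarrow> l s = L s"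
    and "0 \<le> C"
    and "\<And>x'. (\<forall>i>Suc n. x' i = x i) \<Longrightarrow> F x' = ennreal (C * (exp (c * x' 1) * (b - x' (Suc n)) powr (\<beta> - 1) *
      (\<Prod>i=2..Suc n. (x' i - x' (i - 1)) powr (\<beta> - 1)) * (\<Prod>i=1..Suc n. L (x' i))))"
  shows "iterated_integral (Suc n) b F x = ennreal (C * exp (c * b) / M ^ Suc n) * iter_kernel l (Suc n) b"
  using assms(4,5)
proof (induction n arbitrary: b C x)
  have k_eq: "M * (exp (c * y) * (b - y) powr (\<beta> - 1)) = exp (c * b) * k (b - y)" if "y \<le> b" for y b
    using that by (cases "y = b") (auto simp: k_def algebra_simps simp flip: exp_add)
  have aux: "(\<integral>\<^sup>+y\<in>{0..b}. G y \<partial>lebesgue) = ennreal (D * exp (c * b) / M ^ Suc m) * iter_kernel l (Suc m) b"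
    if "0 \<le> D" "\<And>y. 0 \<le> y \<Longrightarrow> y \<le> b \<Longrightarrow> G y = ennreal (D * (b - y) powr (\<beta> - 1) * L y * exp (c * y) / M ^ m) * iter_kernel l m y" for G D m b
  proof -
    have [measurable]: "iter_kernel l m \<in> borel_measurable lebesgue" "l \<in> borel_measurable lebesgue"
      using iter_kernel_lebesgue[OF l(1)] l(1) by auto
    have "(\<integral>\<^sup>+y\<in>{0..b}. G y \<partial>lebesgue) = (\<integral>\<^sup>+y. ennreal (D * exp (c * b) / M ^ Suc m) *
        (ennreal (k (b - y)) * (ennreal (l y) * iter_kernel l m y) * indicator {0..} y) \<partial>lebesgue)"
    proof (rule nn_integral_cong)
      fix y
      show "G y * indicator {0..b} y = ennreal (D * exp (c * b) / M ^ Suc m) *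
        (ennreal (k (b - y)) * (ennreal (l y) * iter_kernel l m y) * indicator {0..} y)"
      proof (cases "0 \<le> y \<and> y \<le> b")
        case True
        have "D * (b - y) powr (\<beta> - 1) * L y * exp (c * y) / M ^ m
            = D * L y * (M * (exp (c * y) * (b - y) powr (\<beta> - 1))) / M ^ Suc m"
          using M_pos by simp
        also have "\<dots> = (D * exp (c * b) / M ^ Suc m) * (k (b - y) * l y)"
          using True by (simp only: k_eq) (simp add: l(3))
        finally have eq: "D * (b - y) powr (\<beta> - 1) * L y * exp (c * y) / M ^ m = (D * exp (c * b) / M ^ Suc m) * (k (b - y) * l y)" .
        have "0 \<le> D * exp (c * b) / M ^ Suc m" using that(1) M_pos by simp
        then have "ennreal ((D * exp (c * b) / M ^ Suc m) * (k (b - y) * l y))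
            = ennreal (D * exp (c * b) / M ^ Suc m) * (ennreal (k (b - y)) * ennreal (l y))"
          by (metis ennreal_mult k_nonneg l(2) mult_nonneg_nonneg)
        then show ?thesis
          using True that(2)[of y] unfolding eq by (simp add: mult.assoc)
      qed (auto simp: k_def)
    qed
    also have "\<dots> = ennreal (D * exp (c * b) / M ^ Suc m) * iter_kernel l (Suc m) b"
      by (simp add: kconv_def nn_integral_cmult)
    finally show ?thesis .
  qed
  {
    case 0
    have "iterated_integral (Suc 0) b F x = (\<integral>\<^sup>+y\<in>{0..b}. F (x(Suc 0 := y)) \<partial>lebesgue)" by simp
    also have "\<dots> = ennreal (C * exp (c * b) / M ^ Suc 0) * iter_kernel l (Suc 0) b"
    proof (rule aux[OF 0(1)])
      fix y :: real
      show "F (x(Suc 0 := y)) = ennreal (C * (b - y) powr (\<beta> - 1) * L y * exp (c * y) / M ^ 0) * iter_kernel l 0 y"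
        by (subst 0(2)) (simp_all add: mult_ac)
    qed
    finally show ?case .
  next
    case (Suc n)
    have "iterated_integral (Suc (Suc n)) b F x = (\<integral>\<^sup>+y\<in>{0..b}. iterated_integral (Suc n) y F (x(Suc (Suc n) := y)) \<partial>lebesgue)"
      by simp
    also have "\<dots> = ennreal (C * exp (c * b) / M ^ Suc (Suc n)) * iter_kernel l (Suc (Suc n)) b"
    proof (rule aux[OF Suc.prems(1)])
      fix y :: real assume y: "0 \<le> y" "y \<le> b"
      have Ly: "0 \<le> L y" using l(2)[of y] l(3)[OF y(1)] by simp
      show "iterated_integral (Suc n) y F (x(Suc (Suc n) := y))
          = ennreal (C * (b - y) powr (\<beta> - 1) * L y * exp (c * y) / M ^ Suc n) * iter_kernel l (Suc n) y"
      proof (rule Suc.IH)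
        show "0 \<le> C * (b - y) powr (\<beta> - 1) * L y" using Suc.prems(1) Ly by simp
        fix x' :: "nat \<Rightarrow> real" assume x': "\<forall>i>Suc n. x' i = (x(Suc (Suc n) := y)) i"
        have "F x' = ennreal (C * (exp (c * x' 1) * (b - x' (Suc (Suc n))) powr (\<beta> - 1) *
            (\<Prod>i=2..Suc (Suc n). (x' i - x' (i - 1)) powr (\<beta> - 1)) * (\<Prod>i=1..Suc (Suc n). L (x' i))))"
          by (rule Suc.prems(2)) (use x' in auto)
        also have "x' (Suc (Suc n)) = y" using x' by simp
        also have "(\<Prod>i=2..Suc (Suc n). (x' i - x' (i - 1)) powr (\<beta> - 1))
            = (y - x' (Suc n)) powr (\<beta> - 1) * (\<Prod>i=2..Suc n. (x' i - x' (i - 1)) powr (\<beta> - 1))"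
          using x' by (simp add: prod.cl_ivl_Suc mult.commute)
        also have "(\<Prod>i=1..Suc (Suc n). L (x' i)) = L y * (\<Prod>i=1..Suc n. L (x' i))"
          using x' by (simp add: prod.cl_ivl_Suc mult.commute)
        finally show "F x' = ennreal (C * (b - y) powr (\<beta> - 1) * L y * (exp (c * x' 1) * (y - x' (Suc n)) powr (\<beta> - 1) *
            (\<Prod>i=2..Suc n. (x' i - x' (i - 1)) powr (\<beta> - 1)) * (\<Prod>i=1..Suc n. L (x' i))))"
          by (simp only: mult_ac)
      qed
    qed
    finally show ?case .
  }
qed

text \<open>The prefactors \<open>M ^ n\<close> and \<open>exp (- c * t)\<close> cancel what the
  change to \<open>k\<close> produced, so \<open>iter_kernel\<close> is the expression under the
  supremum at \<open>t\<close>.\<close>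

lemma iter_kernel_le_M_const:
  assumes l: "l \<in> borel_measurable lebesgue" "\<And>s. 0 \<le> l s" "\<And>s. 0 \<le> s \<Longrightarrow> l s = L s"
    and n: "n \<ge> 1"
  shows "iter_kernel l n t \<le> M_const c \<beta> M L n"
proof (cases "0 \<le> t")
  case True
  obtain m where m: "n = Suc m" using n by (cases n) auto
  define F where "F x = ennreal (exp (c * x 1) * (t - x n) powr (\<beta> - 1) *
                 (\<Prod>i=2..n. (x i - x (i - 1)) powr (\<beta> - 1)) * (\<Prod>i=1..n. L (x i)))" for x :: "nat \<Rightarrow> real"
  have "iterated_integral n t F (\<lambda>_. 0) = ennreal (1 * exp (c * t) / M ^ n) * iter_kernel l n t"
    unfolding m by (rule iterated_integral_eq_iter_kernel[OF l]) (auto simp: F_def m)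
  then have "ennreal (M ^ n) * (ennreal (exp (- c * t)) * iterated_integral n t F (\<lambda>_. 0)) =
      ennreal (M ^ n) * (ennreal (exp (- c * t)) * (ennreal (exp (c * t) / M ^ n) * iter_kernel l n t))"
    by (simp only: mult_1)
  also have "\<dots> = ennreal (M ^ n * (exp (- c * t) * (exp (c * t) / M ^ n))) * iter_kernel l n t"
  proof -
    have "ennreal a * (ennreal b * (ennreal d * B)) = ennreal (a * (b * d)) * B"
      if "0 \<le> a" "0 \<le> b" "0 \<le> d" for a b d B
      using that by (simp add: ennreal_mult mult.assoc)
    then show ?thesis using M_pos by (metis exp_ge_zero divide_nonneg_pos less_imp_le zero_less_power)
  qed
  also have "M ^ n * (exp (- c * t) * (exp (c * t) / M ^ n)) = 1"
    using M_pos by (simp add: exp_minus)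
  finally have "iter_kernel l n t = ennreal (M ^ n) * (ennreal (exp (- c * t)) * iterated_integral n t F (\<lambda>_. 0))" by simp
  also have "\<dots> \<le> M_const c \<beta> M L n"
    unfolding M_const_def F_def using True by (intro mult_left_mono SUP_upper) auto
  finally show ?thesis .
next
  case False
  then have "iter_kernel l n t = 0" using n by (cases n) (auto simp: kconv_le_0)
  then show ?thesis by simp
qed

text \<open>Since \<open>k\<close> is decreasing, \<open>k(x' - x) \<ge> k(t - x)\<close> for \<open>x < x' \<le> t\<close>; replacing all inner kernels
  accordingly bounds the \<open>n\<close>-fold integral from below by a multiple of the \<open>n\<close>-th power of the simple one.\<close>

primrec power_const :: "nat \<Rightarrow> real" where
  "power_const 0 = 1"
| "power_const (Suc n) = power_const n / 2 ^ Suc n"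

lemma power_const_pos: "power_const n > 0"
  by (induction n) auto

lemma iter_kernel_ge_power:
  assumes [measurable]: "l \<in> borel_measurable lebesgue" and l: "\<And>s. 0 \<le> l s" "\<And>s. s < 0 \<Longrightarrow> l s = 0"
    and fin: "kconv (\<lambda>s. ennreal (l s)) t < \<infinity>"
    and "0 \<le> y" "y \<le> t"
  shows "ennreal (power_const n) * (\<integral>\<^sup>+s\<in>{..<y}. ennreal (k (t - s)) * ennreal (l s) \<partial>lebesgue) ^ n \<le> iter_kernel l n y"
  using \<open>0 \<le> y\<close> \<open>y \<le> t\<close>
proof (induction n arbitrary: y)
  case (Suc n)
  define w where "w s = ennreal (k (t - s)) * ennreal (l s)" for s
  have [measurable]: "w \<in> borel_measurable lebesgue" unfolding w_def[abs_def] by measurable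
  have neg: "w s = 0" if "s < 0" for s using l(2)[OF that] by (simp add: w_def)
  have "kconv (\<lambda>s. ennreal (l s)) t = (\<integral>\<^sup>+s. w s \<partial>lebesgue)"
    unfolding kconv_def w_def by (intro nn_integral_cong) (auto simp: l(2) split: split_indicator)
  then have w_fin: "(\<integral>\<^sup>+s. w s \<partial>lebesgue) < \<infinity>" using fin by simp
  \<comment> \<open>The interval from \<open>z\<close> to \<open>y\<close> keeps half of the mass
    for the outermost integral, while the induction hypothesis at any \<open>s \<ge> z\<close> still
    sees the other half.\<close>
  obtain z where z: "0 \<le> z" "z \<le> y" "(\<integral>\<^sup>+s\<in>{..<z}. w s \<partial>lebesgue) = (\<integral>\<^sup>+s\<in>{z..<y}. w s \<partial>lebesgue)"
  proof (rule nn_integral_half_point[of w y])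
    show "w \<in> borel_measurable lebesgue" by measurable
    show "(\<integral>\<^sup>+s. w s \<partial>lebesgue) < \<infinity>" by (rule w_fin)
    show "w s = 0" if "s < 0" for s by (rule neg[OF that])
    show "0 \<le> y" by (rule Suc.prems(1))
  qed (rule that)
  define W where "W = (\<integral>\<^sup>+s\<in>{..<z}. w s \<partial>lebesgue)"
  have Wy: "(\<integral>\<^sup>+s\<in>{..<y}. w s \<partial>lebesgue) = 2 * W"
  proof -
    have "(\<integral>\<^sup>+s\<in>{..<y}. w s \<partial>lebesgue) = (\<integral>\<^sup>+s. w s * indicator {..<z} s + w s * indicator {z..<y} s \<partial>lebesgue)"
      using z by (intro nn_integral_cong) (auto split: split_indicator)
    also have "\<dots> = W + W" unfolding W_def by (subst nn_integral_add) (simp_all add: z(3))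
    finally show ?thesis by (simp add: mult_2)
  qed
  \<comment> \<open>The full mass is \<open>2 * W\<close> but only \<open>W\<close> is available in
    each of the \<open>Suc n\<close> factors: this loss of \<open>2 ^ Suc n\<close> is the new
    factor in \<open>power_const\<close>.\<close>
  have "ennreal (power_const (Suc n)) * (2 * W) ^ Suc n = ennreal (power_const n) * W ^ Suc n"
  proof -
    have "ennreal (power_const (Suc n)) * 2 ^ Suc n = ennreal (power_const (Suc n)) * ennreal (2 ^ Suc n)"
      by (metis ennreal_numeral ennreal_power zero_le_numeral)
    also have "\<dots> = ennreal (power_const (Suc n) * 2 ^ Suc n)"
      by (rule ennreal_mult[OF less_imp_le[OF power_const_pos], symmetric]) simp
    also have "power_const (Suc n) * 2 ^ Suc n = power_const n" by simp
    finally show ?thesis by (simp only: power_mult_distrib mult.assoc[symmetric])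
  qed
  also have "\<dots> = (\<integral>\<^sup>+s. (ennreal (power_const n) * W ^ n) * (w s * indicator {z..<y} s) \<partial>lebesgue)"
    unfolding W_def z(3) by (subst nn_integral_cmult) (simp_all add: mult_ac)
  also have "\<dots> \<le> iter_kernel l (Suc n) y"
    unfolding iter_kernel.simps kconv_def
  proof (rule nn_integral_mono)
    fix s
    show "(ennreal (power_const n) * W ^ n) * (w s * indicator {z..<y} s)
      \<le> ennreal (k (y - s)) * (ennreal (l s) * iter_kernel l n s) * indicator {0..} s"
    proof (cases "z \<le> s \<and> s < y")
      case True
      have "W \<le> (\<integral>\<^sup>+s'\<in>{..<s}. w s' \<partial>lebesgue)"
        unfolding W_def using True by (intro nn_integral_mono) (auto split: split_indicator)
      then have "ennreal (power_const n) * W ^ n \<le> ennreal (power_const n) * (\<integral>\<^sup>+s'\<in>{..<s}. w s' \<partial>lebesgue) ^ n"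
        by (intro mult_left_mono power_mono) auto
      also have "\<dots> \<le> iter_kernel l n s"
        unfolding w_def using True z Suc.prems by (intro Suc.IH) auto
      finally have 1: "ennreal (power_const n) * W ^ n \<le> iter_kernel l n s" .
      have 2: "w s \<le> ennreal (k (y - s)) * ennreal (l s)"
        unfolding w_def using True Suc.prems by (intro mult_right_mono ennreal_leI k_antimono) auto
      from mult_mono[OF 1 2] show ?thesis using True z by (simp add: mult_ac)
    qed auto
  qed
  finally show ?case by (simp only: Wy[unfolded w_def])
qed simp

text \<open>Taking \<open>y = t\<close> in the lower bound gives
  \<open>power_const n * v ^ n \<le> 1\<close> for the value \<open>v\<close> of the simple
  convolution, with a constant free of \<open>t\<close>. Finiteness at each \<open>t\<close>, known
  from elsewhere, thereby becomes a uniform bound.\<close>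

lemma kconv_bounded_of_iter_kernel:
  assumes l_meas: "l \<in> borel_measurable lebesgue" and l: "\<And>s. 0 \<le> l s" "\<And>s. s < 0 \<Longrightarrow> l s = 0"
    and fin: "\<And>t. kconv (\<lambda>s. ennreal (l s)) t < \<infinity>"
    and n: "n \<ge> 1" and iter_kernel: "\<And>t. iter_kernel l n t \<le> 1"
  shows "kconv (\<lambda>s. ennreal (l s)) t \<le> ennreal (max 1 (1 / power_const n))"
proof (cases "0 \<le> t")
  case True
  have eq: "kconv (\<lambda>s. ennreal (l s)) t = (\<integral>\<^sup>+s\<in>{..<t}. ennreal (k (t - s)) * ennreal (l s) \<partial>lebesgue)"
    unfolding kconv_def by (intro nn_integral_cong) (auto simp: k_def l(2) split: split_indicator)
  have 1: "ennreal (power_const n) * kconv (\<lambda>s. ennreal (l s)) t ^ n \<le> 1"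
    unfolding eq using iter_kernel_ge_power[OF l_meas l fin True order_refl, of n] iter_kernel[of t] by (rule order_trans)
  obtain v where v: "0 \<le> v" "kconv (\<lambda>s. ennreal (l s)) t = ennreal v"
    using fin[of t] by (auto simp: less_top_ennreal)
  have "power_const n * v ^ n \<le> 1"
    using 1 v power_const_pos[of n] by (simp add: ennreal_power ennreal_le_1 flip: ennreal_mult)
  then have vn: "v ^ n \<le> 1 / power_const n"
    using power_const_pos[of n] by (simp add: field_simps)
  \<comment> \<open>For \<open>v > 1\<close> the number is at most its \<open>n\<close>-th power, so
    no root is taken.\<close>
  have "v \<le> max 1 (1 / power_const n)"
  proof (cases "v \<le> 1")
    case False
    then have "v ^ 1 \<le> v ^ n" using n by (intro power_increasing) auto
    then show ?thesis using vn by simp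
  qed simp
  then show ?thesis using v by (simp add: ennreal_leI)
next
  case False
  then show ?thesis by (simp add: kconv_le_0)
qed

end

section \<open>The fixed point\<close>

text \<open>The almost periods of \<open>v\<close> are kept; both \<open>S t\<close> and
  \<open>S (t + \<tau>)\<close> are small once \<open>t\<close> is late, since shifts are
  nonnegative.\<close>

lemma aap_add_vanishing:
  fixes v S :: "real \<Rightarrow> 'a::real_normed_vector"
  assumes v: "asymptotically_almost_periodic v" and S: "continuous_on {0..} S" "(S \<longlongrightarrow> 0) at_top"
  shows "asymptotically_almost_periodic (\<lambda>t. S t + v t)"
  unfolding asymptotically_almost_periodic_def
proof (intro conjI allI impI)
  have van: "\<exists>m>0. \<forall>t\<ge>m. norm (S t) \<le> \<epsilon>" if "\<epsilon> > 0" for \<epsilon>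
  proof -
    have "\<forall>\<^sub>F t in at_top. norm (S t) < \<epsilon>"
      using tendstoD[OF S(2) that] by (simp add: dist_norm)
    then obtain N where "\<And>t. t \<ge> N \<Longrightarrow> norm (S t) < \<epsilon>" by (auto simp: eventually_at_top_linorder)
    then show ?thesis by (intro exI[of _ "max 1 N"]) (auto intro: less_imp_le)
  qed
  show "continuous_on {0..} (\<lambda>t. S t + v t)"
    using v S by (intro continuous_intros) (auto simp: asymptotically_almost_periodic_def)
  show "bounded ((\<lambda>t. S t + v t) ` {0..})"
  proof -
    obtain m where m: "m > 0" "\<And>t. t \<ge> m \<Longrightarrow> norm (S t) \<le> 1" using van[of 1] by auto
    have "bounded (S ` {0..m})"
      using continuous_on_subset[OF S(1), of "{0..m}"] by (intro compact_imp_bounded compact_continuous_image) auto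
    then obtain B where B: "\<And>t. 0 \<le> t \<Longrightarrow> t \<le> m \<Longrightarrow> norm (S t) \<le> B" by (force simp: bounded_iff)
    have "norm (S t) \<le> max B 1" if "0 \<le> t" for t
      using B[OF that] m(2)[of t] by (cases "t \<le> m") (auto simp: le_max_iff_disj)
    then have "bounded (S ` {0..})" unfolding bounded_iff by (intro exI[of _ "max B 1"]) auto
    then show ?thesis
      using v by (intro bounded_plus_comp) (auto simp: asymptotically_almost_periodic_def)
  qed
  fix \<epsilon> :: real assume "\<epsilon> > 0"
  then have e3: "\<epsilon> / 3 > 0" by simp
  obtain m' where m': "m' > 0" "\<And>t. t \<ge> m' \<Longrightarrow> norm (S t) \<le> \<epsilon> / 3" using van[OF e3] by auto
  obtain l m where lm: "l > 0" "m > 0"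
      and ap: "\<And>a. 0 \<le> a \<Longrightarrow> \<exists>\<tau>\<in>{a..a + l}. \<forall>t\<ge>m. norm (v (t + \<tau>) - v t) \<le> \<epsilon> / 3"
    using aap_almost_periods[OF v e3] by blast
  have "\<exists>\<tau>\<in>{a..a + l}. \<forall>t\<ge>max m m'. norm (S (t + \<tau>) + v (t + \<tau>) - (S t + v t)) \<le> \<epsilon>" if a: "0 \<le> a" for a
  proof -
    obtain \<tau> where \<tau>: "\<tau> \<in> {a..a+l}" "\<And>t. t \<ge> m \<Longrightarrow> norm (v (t + \<tau>) - v t) \<le> \<epsilon> / 3"
      using ap[OF a] by blast
    have "norm (S (t + \<tau>) + v (t + \<tau>) - (S t + v t)) \<le> \<epsilon>" if t: "t \<ge> max m m'" for t
    proof -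
      have "norm (S (t + \<tau>) + v (t + \<tau>) - (S t + v t)) = norm (S (t + \<tau>) + (v (t + \<tau>) - v t) - S t)"
        by (simp add: algebra_simps)
      also have "\<dots> \<le> norm (S (t + \<tau>)) + norm (v (t + \<tau>) - v t) + norm (S t)"
        by (rule norm_add_diff_le)
      finally show ?thesis using \<tau>(2)[of t] m'(2)[of t] m'(2)[of "t + \<tau>"] t a \<tau>(1) by simp
    qed
    then show ?thesis using \<tau>(1) by blast
  qed
  then show "\<exists>l>0. \<exists>m>0. \<forall>a\<ge>0. \<exists>\<tau>\<in>{a..a + l}. \<forall>t\<ge>m. norm (S (t + \<tau>) + v (t + \<tau>) - (S t + v t)) \<le> \<epsilon>"
    using lm m' by (intro exI[of _ l] conjI exI[of _ "max m m'"]) auto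
qed

locale semilinear_cauchy = semilinear_inclusion M c \<beta> T f g h lf lg K
  for M c \<beta> :: real and T :: "real \<Rightarrow> 'a::banach \<Rightarrow>\<^sub>L 'a" and f g h lf lg K +
  fixes u0 :: 'a and n :: nat and \<theta> :: real
  assumes u0: "((\<lambda>t. blinfun_apply (T t) u0) \<longlongrightarrow> u0) (at_right 0)"
    and theta: "0 \<le> \<theta>" "\<theta> < 1"
    and iter_kernel_le_theta: "iter_kernel lf n t \<le> ennreal \<theta>"
begin

text \<open>The orbit of the initial value. The first case carries the convention
  \<open>T(0) u0 = u0\<close>, which the hypothesis on \<open>u0\<close> turns into continuity at
  \<open>0\<close>.\<close>

definition S :: "real \<Rightarrow> 'a" where
  "S t = (if t \<le> 0 then u0 else blinfun_apply (T t) u0)"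

definition \<Upsilon> :: "(real \<Rightarrow> 'a) \<Rightarrow> real \<Rightarrow> 'a" where
  "\<Upsilon> u t = S t + Tconv (F u) t"

lemma S_continuous: "continuous_on {0..} S"
proof -
  have "continuous (at t within {0..}) S" if t: "t \<ge> 0" for t
  proof (cases "t = 0")
    case True
    have "\<forall>\<^sub>F t in at_right 0. S t = blinfun_apply (T t) u0"
      by (simp add: eventually_at_filter S_def)
    then have "(S \<longlongrightarrow> u0) (at_right 0)"
      using u0 by (subst tendsto_cong)
    then show ?thesis
      using True by (simp add: continuous_within S_def at_within_Ici_at_right)
  next
    case False
    then have "isCont T t"
      using T_continuous t by (intro continuous_on_interior[of "{0<..}"]) (auto simp: interior_open)
    then have "isCont (\<lambda>t. blinfun_apply (T t) u0) t" by (intro continuous_intros)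
    moreover have "\<forall>\<^sub>F s in nhds t. S s = blinfun_apply (T s) u0"
    proof -
      have "\<forall>\<^sub>F s in nhds t. s \<in> {0<..}" using False t by (intro eventually_nhds_in_open) auto
      then show ?thesis by eventually_elim (simp add: S_def)
    qed
    ultimately have "isCont S t" by (simp add: isCont_cong)
    then show ?thesis by (rule continuous_at_imp_continuous_at_within)
  qed
  then show ?thesis by (simp add: continuous_on_eq_continuous_within)
qed

lemma S_vanishes: "(S \<longlongrightarrow> 0) at_top"
proof (rule tendstoI)
  fix \<epsilon> :: real assume "\<epsilon> > 0"
  then obtain m where m: "m > 0" "\<And>t. t \<ge> m \<Longrightarrow> exp (- c * (t - 0)) * (M * norm u0) \<le> \<epsilon> / 2"
    using exp_decay_le[of "M * norm u0" "\<epsilon> / 2" 0] M_pos by auto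
  have "dist (S t) 0 < \<epsilon>" if "t \<ge> max m 1" for t
  proof -
    have "norm (S t) \<le> norm (T t) * norm u0"
      using that m norm_blinfun[of "T t" u0] by (auto simp: S_def)
    also have "\<dots> \<le> k t * norm u0" using T_bound[of t] that m by (intro mult_right_mono) auto
    also have "k t \<le> M * exp (- c * t) * 1"
    proof -
      have "t powr (\<beta> - 1) \<le> 1"
        using that beta_le_1 powr_mono2'[of "\<beta> - 1" 1 t] by simp
      then have "M * exp (- c * t) * t powr (\<beta> - 1) \<le> M * exp (- c * t) * 1"
        using M_pos by (intro mult_left_mono) auto
      then show ?thesis using that m by (simp add: k_def)
    qed
    finally have "norm (S t) \<le> exp (- c * (t - 0)) * (M * norm u0)"
      by (simp add: mult_ac mult_right_mono)
    then show ?thesis using m(2)[of t] that \<open>\<epsilon> > 0\<close> by simp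
  qed
  then show "\<forall>\<^sub>F t in at_top. dist (S t) 0 < \<epsilon>"
    unfolding eventually_at_top_linorder by blast
qed

lemma aap_continuous_bounded:
  "asymptotically_almost_periodic u \<Longrightarrow> continuous_on {0..} u"
  "asymptotically_almost_periodic u \<Longrightarrow> bounded (u ` {0..})"
  by (simp_all add: asymptotically_almost_periodic_def)

lemma admissible_F_aap: "asymptotically_almost_periodic u \<Longrightarrow> admissible (F u)"
  by (intro admissible_F aap_continuous_bounded)

lemma aap_Upsilon:
  assumes u: "asymptotically_almost_periodic u"
  shows "asymptotically_almost_periodic (\<Upsilon> u)"
  unfolding \<Upsilon>_def[abs_def]
proof (rule aap_add_vanishing[OF _ S_continuous S_vanishes])
  obtain U where U: "0 \<le> U" "\<And>s. 0 \<le> s \<Longrightarrow> norm (u s) \<le> U"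
    using bounded_norm_le[OF aap_continuous_bounded(2)[OF u]] by blast
  show "asymptotically_almost_periodic (Tconv (F u))"
  proof (rule aap_Tconv)
    show "admissible (F u)" by (rule admissible_F_aap[OF u])
    show "small_near b (\<lambda>s. ennreal (norm (F u s)))" for b
      by (rule small_near_F[OF aap_continuous_bounded(2)[OF u]])
    show "0 \<le> K + K + K * U" using K_nonneg U by simp
    show "kconv (\<lambda>s. ennreal (norm (F u s))) t \<le> ennreal (K + K + K * U)" for t
      by (rule kconv_F_le) (rule U)
  qed (rule F_almost_periods[OF u])
qed

lemma aap_Upsilon_power: "asymptotically_almost_periodic u \<Longrightarrow> asymptotically_almost_periodic ((\<Upsilon> ^^ j) u)"
  by (induction j) (auto intro: aap_Upsilon)

text \<open>\<open>F u\<close> is zero at negative times, so the map sees \<open>u\<close> only on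
  the half-line. Functions on the whole line can therefore represent functions on the
  half-line.\<close>

lemma Upsilon_cong:
  assumes "\<And>s. 0 \<le> s \<Longrightarrow> u s = v s"
  shows "\<Upsilon> u = \<Upsilon> v"
proof -
  have "F u = F v"
    using assms f_neg by (auto simp: F_def fun_eq_iff) (metis not_le)
  then show ?thesis by (simp add: \<Upsilon>_def[abs_def])
qed

text \<open>Each application contributes the factor \<open>lf\<close> by the Lipschitz condition and
  one convolution with \<open>k\<close>, which is the recursion of
  \<open>iter_kernel\<close>.\<close>

lemma norm_Upsilon_power_diff_le:
  assumes u: "asymptotically_almost_periodic u" and v: "asymptotically_almost_periodic v"
    and d: "\<And>s. 0 \<le> s \<Longrightarrow> norm (u s - v s) \<le> d" and t: "0 \<le> t"
  shows "ennreal (norm ((\<Upsilon> ^^ j) u t - (\<Upsilon> ^^ j) v t)) \<le> ennreal d * iter_kernel lf j t"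
  using t
proof (induction j arbitrary: t)
  case 0
  then show ?case using d by (simp add: ennreal_leI)
next
  case (Suc j)
  let ?u = "(\<Upsilon> ^^ j) u" and ?v = "(\<Upsilon> ^^ j) v"
  note [measurable] = iter_kernel_lebesgue[OF lf_measurable]
  have "ennreal (norm ((\<Upsilon> ^^ Suc j) u t - (\<Upsilon> ^^ Suc j) v t)) = ennreal (norm (Tconv (F ?u) t - Tconv (F ?v) t))"
    by (simp add: \<Upsilon>_def)
  also have "\<dots> \<le> kconv (\<lambda>s. ennreal (norm (F ?u s - F ?v s))) t"
    by (intro norm_Tconv_diff_le admissible_F_aap aap_Upsilon_power u v)
  also have "\<dots> \<le> kconv (\<lambda>s. ennreal d * (ennreal (lf s) * iter_kernel lf j s)) t"
  proof (rule kconv_mono_AE)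
    show "AE s in lebesgue. 0 \<le> s \<longrightarrow> ennreal (norm (F ?u s - F ?v s)) \<le> ennreal d * (ennreal (lf s) * iter_kernel lf j s)"
      using f_Lipschitz
    proof eventually_elim
      case (elim s)
      show ?case
      proof
        assume s: "0 \<le> s"
        have "ennreal (norm (F ?u s - F ?v s)) \<le> ennreal (lf s * norm (?u s - ?v s))"
          using elim by (intro ennreal_leI) (simp add: F_def)
        also have "\<dots> = ennreal (lf s) * ennreal (norm (?u s - ?v s))"
          using lf_nonneg by (simp add: ennreal_mult)
        also have "\<dots> \<le> ennreal (lf s) * (ennreal d * iter_kernel lf j s)"
          by (intro mult_left_mono Suc.IH s) auto
        finally show "ennreal (norm (F ?u s - F ?v s)) \<le> ennreal d * (ennreal (lf s) * iter_kernel lf j s)"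
          by (simp add: mult_ac)
      qed
    qed
  qed
  also have "\<dots> = ennreal d * iter_kernel lf (Suc j) t"
    by (simp add: kconv_cmult)
  finally show ?case .
qed

lemma Upsilon_power_contraction:
  assumes u: "asymptotically_almost_periodic u" and v: "asymptotically_almost_periodic v"
    and d: "\<And>s. 0 \<le> s \<Longrightarrow> norm (u s - v s) \<le> d" and t: "0 \<le> t"
  shows "norm ((\<Upsilon> ^^ n) u t - (\<Upsilon> ^^ n) v t) \<le> \<theta> * d"
proof -
  have d0: "0 \<le> d" using d[OF t] norm_ge_zero[of "u t - v t"] by linarith
  have "ennreal (norm ((\<Upsilon> ^^ n) u t - (\<Upsilon> ^^ n) v t)) \<le> ennreal d * iter_kernel lf n t"
    by (rule norm_Upsilon_power_diff_le[OF u v d t])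
  also have "\<dots> \<le> ennreal d * ennreal \<theta>" by (intro mult_left_mono iter_kernel_le_theta) auto
  also have "\<dots> = ennreal (\<theta> * d)" using d0 theta by (simp add: ennreal_mult mult.commute)
  finally show ?thesis using d0 theta by (simp add: ennreal_le_iff)
qed

text \<open>Any bound \<open>d\<close> for the difference improves itself to
  \<open>\<theta> * d\<close>; starting from \<open>U + V\<close> this forces the difference to
  vanish.\<close>

lemma Upsilon_power_fixed_unique:
  assumes u: "asymptotically_almost_periodic u" and v: "asymptotically_almost_periodic v"
    and fu: "\<And>t. 0 \<le> t \<Longrightarrow> (\<Upsilon> ^^ n) u t = u t" and fv: "\<And>t. 0 \<le> t \<Longrightarrow> (\<Upsilon> ^^ n) v t = v t"
    and t: "0 \<le> t"
  shows "u t = v t"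
proof -
  obtain U where U: "0 \<le> U" "\<And>s. 0 \<le> s \<Longrightarrow> norm (u s) \<le> U"
    using bounded_norm_le[OF aap_continuous_bounded(2)[OF u]] by blast
  obtain V where V: "0 \<le> V" "\<And>s. 0 \<le> s \<Longrightarrow> norm (v s) \<le> V"
    using bounded_norm_le[OF aap_continuous_bounded(2)[OF v]] by blast
  have le: "norm (u s - v s) \<le> \<theta> ^ j * (U + V)" if "0 \<le> s" for s j
    using that
  proof (induction j arbitrary: s)
    case 0
    then show ?case using U(2)[of s] V(2)[of s] norm_triangle_ineq4[of "u s" "v s"] by simp
  next
    case (Suc j)
    have "norm ((\<Upsilon> ^^ n) u s - (\<Upsilon> ^^ n) v s) \<le> \<theta> * (\<theta> ^ j * (U + V))"
      by (rule Upsilon_power_contraction[OF u v Suc.IH Suc.prems])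
    then show ?case using fu fv Suc.prems by (simp add: mult.assoc)
  qed
  have "(\<lambda>j. \<theta> ^ j * (U + V)) \<longlonglongrightarrow> 0 * (U + V)"
    using theta by (intro tendsto_intros LIMSEQ_realpow_zero) auto
  then have "norm (u t - v t) \<le> 0 * (U + V)"
    using le[OF t] by (intro LIMSEQ_le_const) auto
  then show ?thesis by simp
qed

text \<open>Banach's theorem for the \<open>n\<close>-th iterate on the closed set of asymptotically
  almost periodic members of the bounded continuous functions.\<close>

lemma Upsilon_fixed_exists:
  obtains u where "asymptotically_almost_periodic u" "\<And>t. 0 \<le> t \<Longrightarrow> \<Upsilon> u t = u t"
proof -
  define A where "A = {\<phi> :: real \<Rightarrow>\<^sub>C 'a. asymptotically_almost_periodic (apply_bcontfun \<phi>)}"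
  \<comment> \<open>Bounded continuous functions live on the whole line here, so the image is
    continued to negative times by its value at \<open>0\<close>.\<close>
  define G where "G \<phi> = Bcontfun (\<lambda>t. (\<Upsilon> ^^ n) (apply_bcontfun \<phi>) (max 0 t))" for \<phi> :: "real \<Rightarrow>\<^sub>C 'a"
  have G: "apply_bcontfun (G \<phi>) = (\<lambda>t. (\<Upsilon> ^^ n) (apply_bcontfun \<phi>) (max 0 t))" if "\<phi> \<in> A" for \<phi>
  proof -
    have aap: "asymptotically_almost_periodic ((\<Upsilon> ^^ n) (apply_bcontfun \<phi>))"
      using that unfolding A_def by (intro aap_Upsilon_power) simp
    obtain U where U: "\<And>s. 0 \<le> s \<Longrightarrow> norm ((\<Upsilon> ^^ n) (apply_bcontfun \<phi>) s) \<le> U"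
      using bounded_norm_le[OF aap_continuous_bounded(2)[OF aap]] by blast
    have "(\<lambda>t. (\<Upsilon> ^^ n) (apply_bcontfun \<phi>) (max 0 t)) \<in> bcontfun"
      using U by (intro bcontfun_normI[of _ U] continuous_on_compose2[OF aap_continuous_bounded(1)[OF aap]])
        (auto intro!: continuous_intros)
    then show ?thesis unfolding G_def by (rule Bcontfun_inverse)
  qed
  have aap_cong: "asymptotically_almost_periodic v" if "asymptotically_almost_periodic u" "\<And>t. 0 \<le> t \<Longrightarrow> u t = v t" for u v :: "real \<Rightarrow> 'a"
  proof (rule aap_uniform_limit[of "\<lambda>_. u"])
    show "continuous_on {0..} v"
      using aap_continuous_bounded(1)[OF that(1)] that(2) by (subst continuous_on_cong[of "{0..}" "{0..}" v u]) auto
    have "v ` {0..} = u ` {0..}" using that(2) by force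
    then show "bounded (v ` {0..})" using aap_continuous_bounded(2)[OF that(1)] by simp
  qed (use that in auto)
  have "closed A"
    unfolding closed_sequential_limits
  proof (intro allI impI)
    fix \<phi> :: "nat \<Rightarrow> real \<Rightarrow>\<^sub>C 'a" and \<psi> assume "(\<forall>n. \<phi> n \<in> A) \<and> \<phi> \<longlonglongrightarrow> \<psi>"
    then have \<phi>: "\<And>n. \<phi> n \<in> A" and lim: "\<phi> \<longlonglongrightarrow> \<psi>" by auto
    have "asymptotically_almost_periodic (apply_bcontfun \<psi>)"
    proof (rule aap_uniform_limit[of "\<lambda>n. apply_bcontfun (\<phi> n)"])
      show "asymptotically_almost_periodic (apply_bcontfun (\<phi> n))" for n using \<phi> by (simp add: A_def)
      show "continuous_on {0..} (apply_bcontfun \<psi>)" by simp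
      show "bounded (apply_bcontfun \<psi> ` {0..})"
        using norm_bounded[of \<psi>] unfolding bounded_iff by blast
      fix \<epsilon> :: real assume "\<epsilon> > 0"
      then obtain n where "dist (\<phi> n) \<psi> < \<epsilon>" using metric_LIMSEQ_D[OF lim] by blast
      then have "norm (apply_bcontfun (\<phi> n) t - apply_bcontfun \<psi> t) \<le> \<epsilon>" for t
        using dist_bounded[of "\<phi> n" t \<psi>] by (simp add: dist_norm)
      then show "\<exists>n. \<forall>t\<ge>0. norm (apply_bcontfun (\<phi> n) t - apply_bcontfun \<psi> t) \<le> \<epsilon>" by blast
    qed
    then show "\<psi> \<in> A" by (simp add: A_def)
  qed
  then have "complete A" by (simp add: complete_eq_closed)
  moreover have "A \<noteq> {}"
  proof -
    have "asymptotically_almost_periodic (\<lambda>_. 0 :: 'a)"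
      unfolding asymptotically_almost_periodic_def
    proof (intro conjI allI impI)
      fix \<epsilon> :: real assume "\<epsilon> > 0"
      then have "\<forall>t\<ge>1::real. norm (0 - 0 :: 'a) \<le> \<epsilon>" by simp
      moreover have "a \<in> {a..a + 1}" for a :: real by simp
      ultimately show "\<exists>l>0::real. \<exists>m>0::real. \<forall>a\<ge>0. \<exists>\<tau>\<in>{a..a + l}. \<forall>t\<ge>m. norm (0 - 0 :: 'a) \<le> \<epsilon>"
        using zero_less_one by blast
    qed (simp_all add: image_constant_conv)
    then have "0 \<in> A" by (simp add: A_def zero_bcontfun.rep_eq)
    then show ?thesis by blast
  qed
  moreover have "G ` A \<subseteq> A"
  proof
    fix \<psi> assume "\<psi> \<in> G ` A"
    then obtain \<phi> where \<phi>: "\<phi> \<in> A" "\<psi> = G \<phi>" by blast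
    have "asymptotically_almost_periodic ((\<Upsilon> ^^ n) (apply_bcontfun \<phi>))"
      using \<phi>(1) unfolding A_def by (intro aap_Upsilon_power) simp
    then show "\<psi> \<in> A"
      unfolding A_def \<phi>(2) mem_Collect_eq G[OF \<phi>(1)] by (rule aap_cong) simp
  qed
  moreover have "dist (G \<phi>) (G \<psi>) \<le> \<theta> * dist \<phi> \<psi>" if "\<phi> \<in> A" "\<psi> \<in> A" for \<phi> \<psi>
  proof (rule dist_bound)
    fix t
    have "norm (apply_bcontfun \<phi> s - apply_bcontfun \<psi> s) \<le> dist \<phi> \<psi>" for s
      using dist_bounded[of \<phi> s \<psi>] by (simp add: dist_norm)
    then show "dist (apply_bcontfun (G \<phi>) t) (apply_bcontfun (G \<psi>) t) \<le> \<theta> * dist \<phi> \<psi>"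
      unfolding G[OF that(1)] G[OF that(2)] dist_norm using that
      by (intro Upsilon_power_contraction) (auto simp: A_def dist_norm)
  qed
  ultimately obtain \<phi> where \<phi>: "\<phi> \<in> A" "G \<phi> = \<phi>"
    using Banach_fix[of A \<theta> G] theta by blast
  define u where "u = apply_bcontfun \<phi>"
  have u: "asymptotically_almost_periodic u" using \<phi>(1) by (simp add: A_def u_def)
  have fix_u: "(\<Upsilon> ^^ n) u t = u t" if "0 \<le> t" for t
    using fun_cong[OF G[OF \<phi>(1)], of t] that unfolding \<phi>(2) by (simp add: u_def)
  \<comment> \<open>The map commutes with its iterate, so \<open>\<Upsilon> u\<close> is another
    fixed point of the iterate; uniqueness gives \<open>\<Upsilon> u = u\<close> on the
    half-line.\<close>
  have "(\<Upsilon> ^^ n) (\<Upsilon> u) = \<Upsilon> ((\<Upsilon> ^^ n) u)"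
    by (metis funpow_swap1)
  also have "\<dots> = \<Upsilon> u" by (rule Upsilon_cong[OF fix_u])
  finally have "\<Upsilon> u t = u t" if "0 \<le> t" for t
    using fix_u that by (intro Upsilon_power_fixed_unique[OF aap_Upsilon[OF u] u]) auto
  then show ?thesis using that[OF u] by blast
qed

lemma Upsilon_fixed_unique:
  assumes u: "asymptotically_almost_periodic u" and v: "asymptotically_almost_periodic v"
    and fu: "\<And>t. 0 \<le> t \<Longrightarrow> \<Upsilon> u t = u t" and fv: "\<And>t. 0 \<le> t \<Longrightarrow> \<Upsilon> v t = v t"
    and t: "0 \<le> t"
  shows "u t = v t"
proof -
  have pow: "(\<Upsilon> ^^ j) w s = w s" if "\<And>t. 0 \<le> t \<Longrightarrow> \<Upsilon> w t = w t" "0 \<le> s" for w j s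
    using that(2)
  proof (induction j arbitrary: s)
    case (Suc j)
    have "\<Upsilon> ((\<Upsilon> ^^ j) w) = \<Upsilon> w" by (rule Upsilon_cong[OF Suc.IH])
    then show ?case using that(1) Suc.prems by simp
  qed simp
  show ?thesis
    by (rule Upsilon_power_fixed_unique[OF u v pow[OF fu] pow[OF fv] t])
qed

end

section \<open>Stepanov norms\<close>

lemma strongly_measurable_cong:
  assumes "\<And>x. x \<in> space M \<Longrightarrow> f x = g x"
  shows "strongly_measurable M f \<longleftrightarrow> strongly_measurable M g"
  unfolding strongly_measurable_def
  by (intro ex_cong1 conj_cong refl AE_cong) (simp add: assms)

lemma has_strong_bochner_integral_cong:
  assumes "\<And>x. x \<in> space M \<Longrightarrow> f x = g x"
  shows "has_strong_bochner_integral M f z \<longleftrightarrow> has_strong_bochner_integral M g z"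
proof -
  have "(\<integral>\<^sup>+x. ennreal (norm (f x - s i x)) \<partial>M) = (\<integral>\<^sup>+x. ennreal (norm (g x - s i x)) \<partial>M)" for s and i :: nat
    by (intro nn_integral_cong) (simp add: assms)
  moreover have "strongly_measurable M f \<longleftrightarrow> strongly_measurable M g"
    by (rule strongly_measurable_cong) (rule assms)
  ultimately show ?thesis
    unfolding has_strong_bochner_integral_def by (simp only:)
qed

definition ext0 :: "(real \<Rightarrow> 'a::real_normed_vector) \<Rightarrow> real \<Rightarrow> 'a" where
  "ext0 G s = (if 0 \<le> s then G s else 0)"

text \<open>Each translate is measurable on the unit interval; the pieces on
  \<open>[n, n + 1]\<close> are glued along the floor of \<open>s\<close>.\<close>

lemma strongly_measurable_ext0:
  assumes "\<And>a. 0 \<le> a \<Longrightarrow> in_Lp p (\<lambda>s. G (a + s))"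
  shows "strongly_measurable lebesgue (ext0 G)"
proof -
  have "strongly_measurable lebesgue (\<lambda>s. indicator {0..1} (s - real n) *\<^sub>R G s)" for n
  proof -
    have "strongly_measurable lebesgue (\<lambda>s. indicator {0..1} s *\<^sub>R G (real n + s))"
      using assms[of "real n"] by (simp add: in_Lp_def strongly_measurable_lebesgue_on)
    from strongly_measurable_translation[OF this, of "- real n"] show ?thesis by simp
  qed
  then have "strongly_measurable lebesgue (\<lambda>s. indicator {0..1} (s - real (nat \<lfloor>s\<rfloor>)) *\<^sub>R G s)"
    by (rule strongly_measurable_compose_countable[OF complete_measure_lebesgue]) measurable
  also have "(\<lambda>s. indicator {0..1} (s - real (nat \<lfloor>s\<rfloor>)) *\<^sub>R G s) = ext0 G"
  proof
    fix s
    show "indicator {0..1} (s - real (nat \<lfloor>s\<rfloor>)) *\<^sub>R G s = ext0 G s"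
    proof (cases "0 \<le> s")
      case True
      then have "s - real (nat \<lfloor>s\<rfloor>) = frac s" by (simp add: frac_def)
      then show ?thesis using True frac_lt_1[of s] by (simp add: ext0_def)
    qed (simp add: ext0_def)
  qed
  finally show ?thesis .
qed

text \<open>Translates the Stepanov norm into extended integrals. Powers are compared instead of
  norms, so that no root of an extended integral appears.\<close>

lemma ext0_window:
  assumes p: "p > 0" and G: "strongly_measurable lebesgue (ext0 G)" and a: "0 \<le> a"
    and Lp: "in_Lp p (\<lambda>s. G (a + s))"
  shows "window_integral p (\<lambda>s. norm (ext0 G s)) a = ennreal (Lp_norm p (\<lambda>s. G (a + s)) powr p)"
proof -
  have [measurable]: "(\<lambda>s. norm (ext0 G s)) \<in> borel_measurable lebesgue"
    by (rule strongly_measurable_norm[OF complete_measure_lebesgue G])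
  let ?I = "LINT s|lebesgue_on {0..1}. norm (G (a + s)) powr p"
  have "window_integral p (\<lambda>s. norm (ext0 G s)) a
      = (\<integral>\<^sup>+s. ennreal (norm (ext0 G (a + s)) powr p) * indicator {a..a+1} (a + s) \<partial>lebesgue)"
    by (rule nn_integral_lebesgue_translation[symmetric]) measurable
  also have "\<dots> = (\<integral>\<^sup>+s. ennreal (norm (G (a + s)) powr p) * indicator {0..1} s \<partial>lebesgue)"
    using a by (intro nn_integral_cong) (auto simp: ext0_def split: split_indicator)
  also have "\<dots> = (\<integral>\<^sup>+s. ennreal (norm (G (a + s)) powr p) \<partial>lebesgue_on {0..1})"
    by (subst nn_integral_restrict_space) auto
  also have "\<dots> = ennreal ?I"
    using Lp by (intro nn_integral_eq_integral) (auto simp: in_Lp_def)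
  also have "?I = (?I powr (1 / p)) powr p"
    using p by (simp add: powr_powr integral_nonneg_AE)
  finally show ?thesis by (simp add: Lp_norm_def)
qed

lemma in_Lp_diff:
  assumes p: "p > 0" and F: "in_Lp p F" and G: "in_Lp p G"
  shows "in_Lp p (\<lambda>s. F s - G s)"
  unfolding in_Lp_def
proof (intro conjI)
  show sm: "strongly_measurable (lebesgue_on {0..1}) (\<lambda>s. F s - G s)"
    using F G by (auto simp: in_Lp_def intro: strongly_measurable_diff)
  have [measurable]: "(\<lambda>s. norm (F s - G s)) \<in> borel_measurable (lebesgue_on {0..1})"
    by (rule strongly_measurable_norm[OF complete_measure_lebesgue_on sm]) simp
  show "integrable (lebesgue_on {0..1}) (\<lambda>s. norm (F s - G s) powr p)"
  proof (rule Bochner_Integration.integrable_bound)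
    show "integrable (lebesgue_on {0..1}) (\<lambda>s. 2 powr p * (norm (F s) powr p + norm (G s) powr p))"
      using F G by (auto simp: in_Lp_def)
    have "norm (F s - G s) powr p \<le> 2 powr p * (norm (F s) powr p + norm (G s) powr p)" for s
    proof -
      have "norm (F s - G s) \<le> 2 * max (norm (F s)) (norm (G s))"
        using norm_triangle_ineq4[of "F s" "G s"] by linarith
      then have "norm (F s - G s) powr p \<le> (2 * max (norm (F s)) (norm (G s))) powr p"
        using p by (intro powr_mono2) auto
      also have "\<dots> = 2 powr p * max (norm (F s)) (norm (G s)) powr p"
        by (rule powr_mult)
      also have "max (norm (F s)) (norm (G s)) powr p \<le> norm (F s) powr p + norm (G s) powr p"
        by (simp add: max_def)
      finally show ?thesis by simp
    qed
    then show "AE s in lebesgue_on {0..1}. norm (norm (F s - G s) powr p) \<le> norm (2 powr p * (norm (F s) powr p + norm (G s) powr p))"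
      by (simp add: abs_of_nonneg)
  qed measurable
qed

lemma nn_integral_windows_finite:
  fixes \<phi> :: "real \<Rightarrow> ennreal"
  assumes [measurable]: "\<phi> \<in> borel_measurable lebesgue"
    and win: "\<And>a. 0 \<le> a \<Longrightarrow> (\<integral>\<^sup>+s\<in>{a..a+1}. \<phi> s \<partial>lebesgue) < \<infinity>"
  shows "(\<integral>\<^sup>+s\<in>{0..b}. \<phi> s \<partial>lebesgue) < \<infinity>"
proof -
  have n: "(\<integral>\<^sup>+s\<in>{0..<real n}. \<phi> s \<partial>lebesgue) < \<infinity>" for n
  proof (induction n)
    case (Suc n)
    have "(\<integral>\<^sup>+s\<in>{0..<real (Suc n)}. \<phi> s \<partial>lebesgue)
        \<le> (\<integral>\<^sup>+s. \<phi> s * indicator {0..<real n} s + \<phi> s * indicator {real n..real n + 1} s \<partial>lebesgue)"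
      by (intro nn_integral_mono) (auto split: split_indicator)
    also have "\<dots> = (\<integral>\<^sup>+s\<in>{0..<real n}. \<phi> s \<partial>lebesgue) + (\<integral>\<^sup>+s\<in>{real n..real n + 1}. \<phi> s \<partial>lebesgue)"
      by (rule nn_integral_add) measurable
    also have "\<dots> < \<infinity>" using Suc win[of "real n"] by simp
    finally show ?case .
  qed simp
  obtain m :: nat where "b < real m" using reals_Archimedean2 by blast
  then have "(\<integral>\<^sup>+s\<in>{0..b}. \<phi> s \<partial>lebesgue) \<le> (\<integral>\<^sup>+s\<in>{0..<real m}. \<phi> s \<partial>lebesgue)"
    by (intro nn_integral_mono) (auto split: split_indicator)
  with n[of m] show ?thesis by (rule le_less_trans[rotated])
qed

section \<open>From Stepanov windows to convolution bounds\<close>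

context weakly_singular_kernel_Lq
begin

lemma kconv_bounded_of_windows:
  assumes p: "q \<le> p" and \<phi>: "\<phi> \<in> borel_measurable lebesgue" "\<And>s. 0 \<le> \<phi> s"
    and B: "0 \<le> B"
    and win: "\<And>a. 0 \<le> a \<Longrightarrow> window_integral p \<phi> a \<le> ennreal (B powr p)"
  obtains K where "0 \<le> K" "\<And>t. kconv (\<lambda>s. ennreal (\<phi> s)) t \<le> ennreal K"
proof -
  note C = window_const_pos and kconvC = kconv_le_of_windows
  \<comment> \<open>The window bound wants a positive size, whereas \<open>B\<close> may be
    \<open>0\<close>.\<close>
  have "kconv (\<lambda>s. ennreal (\<phi> s)) t \<le> ennreal (window_const * (B + 1))" for t
  proof (rule kconvC[OF p \<phi>])
    fix a :: real assume "0 \<le> a"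
    note win[OF this]
    also have "B powr p \<le> (B + 1) powr p" using B p q_ge_1 by (intro powr_mono2) auto
    finally show "window_integral p \<phi> a \<le> ennreal ((B + 1) powr p)"
      by (simp add: ennreal_leI)
  qed (use B in simp)
  then show ?thesis using that[of "window_const * (B + 1)"] C B by simp
qed

text \<open>The convolution is split at a time after which all windows are small: the later part is
  small by the window bound, the earlier part is forgotten exponentially, provided the whole
  convolution is bounded. That bound is the first conclusion.\<close>

lemma kconv_vanishes_of_windows:
  assumes p: "q \<le> p" and \<phi>[measurable]: "\<phi> \<in> borel_measurable lebesgue" and \<phi>0: "\<And>s. 0 \<le> \<phi> s"
    and fin: "\<And>a. 0 \<le> a \<Longrightarrow> window_integral p \<phi> a < \<infinity>"
    and win: "\<And>\<epsilon>. \<epsilon> > 0 \<Longrightarrow> \<exists>m. \<forall>a\<ge>m. window_integral p \<phi> a \<le> ennreal (\<epsilon> powr p)"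
  shows "\<exists>K\<ge>0. \<forall>t. kconv (\<lambda>s. ennreal (\<phi> s)) t \<le> ennreal K"
    and "\<epsilon> > 0 \<Longrightarrow> \<exists>m. \<forall>t\<ge>m. kconv (\<lambda>s. ennreal (\<phi> s)) t \<le> ennreal \<epsilon>"
proof -
  have p0: "p > 0" using p q_ge_1 by simp
  obtain m1 where m1: "\<And>a. a \<ge> m1 \<Longrightarrow> window_integral p \<phi> a \<le> ennreal (1 powr p)"
    using win[of 1] by auto
  \<comment> \<open>Windows starting after \<open>m1\<close> have mass at most \<open>1\<close>; the
    others lie inside \<open>[0, m1 + 1]\<close>, whose mass is \<open>I\<close>. So
    \<open>I + 1\<close> serves for all.\<close>
  obtain I where I: "0 \<le> I" "(\<integral>\<^sup>+s\<in>{0..m1 + 1}. ennreal (\<phi> s powr p) \<partial>lebesgue) = ennreal I"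
    using nn_integral_windows_finite[OF _ fin, of "m1 + 1"] by (auto simp: less_top_ennreal)
  have "window_integral p \<phi> a \<le> ennreal (((I + 1) powr (1 / p)) powr p)" if "0 \<le> a" for a
  proof -
    have "window_integral p \<phi> a \<le> ennreal (I + 1)"
    proof (cases "a \<ge> m1")
      case True
      have "ennreal (1 powr p) \<le> ennreal (I + 1)" using I(1) by (intro ennreal_leI) simp
      with m1[OF True] show ?thesis by (rule order_trans)
    next
      case False
      have "window_integral p \<phi> a \<le> (\<integral>\<^sup>+s\<in>{0..m1 + 1}. ennreal (\<phi> s powr p) \<partial>lebesgue)"
        using that False by (intro nn_integral_mono) (auto split: split_indicator)
      also have "\<dots> \<le> ennreal (I + 1)" unfolding I(2) by (intro ennreal_leI) simp
      finally show ?thesis .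
    qed
    then show ?thesis using p0 I(1) by (simp add: powr_powr)
  qed
  then obtain K where K: "0 \<le> K" "\<And>t. kconv (\<lambda>s. ennreal (\<phi> s)) t \<le> ennreal K"
    by (rule kconv_bounded_of_windows[OF p \<phi> \<phi>0 powr_ge_zero]) (assumption, rule that)
  then show "\<exists>K\<ge>0. \<forall>t. kconv (\<lambda>s. ennreal (\<phi> s)) t \<le> ennreal K" by blast
  assume \<epsilon>: "\<epsilon> > 0"
  note C = window_const_pos and kconvC = kconv_le_of_windows
  let ?\<eta> = "\<epsilon> / (2 * window_const)"
  have \<eta>: "?\<eta> > 0" using \<epsilon> C by simp
  obtain m2 where m2: "\<And>a. a \<ge> m2 \<Longrightarrow> window_integral p \<phi> a \<le> ennreal (?\<eta> powr p)"
    using win[OF \<eta>] by blast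
  obtain m3 where m3: "\<And>t. t \<ge> m3 \<Longrightarrow> exp (- c * (t - m2)) * K \<le> \<epsilon> / 2"
    using exp_decay_le[OF K(1) half_gt_zero[OF \<epsilon>]] by blast
  \<comment> \<open>Cut off at \<open>m2\<close>, a window starting earlier sees only part of the
    window starting at \<open>m2\<close>, so every window is small.\<close>
  define \<psi> where "\<psi> s = \<phi> s * indicator {m2..} s" for s
  have [measurable]: "\<psi> \<in> borel_measurable lebesgue" unfolding \<psi>_def[abs_def] by measurable
  have \<psi>: "kconv (\<lambda>s. ennreal (\<psi> s)) t \<le> ennreal (\<epsilon> / 2)" for t
  proof -
    have "kconv (\<lambda>s. ennreal (\<psi> s)) t \<le> ennreal (window_const * ?\<eta>)"
    proof (rule kconvC[OF p _ _ \<eta>])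
      show "0 \<le> \<psi> s" for s using \<phi>0 by (simp add: \<psi>_def)
      fix a :: real
      have "window_integral p \<psi> a \<le> window_integral p \<phi> (max a m2)"
        by (intro nn_integral_mono) (auto simp: \<psi>_def split: split_indicator)
      also have "\<dots> \<le> ennreal (?\<eta> powr p)" by (rule m2) simp
      finally show "window_integral p \<psi> a \<le> ennreal (?\<eta> powr p)" .
    qed measurable
    then show ?thesis using C by simp
  qed
  have "kconv (\<lambda>s. ennreal (\<phi> s)) t \<le> ennreal \<epsilon>" if t: "t \<ge> max m2 m3" for t
  proof -
    have "kconv (\<lambda>s. ennreal (\<phi> s)) t \<le> kconv (\<lambda>s. ennreal (\<phi> s) * indicator {..<m2} s + ennreal (\<psi> s)) t"
      by (rule kconv_mono) (auto simp: \<psi>_def split: split_indicator)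
    also have "\<dots> = kconv (\<lambda>s. ennreal (\<phi> s) * indicator {..<m2} s) t + kconv (\<lambda>s. ennreal (\<psi> s)) t"
      by (rule kconv_add) measurable
    also have "kconv (\<lambda>s. ennreal (\<phi> s) * indicator {..<m2} s) t \<le> ennreal (exp (- c * (t - m2))) * kconv (\<lambda>s. ennreal (\<phi> s)) m2"
      using t by (intro kconv_decay) auto
    also have "\<dots> \<le> ennreal (exp (- c * (t - m2))) * ennreal K"
      by (intro mult_left_mono K) auto
    also have "\<dots> \<le> ennreal (\<epsilon> / 2)"
      using m3[of t] t K(1) by (auto simp flip: ennreal_mult intro!: ennreal_leI)
    also have "ennreal (\<epsilon> / 2) + kconv (\<lambda>s. ennreal (\<psi> s)) t \<le> ennreal (\<epsilon> / 2) + ennreal (\<epsilon> / 2)"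
      by (intro add_left_mono \<psi>)
    also have "\<dots> = ennreal \<epsilon>" using \<epsilon> by (simp flip: ennreal_plus)
    finally show ?thesis by (simp add: add_right_mono)
  qed
  then show "\<exists>m. \<forall>t\<ge>m. kconv (\<lambda>s. ennreal (\<phi> s)) t \<le> ennreal \<epsilon>" by blast
qed

end

lemma Lr_S_windows_bounded:
  assumes r: "r > 0" and L: "Lr_S r L"
  obtains B where "0 \<le> B"
    "\<And>a. 0 \<le> a \<Longrightarrow> window_integral r (\<lambda>s. \<bar>L s\<bar>) a \<le> ennreal (B powr r)"
proof -
  let ?I = "\<lambda>t. LINT s|lebesgue_on {t..t + 1}. \<bar>L s\<bar> powr r"
  obtain B where B: "\<And>t. 0 \<le> t \<Longrightarrow> ?I t powr (1 / r) \<le> B"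
    using L unfolding Lr_S_def bdd_above_def by auto
  show ?thesis
  proof (rule that)
    show "0 \<le> B" using order_trans[OF powr_ge_zero B[of 0]] by simp
    fix a :: real assume a: "0 \<le> a"
    have I0: "0 \<le> ?I a" by (rule integral_nonneg_AE) simp
    have "window_integral r (\<lambda>s. \<bar>L s\<bar>) a = (\<integral>\<^sup>+s. ennreal (\<bar>L s\<bar> powr r) \<partial>lebesgue_on {a..a+1})"
      by (subst nn_integral_restrict_space) auto
    also have "\<dots> = ennreal (?I a)"
      using L a by (intro nn_integral_eq_integral) (auto simp: Lr_S_def)
    also have "?I a = (?I a powr (1 / r)) powr r" using r I0 by (simp add: powr_powr)
    also have "ennreal \<dots> \<le> ennreal (B powr r)"
      using B[OF a] r by (intro ennreal_leI powr_mono2) auto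
    finally show "window_integral r (\<lambda>s. \<bar>L s\<bar>) a \<le> ennreal (B powr r)" .
  qed
qed

text \<open>\<open>q\<close> is the Hoelder exponent with \<open>1 / q = 1 / p + 1 / r\<close>. It
  equals \<open>1\<close> exactly when \<open>p\<close> and \<open>r\<close> are conjugate, and
  otherwise its conjugate exponent is \<open>p * r / (p * r - p - r)\<close>, the quantity compared
  with \<open>1 / (1 - \<beta>)\<close>.\<close>

lemma exponent_conditions:
  fixes p q r \<beta> :: real
  assumes p: "p > 1" and r: "r \<ge> max p (p / (p - 1))" and \<beta>: "0 < \<beta>" "\<beta> \<le> 1"
    and q: "q = p * r / (p + r)"
    and eq: "r = p / (p - 1) \<longrightarrow> \<beta> = 1"
    and gt: "r > p / (p - 1) \<longrightarrow>
      ereal (p * r / (p * r - p - r)) < (if \<beta> = 1 then \<infinity> else ereal (1 / (1 - \<beta>)))"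
  shows "(q = 1 \<and> \<beta> = 1) \<or> (q > 1 \<and> q / (q - 1) * (1 - \<beta>) < 1)" and "q \<le> p" and "q \<le> r"
proof -
  have r1: "r > 1" "r \<ge> p / (p - 1)" using p r by auto
  show "q \<le> p" "q \<le> r" unfolding q using p r1 by (simp_all add: field_simps)
  show "(q = 1 \<and> \<beta> = 1) \<or> (q > 1 \<and> q / (q - 1) * (1 - \<beta>) < 1)"
  proof (cases "r = p / (p - 1)")
    case True
    have pr: "p * r = p + r" unfolding True using p by (simp add: field_simps)
    have "q = 1" unfolding q pr using p r1(1) by simp
    then show ?thesis using eq True by simp
  next
    case False
    then have r2: "r > p / (p - 1)" using r1 by simp
    then have D: "p * r - p - r > 0" using p by (simp add: field_simps)
    have q1: "q > 1" unfolding q using D p r1 by (simp add: field_simps)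
    have "q - 1 = (p * r - p - r) / (p + r)" unfolding q using p r1 by (simp add: field_simps)
    then have conj: "q / (q - 1) = p * r / (p * r - p - r)" unfolding q using p r1 by simp
    have "q / (q - 1) * (1 - \<beta>) < 1"
    proof (cases "\<beta> = 1")
      case b: False
      then have "p * r / (p * r - p - r) < 1 / (1 - \<beta>)" using gt r2 by simp
      then have "q / (q - 1) < 1 / (1 - \<beta>)" unfolding conj .
      then show ?thesis using b \<beta> by (simp add: less_divide_eq)
    qed simp
    then show ?thesis using q1 by simp
  qed
qed

section \<open>Stepanov data turned into convolution bounds, mild solutions into fixed
  points\<close>

theorem theorem2p10:
  fixes A :: "'a::complex_banach \<Rightarrow> 'a set"
    and c \<beta> M p q r :: real
    and u\<^sub>0 :: 'a
    and T :: "real \<Rightarrow> 'a \<Rightarrow>\<^sub>L 'a"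
    and f g h :: "real \<Rightarrow> 'a \<Rightarrow> 'a"
    and L\<^sub>g L\<^sub>f :: "real \<Rightarrow> real"
  assumes "mlo A"
    and "condition_P A c \<beta>"
    and T_def: "T = degenerate_semigroup A c"
    and "M > 0"
    and "\<forall>t>0. norm (T t) \<le> M * exp (- c * t) * t powr (\<beta> - 1)"
    and "point_of_continuity T u\<^sub>0"
    and "p > 1" and "APS p g"
    and "r \<ge> max p (p / (p - 1))" and "Lr_S r L\<^sub>g"
    and "\<forall>t\<ge>0. \<forall>x y. norm (g t x - g t y) \<le> L\<^sub>g t * norm (x - y)"
    and "\<forall>t\<ge>0. \<forall>x. f t x = g t x + h t x"
    and q_def: "q = p * r / (p + r)" and "C0_Lp q (bochner_transform h)"
    and "r = p / (p - 1) \<longrightarrow> \<beta> = 1"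
    and "r > p / (p - 1) \<longrightarrow>
      ereal (p * r / (p * r - p - r)) < (if \<beta> = 1 then \<infinity> else ereal (1 / (1 - \<beta>)))"
    and "\<forall>t\<ge>0. L\<^sub>f t > 0"
    and "\<forall>b\<ge>0. bdd_above (L\<^sub>f ` {0..b})"
    and "L\<^sub>f \<in> borel_measurable (lebesgue_on {0..})"
    and "AE t in lebesgue. t > 0 \<longrightarrow> (\<forall>x y. norm (f t x - f t y) \<le> L\<^sub>f t * norm (x - y))"
    and "\<exists>n\<ge>1. M_const c \<beta> M L\<^sub>f n < 1"
  shows "\<exists>u. mild_solution T f u\<^sub>0 u \<and> asymptotically_almost_periodic u \<and>
           (\<forall>v. mild_solution T f u\<^sub>0 v \<and> asymptotically_almost_periodic v \<longrightarrow> (\<forall>t\<ge>0. v t = u t))"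
proof -
  note P = assms(2) and p = assms(7) and APS = assms(8) and C0 = assms(14)
  have \<beta>: "0 < \<beta>" "\<beta> \<le> 1" and c: "c > 0" using P by (auto simp: condition_P_def)
  note exps = exponent_conditions[OF p assms(9) \<beta> q_def assms(15,16)]
  interpret weakly_singular_kernel_Lq M c \<beta> q
    by standard (use \<beta> c assms(4) exps(1) in auto)
  have r: "r > 0" "q \<le> r" using p assms(9) exps(3) by auto
  \<comment> \<open>Extension by zero puts all data on the whole line, as the convolution lemmas
    require; the absolute value in \<open>lg\<close> secures the sign demanded there.\<close>
  define f' where "f' s x = ext0 (\<lambda>s. f s x) s" for s x
  define g' where "g' s x = ext0 (\<lambda>s. g s x) s" for s x
  define h' where "h' s x = ext0 (\<lambda>s. h s x) s" for s x
  define lf where "lf s = ext0 L\<^sub>f s" for s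
  define lg where "lg s = ext0 (\<lambda>s. \<bar>L\<^sub>g s\<bar>) s" for s

  have g_Lp: "in_Lp p (\<lambda>s. g (a + s) x)" if "0 \<le> a" for a x
    using APS that by (simp add: APS_def Lp_continuous_def bochner_transform_def)
  have h_Lp: "in_Lp q (\<lambda>s. h (a + s) x)" if "0 \<le> a" for a x
    using C0 that by (simp add: C0_Lp_def Lp_continuous_def bochner_transform_def)
  have g_sm: "strongly_measurable lebesgue (\<lambda>s. g' s x)" for x
    unfolding g'_def by (rule strongly_measurable_ext0[OF g_Lp])
  have h_sm: "strongly_measurable lebesgue (\<lambda>s. h' s x)" for x
    unfolding h'_def by (rule strongly_measurable_ext0[OF h_Lp])
  have ng[measurable]: "(\<lambda>s. norm (g' s x)) \<in> borel_measurable lebesgue"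
    and nh[measurable]: "(\<lambda>s. norm (h' s x)) \<in> borel_measurable lebesgue" for x
    by (intro strongly_measurable_norm complete_measure_lebesgue g_sm h_sm)+
  have g_win: "window_integral p (\<lambda>s. norm (g' s x)) a = ennreal (Lp_norm p (bochner_transform g a x) powr p)" if "0 \<le> a" for a x
    unfolding g'_def bochner_transform_def using p g_sm[of x] that g_Lp[OF that] by (intro ext0_window) (auto simp: g'_def)
  have h_win: "window_integral q (\<lambda>s. norm (h' s x)) a = ennreal (Lp_norm q (bochner_transform h a x) powr q)" if "0 \<le> a" for a x
    unfolding h'_def bochner_transform_def using q_ge_1 h_sm[of x] that h_Lp[OF that] by (intro ext0_window) (auto simp: h'_def)

  have lf_meas: "lf \<in> borel_measurable lebesgue"
  proof -
    have "(\<lambda>s. indicator {0..} s *\<^sub>R L\<^sub>f s) \<in> borel_measurable lebesgue"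
      using assms(19) by (subst (asm) borel_measurable_restrict_space_iff) auto
    also have "(\<lambda>s. indicator {0..} s *\<^sub>R L\<^sub>f s) = lf" by (auto simp: lf_def ext0_def split: split_indicator)
    finally show ?thesis .
  qed
  have lg_meas: "lg \<in> borel_measurable lebesgue"
  proof -
    have "L\<^sub>g \<in> borel_measurable (lebesgue_on {0..})" using assms(10) by (simp add: Lr_S_def)
    then have "(\<lambda>s. indicator {0..} s *\<^sub>R L\<^sub>g s) \<in> borel_measurable lebesgue"
      by (subst (asm) borel_measurable_restrict_space_iff) auto
    then have "(\<lambda>s. \<bar>indicator {0..} s *\<^sub>R L\<^sub>g s\<bar>) \<in> borel_measurable lebesgue" by measurable
    also have "(\<lambda>s. \<bar>indicator {0..} s *\<^sub>R L\<^sub>g s\<bar>) = lg" by (auto simp: lg_def ext0_def split: split_indicator)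
    finally show ?thesis .
  qed
  have lf0: "0 \<le> lf s" for s using assms(17) by (auto simp: lf_def ext0_def less_imp_le)
  have lg0: "0 \<le> lg s" for s by (simp add: lg_def ext0_def)
  have lf_bdd: "\<exists>B\<ge>0. \<forall>s\<le>b. lf s \<le> B" for b
  proof -
    have "bdd_above (L\<^sub>f ` {0..max b 0})" using assms(18) by simp
    then obtain B where "\<And>y. y \<in> L\<^sub>f ` {0..max b 0} \<Longrightarrow> y \<le> B"
      unfolding bdd_above_def by blast
    then show ?thesis by (intro exI[of _ "max B 0"]) (auto simp: lf_def ext0_def le_max_iff_disj)
  qed
  \<comment> \<open>Local boundedness gives finiteness for each single \<open>t\<close>, with a
    bound that depends on \<open>t\<close>.\<close>
  have lf_fin: "kconv (\<lambda>s. ennreal (lf s)) t < \<infinity>" for t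
  proof -
    obtain B where B: "0 \<le> B" "\<And>s. s \<le> t \<Longrightarrow> lf s \<le> B" using lf_bdd by blast
    have "kconv (\<lambda>s. ennreal (lf s)) t \<le> (\<integral>\<^sup>+s. ennreal B * (ennreal (k (t - s)) * indicator {t - (\<bar>t\<bar> + 1)<..} s) \<partial>lebesgue)"
      unfolding kconv_def
    proof (rule nn_integral_mono)
      fix s
      show "ennreal (k (t - s)) * ennreal (lf s) * indicator {0..} s \<le> ennreal B * (ennreal (k (t - s)) * indicator {t - (\<bar>t\<bar> + 1)<..} s)"
      proof (cases "0 \<le> s \<and> s \<le> t")
        case True
        then show ?thesis using B(2)[of s] by (simp add: mult.commute[of "ennreal B"] mult_left_mono ennreal_leI)
      next
        case False
        then show ?thesis by (auto simp: k_def)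
      qed
    qed
    also have "\<dots> = ennreal B * (\<integral>\<^sup>+s. ennreal (k (t - s)) * indicator {t - (\<bar>t\<bar> + 1)<..} s \<partial>lebesgue)"
      by (rule nn_integral_cmult) measurable
    also have "\<dots> \<le> ennreal B * ennreal (M * (\<bar>t\<bar> + 1) powr \<beta> / \<beta>)"
      by (intro mult_left_mono nn_integral_k_le) auto
    also have "\<dots> < \<infinity>" by (simp add: ennreal_mult_less_top)
    finally show ?thesis .
  qed
  obtain n where n: "n \<ge> 1" "M_const c \<beta> M L\<^sub>f n < 1" using assms(21) by blast
  obtain \<theta> where \<theta>: "0 \<le> \<theta>" "\<theta> < 1" "M_const c \<beta> M L\<^sub>f n = ennreal \<theta>"
    using n(2) by (cases "M_const c \<beta> M L\<^sub>f n") (auto simp: ennreal_less_one_iff)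
  have iter_kernel: "iter_kernel lf n t \<le> ennreal \<theta>" for t
    unfolding \<theta>(3)[symmetric] using n(1) lf_meas lf0 by (intro iter_kernel_le_M_const) (auto simp: lf_def ext0_def)

  \<comment> \<open>Here \<open>M_const c \<beta> M L\<^sub>f n < 1\<close> is used a second time,
    to make the convolution of the Lipschitz function bounded uniformly in \<open>t\<close>.\<close>
  have "\<exists>K\<ge>0. \<forall>t. kconv (\<lambda>s. ennreal (lf s)) t \<le> ennreal K"
  proof -
    have Bn1: "iter_kernel lf n t \<le> 1" for t
      using order_trans[OF iter_kernel ennreal_leI[of \<theta> 1]] \<theta>(2) by simp
    have "lf s = 0" if "s < 0" for s using that by (simp add: lf_def ext0_def)
    then have "kconv (\<lambda>s. ennreal (lf s)) t \<le> ennreal (max 1 (1 / power_const n))" for t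
      by (rule kconv_bounded_of_iter_kernel[OF lf_meas lf0 _ lf_fin n(1) Bn1])
    then show ?thesis by (intro exI[of _ "max 1 (1 / power_const n)"]) auto
  qed
  then obtain K1 where K1: "0 \<le> K1" "\<And>t. kconv (\<lambda>s. ennreal (lf s)) t \<le> ennreal K1" by blast
  obtain K2 where K2: "0 \<le> K2" "\<And>t. kconv (\<lambda>s. ennreal (lg s)) t \<le> ennreal K2"
  proof -
    obtain B where B: "0 \<le> B" "\<And>a. 0 \<le> a \<Longrightarrow> window_integral r (\<lambda>s. \<bar>L\<^sub>g s\<bar>) a \<le> ennreal (B powr r)"
      using Lr_S_windows_bounded[OF r(1) assms(10)] by blast
    have "window_integral r lg a \<le> ennreal (B powr r)" if "0 \<le> a" for a
    proof -
      have "window_integral r lg a = window_integral r (\<lambda>s. \<bar>L\<^sub>g s\<bar>) a"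
        using that by (intro nn_integral_cong) (auto simp: lg_def ext0_def split: split_indicator)
      then show ?thesis using B(2)[OF that] by simp
    qed
    from kconv_bounded_of_windows[OF r(2) lg_meas lg0 B(1) this] show ?thesis using that by blast
  qed
  obtain K3 where K3: "0 \<le> K3" "\<And>t. kconv (\<lambda>s. ennreal (norm (g' s 0))) t \<le> ennreal K3"
  proof -
    obtain B where B: "\<And>t x. 0 \<le> t \<Longrightarrow> Lp_norm p (bochner_transform g t x) \<le> B"
    proof -
      have "\<exists>B. \<forall>t\<ge>0. \<forall>x. Lp_norm p (bochner_transform g t x) \<le> B"
        using APS unfolding APS_def by (elim conjE)
      then show ?thesis using that by blast
    qed
    have B0: "0 \<le> max B 0" by simp
    have "window_integral p (\<lambda>s. norm (g' s 0)) a \<le> ennreal (max B 0 powr p)" if "0 \<le> a" for a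
      unfolding g_win[OF that] using B[OF that] p
      by (intro ennreal_leI powr_mono2) (auto simp: Lp_norm_def le_max_iff_disj)
    from kconv_bounded_of_windows[OF exps(2) ng norm_ge_zero B0 this] show ?thesis using that by blast
  qed
  have h_small: "\<exists>m. \<forall>a\<ge>m. window_integral q (\<lambda>s. norm (h' s x)) a \<le> ennreal (\<epsilon> powr q)"
    if \<epsilon>: "\<epsilon> > 0" for \<epsilon> x
  proof -
    have "uniform_limit {x} (\<lambda>t x. Lp_norm q (bochner_transform h t x)) (\<lambda>x. 0) at_top"
      using C0 compact_sing[of x] unfolding C0_Lp_def by blast
    from uniform_limitD[OF this \<epsilon>]
    have "\<forall>\<^sub>F t in at_top. \<bar>Lp_norm q (bochner_transform h t x)\<bar> < \<epsilon>" by simp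
    then obtain m where m: "\<And>t. t \<ge> m \<Longrightarrow> \<bar>Lp_norm q (bochner_transform h t x)\<bar> < \<epsilon>"
      by (auto simp: eventually_at_top_linorder)
    have "window_integral q (\<lambda>s. norm (h' s x)) a \<le> ennreal (\<epsilon> powr q)" if "a \<ge> max m 0" for a
    proof -
      have a: "0 \<le> a" "m \<le> a" using that by auto
      show ?thesis
        unfolding h_win[OF a(1)] using m[OF a(2)] q_ge_1
        by (intro ennreal_leI powr_mono2) (auto simp: Lp_norm_def)
    qed
    then show ?thesis by blast
  qed
  have h_fin: "window_integral q (\<lambda>s. norm (h' s x)) a < \<infinity>" if "0 \<le> a" for a x
    unfolding h_win[OF that] by simp
  note h_kconv = kconv_vanishes_of_windows[OF order_refl nh norm_ge_zero h_fin h_small]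
  obtain K4 where K4: "0 \<le> K4" "\<And>t. kconv (\<lambda>s. ennreal (norm (h' s 0))) t \<le> ennreal K4"
    using h_kconv(1)[of 0] by blast
  define K where "K = max (max K1 K2) (max K3 K4)"
  have K: "K1 \<le> K" "K2 \<le> K" "K3 \<le> K" "K4 \<le> K" by (auto simp: K_def)

  \<comment> \<open>A finite set is compact, so Stepanov almost periods up to
    \<open>\<epsilon> / window_const\<close> exist for all its points at once; the window bound
    restores \<open>\<epsilon>\<close>.\<close>
  have g_ap: "\<exists>l>0. \<forall>a\<ge>0. \<exists>\<tau>\<in>{a..a + l}. \<forall>x\<in>X. \<forall>t. kconv (\<lambda>s. ennreal (norm (g' (s + \<tau>) x - g' s x))) t \<le> ennreal \<epsilon>"
    if X: "finite X" and \<epsilon>: "\<epsilon> > 0" for X \<epsilon>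
  proof -
    note C = window_const_pos and kconvC = kconv_le_of_windows
    have \<eta>: "\<epsilon> / window_const > 0" using \<epsilon> C by simp
    obtain l where l: "l > 0" "\<And>a. 0 \<le> a \<Longrightarrow> \<exists>\<tau>\<in>{a..a + l}. \<forall>t\<ge>0. \<forall>x\<in>X.
           Lp_norm p (\<lambda>s. bochner_transform g (t + \<tau>) x s - bochner_transform g t x s) \<le> \<epsilon> / window_const"
    proof -
      have "\<forall>\<epsilon>>0. \<forall>K. compact K \<longrightarrow> (\<exists>l>0. \<forall>a\<ge>0. \<exists>\<tau>\<in>{a..a + l}. \<forall>t\<ge>0. \<forall>x\<in>K.
          Lp_norm p (\<lambda>s. bochner_transform g (t + \<tau>) x s - bochner_transform g t x s) \<le> \<epsilon>)"
        using APS unfolding APS_def by (elim conjE)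
      from this[rule_format, OF \<eta> finite_imp_compact[OF X]] show ?thesis using that by blast
    qed
    have "\<exists>\<tau>\<in>{a..a + l}. \<forall>x\<in>X. \<forall>t. kconv (\<lambda>s. ennreal (norm (g' (s + \<tau>) x - g' s x))) t \<le> ennreal \<epsilon>" if a: "0 \<le> a" for a
    proof -
      obtain \<tau> where \<tau>: "\<tau> \<in> {a..a + l}" "\<And>t x. 0 \<le> t \<Longrightarrow> x \<in> X \<Longrightarrow>
           Lp_norm p (\<lambda>s. bochner_transform g (t + \<tau>) x s - bochner_transform g t x s) \<le> \<epsilon> / window_const"
        using l(2)[OF a] by blast
      have \<tau>0: "0 \<le> \<tau>" using \<tau>(1) a by auto
      have "kconv (\<lambda>s. ennreal (norm (g' (s + \<tau>) x - g' s x))) t \<le> ennreal \<epsilon>" if x: "x \<in> X" for x t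
      proof -
        let ?G = "\<lambda>s. g (s + \<tau>) x - g s x"
        have G_Lp: "in_Lp p (\<lambda>s. ?G (b + s))" if "0 \<le> b" for b
          using in_Lp_diff[OF _ g_Lp[of "b + \<tau>" x] g_Lp[of b x]] p that \<tau>0 by (simp add: add_ac)
        have G_sm: "strongly_measurable lebesgue (ext0 ?G)" by (rule strongly_measurable_ext0[OF G_Lp])
        have "kconv (\<lambda>s. ennreal (norm (ext0 ?G s))) t \<le> ennreal (window_const * (\<epsilon> / window_const))"
        proof (rule kconvC[OF exps(2) _ _ \<eta>])
          show "(\<lambda>s. norm (ext0 ?G s)) \<in> borel_measurable lebesgue"
            by (intro strongly_measurable_norm complete_measure_lebesgue G_sm)
          fix b :: real assume b: "0 \<le> b"
          have "Lp_norm p (\<lambda>s. ?G (b + s)) \<le> \<epsilon> / window_const"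
            using \<tau>(2)[OF b x] by (simp add: bochner_transform_def add_ac)
          then have "ennreal (Lp_norm p (\<lambda>s. ?G (b + s)) powr p) \<le> ennreal ((\<epsilon> / window_const) powr p)"
            using p by (intro ennreal_leI powr_mono2) (auto simp: Lp_norm_def)
          then show "window_integral p (\<lambda>s. norm (ext0 ?G s)) b \<le> ennreal ((\<epsilon> / window_const) powr p)"
            using ext0_window[OF _ G_sm b G_Lp[OF b]] p by simp
        qed simp
        moreover have "kconv (\<lambda>s. ennreal (norm (g' (s + \<tau>) x - g' s x))) t \<le> kconv (\<lambda>s. ennreal (norm (ext0 ?G s))) t"
          by (rule kconv_mono) (use \<tau>0 in \<open>simp add: g'_def ext0_def\<close>)
        ultimately show ?thesis using C by (auto intro: order_trans)
      qed
      then show ?thesis using \<tau>(1) by blast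
    qed
    then show ?thesis using l(1) by blast
  qed

  interpret semilinear_cauchy M c \<beta> T f' g' h' lf lg K u\<^sub>0 n \<theta>
  proof
    show "continuous_on {0<..} T" unfolding T_def by (rule degenerate_semigroup_continuous[OF P])
    show "norm (T t) \<le> k t" if "t > 0" for t using assms(5) that by (simp add: k_def)
    show "f' s x = 0" if "s < 0" for s x using that by (simp add: f'_def ext0_def)
    show "h' s x = 0" if "s < 0" for s x using that by (simp add: h'_def ext0_def)
    show "f' s x = g' s x + h' s x" for s x
      using assms(12) by (simp add: f'_def g'_def h'_def ext0_def)
    show "norm (g' s x - g' s y) \<le> lg s * norm (x - y)" for s x y
    proof (cases "0 \<le> s")
      case True
      then have "norm (g s x - g s y) \<le> L\<^sub>g s * norm (x - y)" using assms(11) by blast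
      also have "\<dots> \<le> \<bar>L\<^sub>g s\<bar> * norm (x - y)" by (intro mult_right_mono) auto
      finally show ?thesis using True by (simp add: g'_def lg_def ext0_def)
    qed (simp add: g'_def lg_def ext0_def)
    \<comment> \<open>The Lipschitz hypothesis on \<open>f\<close> speaks of \<open>t > 0\<close>,
      the extension of the nonnegative times; they differ by one point.\<close>
    have "AE s in lebesgue. s \<noteq> (0::real)"
      using AE_completion[OF AE_lborel_singleton[of 0]] by simp
    then show "AE s in lebesgue. \<forall>x y. norm (f' s x - f' s y) \<le> lf s * norm (x - y)"
      using assms(20) by eventually_elim (auto simp: f'_def lf_def ext0_def)
    show "0 \<le> K" using K1 K by simp
    show "kconv (\<lambda>s. ennreal (lf s)) t \<le> ennreal K" for t using K1(2)[of t] K(1) by (auto intro: order_trans ennreal_leI)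
    show "kconv (\<lambda>s. ennreal (lg s)) t \<le> ennreal K" for t using K2(2)[of t] K(2) by (auto intro: order_trans ennreal_leI)
    show "kconv (\<lambda>s. ennreal (norm (g' s 0))) t \<le> ennreal K" for t using K3(2)[of t] K(3) by (auto intro: order_trans ennreal_leI)
    show "kconv (\<lambda>s. ennreal (norm (h' s 0))) t \<le> ennreal K" for t using K4(2)[of t] K(4) by (auto intro: order_trans ennreal_leI)
    show "small_near b (\<lambda>s. ennreal (norm (g' s 0)))" for b
      by (intro small_near_Lp[OF exps(2) ng norm_ge_zero] nn_integral_windows_finite) (measurable, simp add: g_win)
    show "small_near b (\<lambda>s. ennreal (norm (h' s 0)))" for b
      by (intro small_near_Lp[OF order_refl nh norm_ge_zero] nn_integral_windows_finite) (measurable, simp add: h_win)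
    show "((\<lambda>t. blinfun_apply (T t) u\<^sub>0) \<longlongrightarrow> u\<^sub>0) (at_right 0)"
      using assms(6) by (simp add: point_of_continuity_def)
    show "\<exists>m. \<forall>t\<ge>m. kconv (\<lambda>s. ennreal (norm (h' s x))) t \<le> ennreal \<epsilon>" if "\<epsilon> > 0" for \<epsilon> x
      by (rule h_kconv(2)) (assumption | rule that)+
    show "0 \<le> \<theta>" "\<theta> < 1" by (rule \<theta>)+
    show "iter_kernel lf n t \<le> ennreal \<theta>" for t by (rule iter_kernel)
  qed (fact g_sm h_sm lf_meas lg_meas lf0 lg0 lf_bdd g_ap)+

  \<comment> \<open>For an asymptotically almost periodic \<open>v\<close> the composition is
    admissible, so the integral exists and equals \<open>Tconv\<close>. The equation is asked for
    \<open>t \<ge> 0\<close> only, and so is uniqueness.\<close>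
  have mild: "mild_solution T f u\<^sub>0 v \<longleftrightarrow> (\<forall>t\<ge>0. \<Upsilon> v t = v t)" if v: "asymptotically_almost_periodic v" for v
  proof -
    have "has_strong_bochner_integral (lebesgue_on {0..t}) (\<lambda>s. blinfun_apply (T (t - s)) (f s (v s))) J \<longleftrightarrow> J = Tconv (F v) t" if "0 \<le> t" for t J
    proof -
      have "has_strong_bochner_integral (lebesgue_on {0..t}) (\<lambda>s. blinfun_apply (T (t - s)) (f s (v s))) J
          \<longleftrightarrow> has_strong_bochner_integral (lebesgue_on {0..t}) (\<lambda>s. blinfun_apply (T (t - s)) (F v s)) J"
        by (rule has_strong_bochner_integral_cong) (simp add: F_def f'_def ext0_def)
      then show ?thesis using has_strong_bochner_integral_interval_iff[OF admissible_F_aap[OF v]] by simp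
    qed
    then show ?thesis
      using aap_continuous_bounded(1)[OF v] unfolding mild_solution_def \<Upsilon>_def S_def by auto
  qed
  obtain u where u: "asymptotically_almost_periodic u" "\<And>t. 0 \<le> t \<Longrightarrow> \<Upsilon> u t = u t"
    using Upsilon_fixed_exists by blast
  show ?thesis
  proof (intro exI conjI allI impI)
    show "mild_solution T f u\<^sub>0 u" using mild[OF u(1)] u(2) by blast
    show "asymptotically_almost_periodic u" by (rule u(1))
    fix v :: "real \<Rightarrow> 'a" and t :: real
    assume v: "mild_solution T f u\<^sub>0 v \<and> asymptotically_almost_periodic v" and t: "0 \<le> t"
    then have "\<And>t. 0 \<le> t \<Longrightarrow> \<Upsilon> v t = v t" using mild[of v] by blast
    from Upsilon_fixed_unique[OF conjunct2[OF v] u(1) this u(2) t] show "v t = u t" .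
  qed
qed

end
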